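(* Let $n\ge3$ and let $q\in\mathbb{C}\setminus\{0\}$ not be a root of unity. With the nonclassical type representations $T_{\epsilon,{\bf m}_n}$ and the classical type representations $T_{{\bf m}_n}$ of $U'_q({\rm so}_n)$ defined in the context: (1) For every nonclassically admissible pair $(\epsilon,{\bf m}_n)$, the representation $T_{\epsilon,{\bf m}_n}$ is irreducible. (2) If $(\epsilon,{\bf m}_n)$ and $(\epsilon',{\bf m}'_n)$ are nonclassically admissible pairs with $(\epsilon,{\bf m}_n)\ne(\epsilon',{\bf m}'_n)$, then $T_{\epsilon,{\bf m}_n}$ and $T_{\epsilon',{\bf m}'_n}$ are not equivalent. (3) For every nonclassically admissible pair $(\epsilon,{\bf m}_n)$ and every classically admissible ${\bf m}'_n$, the representations $T_{\epsilon,{\bf m}_n}$ and $T_{{\bf m}'_n}$ are not equivalent.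
   Context: **Algebra.** $U'_q({\rm so}_n)$ is the associative unital complex algebra generated by $I_{i,i-1}$, $i=2,\dots,n$, with relations $I_{i+1,i}I_{i,i-1}^2-(q+q^{-1})I_{i,i-1}I_{i+1,i}I_{i,i-1}+I_{i,i-1}^2I_{i+1,i}=-I_{i+1,i}$, $I_{i+1,i}^2I_{i,i-1}-(q+q^{-1})I_{i+1,i}I_{i,i-1}I_{i+1,i}+I_{i,i-1}I_{i+1,i}^2=-I_{i,i-1}$ and $[I_{i,i-1},I_{j,j-1}]=0$ for $|i-j|>1$. **Notation.** Fix a square root $q^{1/2}$ of $q$, which defines $q^a$ for $a\in\frac12\mathbb{Z}$. Put $[a]=\dfrac{q^a-q^{-a}}{q-q^{-1}}$ and $[a]_+=\dfrac{q^a+q^{-a}}{q-q^{-1}}$. Empty products are $1$ and empty sums are $0$. "Half-integral" means in $\frac12+\mathbb{Z}$. An array $\xi_n=({\bf m}_n,{\bf m}_{n-1},\dots,{\bf m}_2)$ has rows ${\bf m}_k=(m_{1,k},\dots,m_{\lfloor k/2\rfloor,k})$. Put $l_{j,2p+1}=m_{j,2p+1}+p-j+1$ and $l_{j,2p}=m_{j,2p}+p-j$. The symbol $(\xi_n)^{\pm j}_k$ denotes the array obtained from $\xi_n$ by replacing $m_{j,k}$ by $m_{j,k}\pm1$. Define $$A^j_{2p}(\xi_n)=\left(\frac{\prod_{i=1}^p[l_{i,2p+1}+l_{j,2p}][l_{i,2p+1}-l_{j,2p}-1]\prod_{i=1}^{p-1}[l_{i,2p-1}+l_{j,2p}][l_{i,2p-1}-l_{j,2p}-1]}{\prod_{1\le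 i\le p,\,i\ne j}[l_{i,2p}+l_{j,2p}][l_{i,2p}-l_{j,2p}][l_{i,2p}+l_{j,2p}+1][l_{i,2p}-l_{j,2p}-1]}\right)^{1/2},$$ $$B^j_{2p-1}(\xi_n)=\left(\frac{\prod_{i=1}^p[l_{i,2p}+l_{j,2p-1}][l_{i,2p}-l_{j,2p-1}]\prod_{i=1}^{p-1}[l_{i,2p-2}+l_{j,2p-1}][l_{i,2p-2}-l_{j,2p-1}]}{\prod_{1\le i\le p-1,\,i\ne j}[l_{i,2p-1}+l_{j,2p-1}][l_{i,2p-1}-l_{j,2p-1}][l_{i,2p-1}+l_{j,2p-1}-1][l_{i,2p-1}-l_{j,2p-1}-1]}\right)^{1/2}.$$ **Conventions (both types).** In the formulas for operators, a term whose array is not a tableau of the relevant type is omitted (taken as $0$). In every remaining term all brackets in $A$ and $B$ have nonzero integer arguments, and the numbers of negative arguments in the numerator and in the denominator are even. So each $[x]$ may be replaced by $[|x|]$ under the root. The square root is then taken factor by factor, with one square root $[k]^{1/2}$ fixed once and for all for each positive integer $k$ (for $q>0$, the positive root). All $l$'s outside the arguments of $A,B$ are those of $\xi_n$, and $A^j_{2p}((\xi_n)^{-j}_{2p})$, $B^j_{2p-1}((\xi_n)^{-j}_{2p-1})$ are computed from the changed tableau. Formulas for $I_{2p+1,2p}$ hold for $2\le2p\le n-1$, those for $I_{2p,2p-1}$ for $2\le 2p\le n$. **Nonclassical type.** A pair $(\epsilon,{\bf m}_n)$ is nonclassically admissible if $\epsilon=(\epsilon_2,\dots,\epsilon_n)$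 with $\epsilon_i\in\{1,-1\}$ and ${\bf m}_n$ has half-integral entries with $m_{1,n}\ge m_{2,n}\ge\dots\ge m_{\lfloor n/2\rfloor,n}\ge\frac12$. The space of $T_{\epsilon,{\bf m}_n}$ has basis $|\xi_n\rangle$ indexed by arrays (tableaux) with top row ${\bf m}_n$, all entries half-integral, and $$m_{1,2p+1}\ge m_{1,2p}\ge m_{2,2p+1}\ge\dots\ge m_{p,2p+1}\ge m_{p,2p}\ge\tfrac12,$$ $$m_{1,2p}\ge m_{1,2p-1}\ge m_{2,2p}\ge\dots\ge m_{p-1,2p-1}\ge m_{p,2p}$$ for consecutive rows. The operators are $$T_{\epsilon,{\bf m}_n}(I_{2p+1,2p})|\xi_n\rangle=\delta_{m_{p,2p},1/2}\frac{\epsilon_{2p+1}}{q^{1/2}-q^{-1/2}}D_{2p}(\xi_n)|\xi_n\rangle+\sum_{j=1}^p\frac{A^j_{2p}(\xi_n)}{q^{l_{j,2p}}-q^{-l_{j,2p}}}|(\xi_n)^{+j}_{2p}\rangle-\sum_{j=1}^p\frac{A^j_{2p}((\xi_n)^{-j}_{2p})}{q^{l_{j,2p}}-q^{-l_{j,2p}}}|(\xi_n)^{-j}_{2p}\rangle$$ (with $\delta$ the Kronecker symbol; the last sum runs from $1$ to $p-1$ if $m_{p,2p}=\frac12$) and $$T_{\epsilon,{\bf m}_n}(I_{2p,2p-1})|\xi_n\rangle=\sum_{j=1}^{p-1}\frac{B^j_{2p-1}(\xi_n)}{[2l_{j,2p-1}-1][l_{j,2p-1}]_+}|(\xi_n)^{+j}_{2p-1}\rangle-\sum_{j=1}^{p-1}\frac{B^j_{2p-1}((\xi_n)^{-j}_{2p-1})}{[2l_{j,2p-1}-1][l_{j,2p-1}-1]_+}|(\xi_n)^{-j}_{2p-1}\rangle+\epsilon_{2p}\hat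 C_{2p-1}(\xi_n)|\xi_n\rangle,$$ where $$\hat C_{2p-1}(\xi_n)=\frac{\prod_{s=1}^p[l_{s,2p}]_+\prod_{s=1}^{p-1}[l_{s,2p-2}]_+}{\prod_{s=1}^{p-1}[l_{s,2p-1}]_+[l_{s,2p-1}-1]_+},\qquad D_{2p}(\xi_n)=\frac{\prod_{i=1}^p[l_{i,2p+1}-\frac12]\prod_{i=1}^{p-1}[l_{i,2p-1}-\frac12]}{\prod_{i=1}^{p-1}[l_{i,2p}+\frac12][l_{i,2p}-\frac12]}.$$ These operators satisfy the defining relations, so $T_{\epsilon,{\bf m}_n}$ is a representation of $U'_q({\rm so}_n)$. **Classical type.** ${\bf m}_n$ is classically admissible if its entries are all integral or all half-integral and $m_{1,n}\ge\dots\ge m_{p,n}\ge0$ when $n=2p+1$, respectively $m_{1,n}\ge\dots\ge m_{p-1,n}\ge|m_{p,n}|$ when $n=2p$. The space of $T_{{\bf m}_n}$ has basis $|\xi_n\rangle$ indexed by arrays (tableaux) with top row ${\bf m}_n$, all entries integral or all half-integral (as for ${\bf m}_n$), and $$m_{1,2p+1}\ge m_{1,2p}\ge m_{2,2p+1}\ge\dots\ge m_{p,2p+1}\ge m_{p,2p}\ge-m_{p,2p+1},$$ $$m_{1,2p}\ge m_{1,2p-1}\ge m_{2,2p}\ge\dots\ge m_{p-1,2p-1}\ge|m_{p,2p}|$$ for consecutive rows. The operators are $$T_{{\bf m}_n}(I_{2p+1,2p})|\xi_n\rangle=\sum_{j=1}^p\frac{A^j_{2p}(\xi_n)}{q^{l_{j,2p}}+q^{-l_{j,2p}}}|(\xi_n)^{+j}_{2p}\rangle-\sum_{j=1}^p\frac{A^j_{2p}((\xi_n)^{-j}_{2p})}{q^{l_{j,2p}}+q^{-l_{j,2p}}}|(\xi_n)^{-j}_{2p}\rangle,$$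 $$T_{{\bf m}_n}(I_{2p,2p-1})|\xi_n\rangle=\sum_{j=1}^{p-1}\frac{B^j_{2p-1}(\xi_n)}{[2l_{j,2p-1}-1][l_{j,2p-1}]}|(\xi_n)^{+j}_{2p-1}\rangle-\sum_{j=1}^{p-1}\frac{B^j_{2p-1}((\xi_n)^{-j}_{2p-1})}{[2l_{j,2p-1}-1][l_{j,2p-1}-1]}|(\xi_n)^{-j}_{2p-1}\rangle+\mathrm{i}\,C_{2p-1}(\xi_n)|\xi_n\rangle,$$ where $\mathrm{i}=\sqrt{-1}$ and $$C_{2p-1}(\xi_n)=\frac{\prod_{s=1}^p[l_{s,2p}]\prod_{s=1}^{p-1}[l_{s,2p-2}]}{\prod_{s=1}^{p-1}[l_{s,2p-1}][l_{s,2p-1}-1]},$$ with $C_{2p-1}(\xi_n):=0$ whenever $l_{p,2p}=m_{p,2p}=0$. It is known that $T_{{\bf m}_n}$ is a representation of $U'_q({\rm so}_n)$. *)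

theory Defs
  imports Complex_Main "HOL-Library.Poly_Mapping" "HOL-Library.FuncSet" "HOL-Algebra.QuotRing"
begin

text \<open>Words under concatenation form the free monoid, so finitely supported maps from words to
  complex numbers, with the convolution product, form the free associative unital complex algebra.
  The letter \<open>i\<close> stands for the generator \<open>I\<^bsub>i,i-1\<^esub>\<close>.\<close>

datatype word = Word (letters: "nat list")

instantiation word :: monoid_add
begin

definition zero_word :: word where "0 = Word []"

definition plus_word :: "word \<Rightarrow> word \<Rightarrow> word"
  where "v + w = Word (letters v @ letters w)"

instance by standard (simp_all add: zero_word_def plus_word_def)

end

type_synonym ncpoly = "word \<Rightarrow>\<^sub>0 complex"

definition gen :: "nat \<Rightarrow> ncpoly"
  where "gen i = Poly_Mapping.single (Word [i]) 1"

definition scalar :: "complex \<Rightarrow> ncpoly"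
  where "scalar c = Poly_Mapping.single 0 c"

definition free_algebra :: "nat \<Rightarrow> ncpoly ring"
  where "free_algebra n =
    \<lparr>carrier = {a. \<forall>w \<in> Poly_Mapping.keys a. set (letters w) \<subseteq> {2..n}},
     mult = (*), one = 1, zero = 0, add = (+)\<rparr>"

definition relations :: "nat \<Rightarrow> complex \<Rightarrow> ncpoly set"
  where "relations n q =
    {gen (i+1) * gen i * gen i - scalar (q + inverse q) * gen i * gen (i+1) * gen i
       + gen i * gen i * gen (i+1) + gen (i+1) | i. 2 \<le> i \<and> i + 1 \<le> n} \<union>
    {gen (i+1) * gen (i+1) * gen i - scalar (q + inverse q) * gen (i+1) * gen i * gen (i+1)
       + gen i * gen (i+1) * gen (i+1) + gen i | i. 2 \<le> i \<and> i + 1 \<le> n} \<union>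
    {gen i * gen j - gen j * gen i | i j.
       i \<in> {2..n} \<and> j \<in> {2..n} \<and> \<bar>int i - int j\<bar> > 1}"

lemma ring_free_algebra: "ring (free_algebra n)"
proof -
  have closed_mult: "set (letters w) \<subseteq> {2..n}"
    if "\<forall>w \<in> Poly_Mapping.keys a. set (letters w) \<subseteq> {2..n}"
      and "\<forall>w \<in> Poly_Mapping.keys b. set (letters w) \<subseteq> {2..n}"
      and "w \<in> Poly_Mapping.keys (a * b)" for a b :: ncpoly and w
  proof -
    from that(3) obtain u v where uv: "u \<in> Poly_Mapping.keys a" "v \<in> Poly_Mapping.keys b" "w = u + v"
      using Poly_Mapping.keys_mult[of a b] by blast
    have "set (letters u) \<subseteq> {2..n}" "set (letters v) \<subseteq> {2..n}"
      using that(1,2) uv by blast+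
    then show ?thesis by (simp add: uv(3) plus_word_def)
  qed
  have closed_add: "set (letters w) \<subseteq> {2..n}"
    if "\<forall>w \<in> Poly_Mapping.keys a. set (letters w) \<subseteq> {2..n}"
      and "\<forall>w \<in> Poly_Mapping.keys b. set (letters w) \<subseteq> {2..n}"
      and "w \<in> Poly_Mapping.keys (a + b)" for a b :: ncpoly and w
    using Poly_Mapping.keys_add[of a b] that by blast
  have closed_one: "\<forall>w \<in> Poly_Mapping.keys (1::ncpoly). set (letters w) \<subseteq> {2..n}"
    by (simp add: zero_word_def)
  show ?thesis
  proof (rule ringI)
    show "abelian_group (free_algebra n)"
    proof (rule abelian_groupI)
      fix a assume "a \<in> carrier (free_algebra n)"
      then show "\<exists>b \<in> carrier (free_algebra n).
          b \<oplus>\<^bsub>free_algebra n\<^esub> a = \<zero>\<^bsub>free_algebra n\<^esub>"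
        by (intro bexI[of _ "- a"]) (simp_all add: free_algebra_def)
    next
      fix a b assume "a \<in> carrier (free_algebra n)" "b \<in> carrier (free_algebra n)"
      then show "a \<oplus>\<^bsub>free_algebra n\<^esub> b \<in> carrier (free_algebra n)"
        using closed_add[of a b] by (simp add: free_algebra_def)
    qed (simp_all add: free_algebra_def add.assoc add.commute)
    show "Group.monoid (free_algebra n)"
    proof (rule monoidI)
      fix a b assume "a \<in> carrier (free_algebra n)" "b \<in> carrier (free_algebra n)"
      then show "a \<otimes>\<^bsub>free_algebra n\<^esub> b \<in> carrier (free_algebra n)"
        using closed_mult[of a b] by (simp add: free_algebra_def)
    qed (use closed_one in \<open>simp_all add: free_algebra_def mult.assoc\<close>)
  qed (simp_all add: free_algebra_def distrib_left distrib_right)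
qed

lemma relations_closed: "relations n q \<subseteq> carrier (free_algebra n)"
proof -
  interpret ring "free_algebra n" by (rule ring_free_algebra)
  have g: "gen i \<in> carrier (free_algebra n)" if "2 \<le> i" "i \<le> n" for i
    using that by (simp add: free_algebra_def gen_def)
  have c: "scalar c \<in> carrier (free_algebra n)" for c
    by (simp add: free_algebra_def scalar_def zero_word_def)
  have m: "a * b \<in> carrier (free_algebra n)" and p: "a + b \<in> carrier (free_algebra n)"
    if "a \<in> carrier (free_algebra n)" "b \<in> carrier (free_algebra n)" for a b
    using m_closed[OF that] a_closed[OF that] by (simp_all add: free_algebra_def)
  have d: "a - b \<in> carrier (free_algebra n)"
    if "a \<in> carrier (free_algebra n)" "b \<in> carrier (free_algebra n)" for a b
    using p[OF that(1), of "- b"] that(2) by (simp add: free_algebra_def)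
  show ?thesis
    unfolding relations_def by (auto intro!: g c m p d)
qed

definition rel_ideal :: "nat \<Rightarrow> complex \<Rightarrow> ncpoly set"
  where "rel_ideal n q = Idl\<^bsub>free_algebra n\<^esub> (relations n q)"

lemma ideal_rel_ideal: "ideal (rel_ideal n q) (free_algebra n)"
  unfolding rel_ideal_def by (rule ring.genideal_ideal[OF ring_free_algebra relations_closed])

definition Uq :: "nat \<Rightarrow> complex \<Rightarrow> ncpoly set ring"
  where "Uq n q = free_algebra n Quot rel_ideal n q"

definition Uq_class :: "nat \<Rightarrow> complex \<Rightarrow> ncpoly \<Rightarrow> ncpoly set"
  where "Uq_class n q a = rel_ideal n q +>\<^bsub>free_algebra n\<^esub> a"

text \<open>Vectors are elements of free complex vector spaces \<open>'b \<Rightarrow>\<^sub>0 complex\<close>; the vector space with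
  basis \<open>S\<close> is the subspace of the vectors with support in \<open>S\<close>.\<close>

definition cscale :: "complex \<Rightarrow> ('b \<Rightarrow>\<^sub>0 complex) \<Rightarrow> ('b \<Rightarrow>\<^sub>0 complex)"
  where "cscale c x = Poly_Mapping.map ((*) c) x"

lemma lookup_cscale: "Poly_Mapping.lookup (cscale c x) b = c * Poly_Mapping.lookup x b"
  by (simp add: cscale_def Poly_Mapping.map.rep_eq when_def)

lemma vector_space_cscale: "vector_space cscale"
  by standard (simp_all add: poly_mapping_eq_iff fun_eq_iff lookup_cscale lookup_add algebra_simps)

definition space_on :: "'b set \<Rightarrow> ('b \<Rightarrow>\<^sub>0 complex) set"
  where "space_on S = {x. Poly_Mapping.keys x \<subseteq> S}"

abbreviation ket :: "'b \<Rightarrow> ('b \<Rightarrow>\<^sub>0 complex)"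
  where "ket b \<equiv> Poly_Mapping.single b 1"

definition linear_between ::
    "('b \<Rightarrow>\<^sub>0 complex) set \<Rightarrow> ('c \<Rightarrow>\<^sub>0 complex) set \<Rightarrow> (('b \<Rightarrow>\<^sub>0 complex) \<Rightarrow> ('c \<Rightarrow>\<^sub>0 complex)) \<Rightarrow> bool"
  where "linear_between V W f \<longleftrightarrow>
    (\<forall>x\<in>V. f x \<in> W) \<and>
    (\<forall>x\<in>V. \<forall>y\<in>V. f (x + y) = f x + f y) \<and>
    (\<forall>c. \<forall>x\<in>V. f (cscale c x) = cscale c (f x))"

text \<open>A representation on \<open>V\<close> is a homomorphism of unital complex algebras into the linear
  endomorphisms of \<open>V\<close>. Operators are compared on \<open>V\<close> only.\<close>

definition is_representation ::
    "nat \<Rightarrow> complex \<Rightarrow> ('b \<Rightarrow>\<^sub>0 complex) set \<Rightarrow>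
     (ncpoly set \<Rightarrow> ('b \<Rightarrow>\<^sub>0 complex) \<Rightarrow> ('b \<Rightarrow>\<^sub>0 complex)) \<Rightarrow> bool"
  where "is_representation n q V \<rho> \<longleftrightarrow>
    (\<forall>u \<in> carrier (Uq n q). linear_between V V (\<rho> u)) \<and>
    (\<forall>u \<in> carrier (Uq n q). \<forall>v \<in> carrier (Uq n q). \<forall>x\<in>V.
       \<rho> (u \<oplus>\<^bsub>Uq n q\<^esub> v) x = \<rho> u x + \<rho> v x \<and>
       \<rho> (u \<otimes>\<^bsub>Uq n q\<^esub> v) x = \<rho> u (\<rho> v x)) \<and>
    (\<forall>c. \<forall>x\<in>V. \<rho> (Uq_class n q (scalar c)) x = cscale c x)"

definition irreducible_representation ::
    "nat \<Rightarrow> complex \<Rightarrow> ('b \<Rightarrow>\<^sub>0 complex) set \<Rightarrow>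
     (ncpoly set \<Rightarrow> ('b \<Rightarrow>\<^sub>0 complex) \<Rightarrow> ('b \<Rightarrow>\<^sub>0 complex)) \<Rightarrow> bool"
  where "irreducible_representation n q V \<rho> \<longleftrightarrow>
    is_representation n q V \<rho> \<and> V \<noteq> {0} \<and>
    (\<forall>W. module.subspace cscale W \<and> W \<subseteq> V \<and>
         (\<forall>u \<in> carrier (Uq n q). \<forall>x\<in>W. \<rho> u x \<in> W) \<longrightarrow> W = {0} \<or> W = V)"

definition equivalent_representations ::
    "nat \<Rightarrow> complex \<Rightarrow>
     ('b \<Rightarrow>\<^sub>0 complex) set \<Rightarrow> (ncpoly set \<Rightarrow> ('b \<Rightarrow>\<^sub>0 complex) \<Rightarrow> ('b \<Rightarrow>\<^sub>0 complex)) \<Rightarrow>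
     ('c \<Rightarrow>\<^sub>0 complex) set \<Rightarrow> (ncpoly set \<Rightarrow> ('c \<Rightarrow>\<^sub>0 complex) \<Rightarrow> ('c \<Rightarrow>\<^sub>0 complex)) \<Rightarrow> bool"
  where "equivalent_representations n q V \<rho> V' \<rho>' \<longleftrightarrow>
    (\<exists>\<phi>. linear_between V V' \<phi> \<and> bij_betw \<phi> V V' \<and>
         (\<forall>u \<in> carrier (Uq n q). \<forall>x\<in>V. \<phi> (\<rho> u x) = \<rho>' u (\<phi> x)))"

text \<open>Throughout, \<open>s\<close> is the fixed square root of \<open>q\<close>, and exponents lie in \<open>\<int>/2\<close>, so that
  \<open>q\<^sup>a = s\<^sup>2\<^sup>a\<close>.\<close>

definition qpow :: "complex \<Rightarrow> rat \<Rightarrow> complex"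
  where "qpow s a = s powi \<lfloor>2 * a\<rfloor>"

definition qbr :: "complex \<Rightarrow> rat \<Rightarrow> complex"
  where "qbr s a = (qpow s a - qpow s (- a)) / (qpow s 1 - qpow s (- 1))"

definition qbr_plus :: "complex \<Rightarrow> rat \<Rightarrow> complex"
  where "qbr_plus s a = (qpow s a + qpow s (- a)) / (qpow s 1 - qpow s (- 1))"

definition bracket_roots :: "complex \<Rightarrow> (nat \<Rightarrow> complex) \<Rightarrow> bool"
  where "bracket_roots s r \<longleftrightarrow>
    (\<forall>k\<ge>1. (r k)\<^sup>2 = qbr s (of_nat k)) \<and>
    (s\<^sup>2 \<in> \<real> \<and> Re (s\<^sup>2) > 0 \<longrightarrow> (\<forall>k\<ge>1. r k \<in> \<real> \<and> Re (r k) > 0))"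

text \<open>The root \<open>[\<bar>x\<bar>]\<^bsup>1/2\<^esup>\<close> of a bracket with nonzero integral argument \<open>x\<close>.\<close>

definition rt :: "(nat \<Rightarrow> complex) \<Rightarrow> rat \<Rightarrow> complex"
  where "rt r x = r (nat \<lfloor>\<bar>x\<bar>\<rfloor>)"

text \<open>The entry \<open>m\<^bsub>j,k\<^esub>\<close> of the array \<open>\<xi>\<close> is \<open>\<xi> (j, k)\<close>.\<close>

type_synonym arr = "nat \<times> nat \<Rightarrow> rat"

definition half_integers :: "rat set"
  where "half_integers = {a. a - 1/2 \<in> \<int>}"

definition positions :: "nat \<Rightarrow> (nat \<times> nat) set"
  where "positions n = {(j, k). 2 \<le> k \<and> k \<le> n \<and> 1 \<le> j \<and> j \<le> k div 2}"

definition shift_up :: "arr \<Rightarrow> nat \<Rightarrow> nat \<Rightarrow> arr"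
  where "shift_up \<xi> j k = \<xi>((j, k) := \<xi> (j, k) + 1)"

definition shift_down :: "arr \<Rightarrow> nat \<Rightarrow> nat \<Rightarrow> arr"
  where "shift_down \<xi> j k = \<xi>((j, k) := \<xi> (j, k) - 1)"

definition l :: "arr \<Rightarrow> nat \<Rightarrow> nat \<Rightarrow> rat"
  where "l \<xi> j k = \<xi> (j, k) + of_nat (k div 2) - of_nat j + (if odd k then 1 else 0)"

definition nonclassically_admissible :: "nat \<Rightarrow> (nat \<Rightarrow> int) \<Rightarrow> (nat \<Rightarrow> rat) \<Rightarrow> bool"
  where "nonclassically_admissible n \<epsilon> m \<longleftrightarrow>
    \<epsilon> \<in> {2..n} \<rightarrow>\<^sub>E {1, -1} \<and> m \<in> {1..n div 2} \<rightarrow>\<^sub>E half_integers \<and>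
    (\<forall>j\<in>{1..<n div 2}. m j \<ge> m (j+1)) \<and> m (n div 2) \<ge> 1/2"

definition nonclassical_tableaux :: "nat \<Rightarrow> (nat \<Rightarrow> rat) \<Rightarrow> arr set"
  where "nonclassical_tableaux n m = {\<xi> \<in> positions n \<rightarrow>\<^sub>E half_integers.
    (\<forall>j\<in>{1..n div 2}. \<xi> (j, n) = m j) \<and>
    (\<forall>p. 2 \<le> 2*p \<and> 2*p+1 \<le> n \<longrightarrow>
       (\<forall>i\<in>{1..p}. \<xi> (i, 2*p+1) \<ge> \<xi> (i, 2*p)) \<and>
       (\<forall>i\<in>{1..<p}. \<xi> (i, 2*p) \<ge> \<xi> (i+1, 2*p+1)) \<and>
       \<xi> (p, 2*p) \<ge> 1/2) \<and>
    (\<forall>p. 2 \<le> 2*p-1 \<and> 2*p \<le> n \<longrightarrow>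
       (\<forall>i\<in>{1..<p}. \<xi> (i, 2*p) \<ge> \<xi> (i, 2*p-1) \<and> \<xi> (i, 2*p-1) \<ge> \<xi> (i+1, 2*p)))}"

definition classically_admissible :: "nat \<Rightarrow> (nat \<Rightarrow> rat) \<Rightarrow> bool"
  where "classically_admissible n m \<longleftrightarrow>
    (m \<in> {1..n div 2} \<rightarrow>\<^sub>E \<int> \<or> m \<in> {1..n div 2} \<rightarrow>\<^sub>E half_integers) \<and>
    (if odd n then (\<forall>j\<in>{1..<n div 2}. m j \<ge> m (j+1)) \<and> m (n div 2) \<ge> 0
     else (\<forall>j\<in>{1..<n div 2 - 1}. m j \<ge> m (j+1)) \<and> m (n div 2 - 1) \<ge> \<bar>m (n div 2)\<bar>)"

definition classical_tableaux :: "nat \<Rightarrow> (nat \<Rightarrow> rat) \<Rightarrow> arr set"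
  where "classical_tableaux n m =
    {\<xi> \<in> (positions n \<rightarrow>\<^sub>E \<int>) \<union> (positions n \<rightarrow>\<^sub>E half_integers).
    (\<forall>j\<in>{1..n div 2}. \<xi> (j, n) = m j) \<and>
    (\<forall>p. 2 \<le> 2*p \<and> 2*p+1 \<le> n \<longrightarrow>
       (\<forall>i\<in>{1..p}. \<xi> (i, 2*p+1) \<ge> \<xi> (i, 2*p)) \<and>
       (\<forall>i\<in>{1..<p}. \<xi> (i, 2*p) \<ge> \<xi> (i+1, 2*p+1)) \<and>
       \<xi> (p, 2*p) \<ge> - \<xi> (p, 2*p+1)) \<and>
    (\<forall>p. 2 \<le> 2*p-1 \<and> 2*p \<le> n \<longrightarrow>
       (\<forall>i\<in>{1..<p}. \<xi> (i, 2*p) \<ge> \<xi> (i, 2*p-1)) \<and>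
       (\<forall>i\<in>{1..<p-1}. \<xi> (i, 2*p-1) \<ge> \<xi> (i+1, 2*p)) \<and>
       \<xi> (p-1, 2*p-1) \<ge> \<bar>\<xi> (p, 2*p)\<bar>)}"

text \<open>\<open>coeff_A r p j \<xi>\<close> is \<open>A\<^bsup>j\<^esup>\<^bsub>2p\<^esub>(\<xi>)\<close> and \<open>coeff_B r p j \<xi>\<close> is \<open>B\<^bsup>j\<^esup>\<^bsub>2p-1\<^esub>(\<xi>)\<close>, with the root taken
  factor by factor; the other coefficients are indexed by \<open>p\<close> in the same way.\<close>

definition coeff_A :: "(nat \<Rightarrow> complex) \<Rightarrow> nat \<Rightarrow> nat \<Rightarrow> arr \<Rightarrow> complex"
  where "coeff_A r p j \<xi> =
    (\<Prod>i=1..p. rt r (l \<xi> i (2*p+1) + l \<xi> j (2*p)) * rt r (l \<xi> i (2*p+1) - l \<xi> j (2*p) - 1)) *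
    (\<Prod>i=1..p-1. rt r (l \<xi> i (2*p-1) + l \<xi> j (2*p)) * rt r (l \<xi> i (2*p-1) - l \<xi> j (2*p) - 1)) /
    (\<Prod>i\<in>{1..p}-{j}. rt r (l \<xi> i (2*p) + l \<xi> j (2*p)) * rt r (l \<xi> i (2*p) - l \<xi> j (2*p)) *
       rt r (l \<xi> i (2*p) + l \<xi> j (2*p) + 1) * rt r (l \<xi> i (2*p) - l \<xi> j (2*p) - 1))"

definition coeff_B :: "(nat \<Rightarrow> complex) \<Rightarrow> nat \<Rightarrow> nat \<Rightarrow> arr \<Rightarrow> complex"
  where "coeff_B r p j \<xi> =
    (\<Prod>i=1..p. rt r (l \<xi> i (2*p) + l \<xi> j (2*p-1)) * rt r (l \<xi> i (2*p) - l \<xi> j (2*p-1))) *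
    (\<Prod>i=1..p-1. rt r (l \<xi> i (2*p-2) + l \<xi> j (2*p-1)) * rt r (l \<xi> i (2*p-2) - l \<xi> j (2*p-1))) /
    (\<Prod>i\<in>{1..p-1}-{j}. rt r (l \<xi> i (2*p-1) + l \<xi> j (2*p-1)) * rt r (l \<xi> i (2*p-1) - l \<xi> j (2*p-1)) *
       rt r (l \<xi> i (2*p-1) + l \<xi> j (2*p-1) - 1) * rt r (l \<xi> i (2*p-1) - l \<xi> j (2*p-1) - 1))"

definition coeff_C_hat :: "complex \<Rightarrow> nat \<Rightarrow> arr \<Rightarrow> complex"
  where "coeff_C_hat s p \<xi> =
    (\<Prod>i=1..p. qbr_plus s (l \<xi> i (2*p))) * (\<Prod>i=1..p-1. qbr_plus s (l \<xi> i (2*p-2))) /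
    (\<Prod>i=1..p-1. qbr_plus s (l \<xi> i (2*p-1)) * qbr_plus s (l \<xi> i (2*p-1) - 1))"

definition coeff_D :: "complex \<Rightarrow> nat \<Rightarrow> arr \<Rightarrow> complex"
  where "coeff_D s p \<xi> =
    (\<Prod>i=1..p. qbr s (l \<xi> i (2*p+1) - 1/2)) * (\<Prod>i=1..p-1. qbr s (l \<xi> i (2*p-1) - 1/2)) /
    (\<Prod>i=1..p-1. qbr s (l \<xi> i (2*p) + 1/2) * qbr s (l \<xi> i (2*p) - 1/2))"

definition coeff_C :: "complex \<Rightarrow> nat \<Rightarrow> arr \<Rightarrow> complex"
  where "coeff_C s p \<xi> =
    (if l \<xi> p (2*p) = 0 then 0 else
      (\<Prod>i=1..p. qbr s (l \<xi> i (2*p))) * (\<Prod>i=1..p-1. qbr s (l \<xi> i (2*p-2))) /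
      (\<Prod>i=1..p-1. qbr s (l \<xi> i (2*p-1)) * qbr s (l \<xi> i (2*p-1) - 1)))"

text \<open>The term \<open>c |\<xi>\<rangle>\<close>, omitted if \<open>\<xi>\<close> is not a tableau. In particular, lowering an entry
  \<open>m\<^bsub>p,2p\<^esub> = 1/2\<close> of a nonclassical tableau contributes nothing.\<close>

definition tableau_term :: "arr set \<Rightarrow> complex \<Rightarrow> arr \<Rightarrow> (arr \<Rightarrow>\<^sub>0 complex)"
  where "tableau_term S c \<xi> = (if \<xi> \<in> S then cscale c (ket \<xi>) else 0)"

definition nonclassical_odd ::
    "complex \<Rightarrow> (nat \<Rightarrow> complex) \<Rightarrow> nat \<Rightarrow> (nat \<Rightarrow> int) \<Rightarrow> (nat \<Rightarrow> rat) \<Rightarrow> nat \<Rightarrow> arr \<Rightarrow> (arr \<Rightarrow>\<^sub>0 complex)"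
  where "nonclassical_odd s r n \<epsilon> m p \<xi> =
    (let S = nonclassical_tableaux n m; den = (\<lambda>j. qpow s (l \<xi> j (2*p)) - qpow s (- l \<xi> j (2*p))) in
      cscale ((if \<xi> (p, 2*p) = 1/2 then 1 else 0) *
        (of_int (\<epsilon> (2*p+1)) / (qpow s (1/2) - qpow s (- 1/2)) * coeff_D s p \<xi>)) (ket \<xi>)
      + (\<Sum>j=1..p. tableau_term S (coeff_A r p j \<xi> / den j) (shift_up \<xi> j (2*p)))
      - (\<Sum>j=1..p. tableau_term S (coeff_A r p j (shift_down \<xi> j (2*p)) / den j)
                    (shift_down \<xi> j (2*p))))"

definition nonclassical_even ::
    "complex \<Rightarrow> (nat \<Rightarrow> complex) \<Rightarrow> nat \<Rightarrow> (nat \<Rightarrow> int) \<Rightarrow> (nat \<Rightarrow> rat) \<Rightarrow> nat \<Rightarrow> arr \<Rightarrow> (arr \<Rightarrow>\<^sub>0 complex)"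
  where "nonclassical_even s r n \<epsilon> m p \<xi> =
    (let S = nonclassical_tableaux n m; y = (\<lambda>j. l \<xi> j (2*p-1)) in
      (\<Sum>j=1..p-1. tableau_term S
          (coeff_B r p j \<xi> / (qbr s (2 * y j - 1) * qbr_plus s (y j))) (shift_up \<xi> j (2*p-1)))
      - (\<Sum>j=1..p-1. tableau_term S
          (coeff_B r p j (shift_down \<xi> j (2*p-1)) / (qbr s (2 * y j - 1) * qbr_plus s (y j - 1)))
          (shift_down \<xi> j (2*p-1)))
      + cscale (of_int (\<epsilon> (2*p)) * coeff_C_hat s p \<xi>) (ket \<xi>))"

definition classical_odd ::
    "complex \<Rightarrow> (nat \<Rightarrow> complex) \<Rightarrow> nat \<Rightarrow> (nat \<Rightarrow> rat) \<Rightarrow> nat \<Rightarrow> arr \<Rightarrow> (arr \<Rightarrow>\<^sub>0 complex)"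
  where "classical_odd s r n m p \<xi> =
    (let S = classical_tableaux n m; den = (\<lambda>j. qpow s (l \<xi> j (2*p)) + qpow s (- l \<xi> j (2*p))) in
      (\<Sum>j=1..p. tableau_term S (coeff_A r p j \<xi> / den j) (shift_up \<xi> j (2*p)))
      - (\<Sum>j=1..p. tableau_term S (coeff_A r p j (shift_down \<xi> j (2*p)) / den j)
                    (shift_down \<xi> j (2*p))))"

definition classical_even ::
    "complex \<Rightarrow> (nat \<Rightarrow> complex) \<Rightarrow> nat \<Rightarrow> (nat \<Rightarrow> rat) \<Rightarrow> nat \<Rightarrow> arr \<Rightarrow> (arr \<Rightarrow>\<^sub>0 complex)"
  where "classical_even s r n m p \<xi> =
    (let S = classical_tableaux n m; y = (\<lambda>j. l \<xi> j (2*p-1)) in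
      (\<Sum>j=1..p-1. tableau_term S
          (coeff_B r p j \<xi> / (qbr s (2 * y j - 1) * qbr s (y j))) (shift_up \<xi> j (2*p-1)))
      - (\<Sum>j=1..p-1. tableau_term S
          (coeff_B r p j (shift_down \<xi> j (2*p-1)) / (qbr s (2 * y j - 1) * qbr s (y j - 1)))
          (shift_down \<xi> j (2*p-1)))
      + cscale (\<i> * coeff_C s p \<xi>) (ket \<xi>))"

text \<open>A representation is determined by the images of the generators on a basis, so each of the
  following predicates holds for at most one \<open>\<rho>\<close>, up to its values outside \<open>U'\<^sub>q(so\<^sub>n)\<close> and outside
  the representation space.\<close>

definition nonclassical_rep ::
    "complex \<Rightarrow> (nat \<Rightarrow> complex) \<Rightarrow> nat \<Rightarrow> complex \<Rightarrow> (nat \<Rightarrow> int) \<Rightarrow> (nat \<Rightarrow> rat) \<Rightarrow>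
     (ncpoly set \<Rightarrow> (arr \<Rightarrow>\<^sub>0 complex) \<Rightarrow> (arr \<Rightarrow>\<^sub>0 complex)) \<Rightarrow> bool"
  where "nonclassical_rep s r n q \<epsilon> m \<rho> \<longleftrightarrow>
    is_representation n q (space_on (nonclassical_tableaux n m)) \<rho> \<and>
    (\<forall>\<xi> \<in> nonclassical_tableaux n m.
      (\<forall>p. 2 \<le> 2*p \<and> 2*p \<le> n - 1 \<longrightarrow>
         \<rho> (Uq_class n q (gen (2*p+1))) (ket \<xi>) = nonclassical_odd s r n \<epsilon> m p \<xi>) \<and>
      (\<forall>p. 2 \<le> 2*p \<and> 2*p \<le> n \<longrightarrow>
         \<rho> (Uq_class n q (gen (2*p))) (ket \<xi>) = nonclassical_even s r n \<epsilon> m p \<xi>))"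

definition classical_rep ::
    "complex \<Rightarrow> (nat \<Rightarrow> complex) \<Rightarrow> nat \<Rightarrow> complex \<Rightarrow> (nat \<Rightarrow> rat) \<Rightarrow>
     (ncpoly set \<Rightarrow> (arr \<Rightarrow>\<^sub>0 complex) \<Rightarrow> (arr \<Rightarrow>\<^sub>0 complex)) \<Rightarrow> bool"
  where "classical_rep s r n q m \<rho> \<longleftrightarrow>
    is_representation n q (space_on (classical_tableaux n m)) \<rho> \<and>
    (\<forall>\<xi> \<in> classical_tableaux n m.
      (\<forall>p. 2 \<le> 2*p \<and> 2*p \<le> n - 1 \<longrightarrow>
         \<rho> (Uq_class n q (gen (2*p+1))) (ket \<xi>) = classical_odd s r n m p \<xi>) \<and>
      (\<forall>p. 2 \<le> 2*p \<and> 2*p \<le> n \<longrightarrow>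
         \<rho> (Uq_class n q (gen (2*p))) (ket \<xi>) = classical_even s r n m p \<xi>))"

end

theory Submission
  imports Defs
begin

text \<open>Irreducibility and inequivalence both follow from one density statement: in two nonclassical
  representations considered simultaneously, the algebra realizes every matrix unit that replaces the
  rows up to \<open>k\<close> of a tableau by other rows with the same row \<open>k\<close> and the same signs up to \<open>k\<close>.
  This goes by induction on \<open>k\<close>. Sandwiching the generator \<open>I\<^bsub>k,k-1\<^esub>\<close> between matrix units of level
  \<open>k - 1\<close> gives single transitions, whose coefficients are nonzero because \<open>q\<close> is not a root of unity;
  they connect all tableaux with the same rows from \<open>k\<close> on, because the rows \<open>k - 1\<close> below a given row
  \<open>k\<close> form a box. Two different rows \<open>k\<close> are told apart by these boxes, and two different signs at level
  \<open>k\<close> by a nonzero diagonal coefficient, so the algebra contains the projections onto the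
  individual parts up to row \<open>k\<close>. The classical representations are separated by the eigenvalues
  \<open>\<i>[a]\<close> and \<open>\<plusminus>[b]\<^sub>+\<close> of \<open>I\<^bsub>2,1\<^esub>\<close>, which never coincide.\<close>

section \<open>Brackets\<close>

text \<open>The obstacle is the weight of a transition. Compressing I_{k,k-1} between matrix units
  of level k-1 leaves a coefficient that still depends on row k, and the algebra does not yet
  distinguish the rows k. A transition becomes a matrix unit only after the part up to row k has
  been projected out, so each level needs a separation argument that uses nothing but diagonal
  matrices already obtained. These arise as round trips: a transition followed by its reverse is
  diagonal and vanishes wherever the intermediate array is not a tableau, which makes the box of
  admissible rows visible. Treating two representations at once turns density into inequivalence: an
  element acting as a matrix unit in one and as zero in the other excludes an intertwiner. For odd k
  the sign \<epsilon>_k occurs only where the last entry of row k-1 is 1/2, so it is read off at the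
  lower corner of a box. Row 2 has no box below it; there the eigenvalue \<epsilon>_2 [l_{1,2}]_+ of
  I_{2,1} starts the separation.\<close>

lemma half_integers_E:
  assumes "a \<in> half_integers"
  obtains k :: int where "a = of_int k + 1 / 2"
proof -
  from assms obtain k :: int where "a - 1/2 = of_int k"
    by (auto simp: half_integers_def elim: Ints_cases)
  then show thesis by (intro that[of k]) (simp add: algebra_simps)
qed

lemma half_integers_add_int: "a \<in> half_integers \<Longrightarrow> b \<in> \<int> \<Longrightarrow> a + b \<in> half_integers"
  by (auto simp: half_integers_def add_diff_eq[symmetric] add.commute[of a])

lemma half_integers_add: "a \<in> half_integers \<Longrightarrow> b \<in> half_integers \<Longrightarrow> a + b \<in> \<int>"
proof (elim half_integers_E)
  fix k k' :: int assume "a = of_int k + 1/2" "b = of_int k' + 1/2"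
  then have "a + b = of_int (k + k' + 1)" by simp
  then show ?thesis by (metis Ints_of_int)
qed

lemma half_integers_diff: "a \<in> half_integers \<Longrightarrow> b \<in> half_integers \<Longrightarrow> a - b \<in> \<int>"
  by (metis (no_types, lifting) Ints_diff diff_diff_eq2 diff_add_cancel half_integers_def mem_Collect_eq)

lemma half_integers_double: "a \<in> half_integers \<Longrightarrow> 2 * a \<in> \<int>"
  using half_integers_add[of a a] by simp

lemma half_integers_half: "1 / 2 \<in> half_integers"
  by (simp add: half_integers_def)

lemma half_integers_l: "\<xi> (j, k) \<in> half_integers \<Longrightarrow> l \<xi> j k \<in> half_integers"
  unfolding l_def add_diff_eq[symmetric] add.assoc
  by (rule half_integers_add_int) auto

lemma Ints_less_imp_le: "a < b \<Longrightarrow> b - a \<in> \<int> \<Longrightarrow> a + 1 \<le> (b :: rat)"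
proof (elim Ints_cases)
  fix z assume "a < b" "b - a = of_int z"
  then have "0 < z" by (metis diff_gt_0_iff_gt of_int_0_less_iff)
  then have "1 \<le> (of_int z :: rat)" by simp
  with \<open>b - a = of_int z\<close> show ?thesis by linarith
qed

lemma double_Ints_E:
  assumes "2 * a \<in> \<int>"
  obtains k where "a = of_int k / (2 :: rat)"
proof -
  from assms obtain k where "2 * a = of_int k" by (elim Ints_cases)
  then show thesis by (intro that[of k]) simp
qed

section \<open>Half-integral powers of q and zeros of brackets\<close>

lemma qpow_half: "qpow s (of_int k / 2) = s powi k" "qpow s (- (of_int k / 2)) = s powi (- k)"
proof -
  have "\<lfloor>2 * (of_int k / (2 :: rat))\<rfloor> = k" "\<lfloor>2 * (- (of_int k / (2 :: rat)))\<rfloor> = - k"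
    by (simp_all)
  then show "qpow s (of_int k / 2) = s powi k" "qpow s (- (of_int k / 2)) = s powi (- k)"
    by (simp_all add: qpow_def)
qed

lemma minus_eq_1: "- x = 1 \<longleftrightarrow> x = (- 1 :: complex)"
  by (metis minus_minus)

text \<open>The difference of the two sides, multiplied by \<open>x * y\<close>, factors as
  \<open>(x - y) * (x * y - 1)\<close>. Eigenvalues are compared through this.\<close>

lemma add_inverse_eq_iff:
  fixes x y :: complex
  assumes "x \<noteq> 0" "y \<noteq> 0"
  shows "x + inverse x = y + inverse y \<longleftrightarrow> x = y \<or> x * y = 1"
proof -
  have "(x - y) * (x * y - 1) = (x + inverse x - (y + inverse y)) * (x * y)"
    using assms by (simp add: field_simps)
  with assms show ?thesis by (metis diff_eq_diff_eq diff_self eq_iff_diff_eq_0 mult_eq_0_iff)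
qed

locale non_root =
  fixes q s :: complex and r :: "nat \<Rightarrow> complex"
  assumes q_nonzero: "q \<noteq> 0"
    and q_power: "\<forall>k::nat. k \<ge> 1 \<longrightarrow> q ^ k \<noteq> 1"
    and s_square: "s\<^sup>2 = q"
    and roots: "bracket_roots s r"
begin

lemma s_nonzero: "s \<noteq> 0"
  using q_nonzero s_square by auto

text \<open>\<open>s\<close> is not a root of unity either: squaring a relation
  \<open>s ^ k = 1\<close> gives \<open>q ^ k = 1\<close>.\<close>

lemma s_powi_eq_1_iff: "s powi k = 1 \<longleftrightarrow> k = 0"
proof
  assume *: "s powi k = 1"
  then have "s powi \<bar>k\<bar> = 1" by (cases "k \<ge> 0") (auto simp: power_int_minus)
  then have "s ^ nat \<bar>k\<bar> = 1" by (simp add: power_int_def)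
  then have "q ^ nat \<bar>k\<bar> = 1"
    by (simp add: s_square[symmetric] power_mult[symmetric] mult.commute power_mult)
  with q_power show "k = 0" by (cases "nat \<bar>k\<bar>") (auto simp del: power_Suc)
qed simp

lemma s_powi_eq_iff: "s powi k = s powi k' \<longleftrightarrow> k = k'"
proof -
  have "s powi (k - k') = s powi k / s powi k'" by (rule power_int_diff) (use s_nonzero in simp)
  then show ?thesis using s_powi_eq_1_iff[of "k - k'"] s_nonzero by (auto simp: divide_simps)
qed

lemma s_powi_square: "(s powi k)\<^sup>2 = s powi (2 * k)"
  unfolding power2_eq_square mult_2 by (rule power_int_add[symmetric]) (simp add: s_nonzero)

text \<open>Squaring removes the sign and forces equal exponents, and then
  \<open>2 * s powi k\<close> would be zero. This is why [a]_+ has no zeros at integral or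
  half-integral a.\<close>

lemma s_powi_neq_uminus: "s powi k \<noteq> - (s powi k')"
proof
  assume *: "s powi k = - (s powi k')"
  then have "(s powi k)\<^sup>2 = (s powi k')\<^sup>2" by simp
  then have "k = k'" by (simp add: s_powi_square s_powi_eq_iff)
  with * s_nonzero show False by simp
qed

lemma qpow_diff_nonzero: "2 * a \<in> \<int> \<Longrightarrow> a \<noteq> 0 \<Longrightarrow> qpow s a - qpow s (- a) \<noteq> 0"
proof -
  assume "2 * a \<in> \<int>" "a \<noteq> 0"
  from \<open>2 * a \<in> \<int>\<close> obtain k where k: "a = of_int k / 2" by (rule double_Ints_E)
  moreover have "k \<noteq> - k" using k \<open>a \<noteq> 0\<close> by auto
  ultimately show ?thesis by (simp only: qpow_half right_minus_eq s_powi_eq_iff not_False_eq_True)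
qed

lemma qpow_add_nonzero: "2 * a \<in> \<int> \<Longrightarrow> qpow s a + qpow s (- a) \<noteq> 0"
proof -
  assume "2 * a \<in> \<int>"
  then obtain k where "a = of_int k / 2" by (rule double_Ints_E)
  then show ?thesis by (simp only: qpow_half add_eq_0_iff2 s_powi_neq_uminus not_False_eq_True)
qed

lemma qpow_1_diff_nonzero: "qpow s 1 - qpow s (- 1) \<noteq> 0"
  by (rule qpow_diff_nonzero) auto

lemma qbr_nonzero: "2 * a \<in> \<int> \<Longrightarrow> a \<noteq> 0 \<Longrightarrow> qbr s a \<noteq> 0"
  unfolding qbr_def by (simp only: divide_eq_0_iff qpow_diff_nonzero qpow_1_diff_nonzero simp_thms)

lemma qbr_plus_nonzero: "2 * a \<in> \<int> \<Longrightarrow> qbr_plus s a \<noteq> 0"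
  unfolding qbr_plus_def by (simp only: divide_eq_0_iff qpow_add_nonzero qpow_1_diff_nonzero simp_thms)

lemma rt_nonzero:
  assumes "a \<in> \<int>" "a \<noteq> 0"
  shows "rt r a \<noteq> 0"
proof -
  from assms obtain z where z: "a = of_int z" "z \<noteq> 0" by (auto elim: Ints_cases)
  have "nat \<lfloor>\<bar>a\<bar>\<rfloor> \<ge> 1" by (simp add: z flip: of_int_abs) (use z in linarith)
  moreover have "r k \<noteq> 0" if "k \<ge> 1" for k
  proof
    assume "r k = 0"
    with roots that have "qbr s (of_nat k) = 0" by (auto simp: bracket_roots_def)
    moreover have "2 * (of_nat k :: rat) \<in> \<int>" by simp
    ultimately show False using qbr_nonzero[of "of_nat k"] that by simp
  qed
  ultimately show ?thesis by (simp add: rt_def)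
qed

text \<open>Serves the separation at level 2, where the eigenvalue of I_{2,1} must determine both
  the sign and the entry. Positivity of \<open>a\<close> and \<open>b\<close> excludes the second
  solution, in which x is plus or minus 1/y.\<close>

lemma qbr_plus_inj:
  assumes "2 * a \<in> \<int>" "2 * b \<in> \<int>" "a > 0" "b > 0" and e: "e \<in> {1, -1}" "e' \<in> {1, -1}"
    and eq: "of_int e * qbr_plus s a = of_int e' * qbr_plus s b"
  shows "e = e'" "a = b"
proof -
  from assms(1) obtain k where k: "a = of_int k / 2" by (rule double_Ints_E)
  from assms(2) obtain k' where k': "b = of_int k' / 2" by (rule double_Ints_E)
  have pos: "k > 0" "k' > 0" using k k' assms(3,4) by auto
  define x y where "x = s powi k" and "y = s powi k'"
  have nz: "x \<noteq> 0" "y \<noteq> 0" using s_nonzero by (simp_all add: x_def y_def)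
  have eq1: "of_int e * (x + inverse x) = of_int e' * (y + inverse y)"
    using eq qpow_1_diff_nonzero
    by (simp add: qbr_plus_def k k' qpow_half x_def y_def power_int_minus)
  \<comment> \<open>Each sign is its own inverse, so both can be collected in one factor
    \<open>t\<close>, and \<open>t\<close> times y + 1/y is again of the form z + 1/z with z = t
    y.\<close>
  define t :: int where "t = e * e'"
  have t: "t \<in> {1, -1}" using e by (auto simp: t_def)
  have "x + inverse x = of_int t * y + inverse (of_int t * y)"
  proof -
    have "x + inverse x = of_int e * (of_int e * (x + inverse x))" using e by auto
    also have "\<dots> = of_int t * (y + inverse y)" unfolding eq1 by (simp add: t_def)
    finally show ?thesis using t by auto
  qed
  then have "x = of_int t * y \<or> x * y = of_int t"
    using add_inverse_eq_iff[of x "of_int t * y"] nz t by (auto simp: minus_eq_1)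
  moreover have "x * y \<noteq> 1" "x * y \<noteq> - 1"
  proof -
    have xy: "x * y = s powi (k + k')" by (simp add: x_def y_def power_int_add s_nonzero)
    show "x * y \<noteq> 1" unfolding xy s_powi_eq_1_iff using pos by simp
    show "x * y \<noteq> - 1" unfolding xy using s_powi_neq_uminus[of "k + k'" 0] by simp
  qed
  ultimately have "x = of_int t * y" using t by auto
  with t s_powi_neq_uminus[of k k'] have "t = 1" "x = y" by (auto simp: x_def y_def)
  then show "e = e'" "a = b" using e by (auto simp: t_def k k' x_def y_def s_powi_eq_iff)
qed

text \<open>Once both sides have the form x + 1/x, the squares of x and y are a power of
  \<open>s\<close> and minus a power of \<open>s\<close>, and no power of \<open>s\<close> is minus
  another.\<close>

lemma qbr_plus_neq_imaginary_qbr: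
  assumes "2 * a \<in> \<int>" "2 * b \<in> \<int>" and e: "e \<in> {1, -1}"
  shows "of_int e * qbr_plus s a \<noteq> \<i> * qbr s b"
proof
  assume eq: "of_int e * qbr_plus s a = \<i> * qbr s b"
  from assms(1) obtain k where k: "a = of_int k / 2" by (rule double_Ints_E)
  from assms(2) obtain k' where k': "b = of_int k' / 2" by (rule double_Ints_E)
  \<comment> \<open>Since 1/i = -i, absorbing i into \<open>y\<close> turns i times a difference of
    inverse powers into y + 1/y.\<close>
  define x y where "x = of_int e * s powi k" and "y = \<i> * s powi k'"
  have nz: "x \<noteq> 0" "y \<noteq> 0" using s_nonzero e by (auto simp: x_def y_def)
  have "of_int e * (s powi k + s powi (- k)) = \<i> * (s powi k' - s powi (- k'))"
    using eq qpow_1_diff_nonzero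
    by (simp add: qbr_plus_def qbr_def k k' qpow_half)
  then have "x + inverse x = y + inverse y"
    using e by (auto simp: x_def y_def power_int_minus algebra_simps)
  then have "x = y \<or> x * y = 1" using add_inverse_eq_iff nz by blast
  then have "x\<^sup>2 = y\<^sup>2 \<or> x\<^sup>2 * y\<^sup>2 = 1" by (metis power_mult_distrib one_power2)
  moreover have "x\<^sup>2 = s powi (2 * k)" "y\<^sup>2 = - (s powi (2 * k'))"
    using e by (auto simp: x_def y_def power_mult_distrib s_powi_square)
  ultimately have "s powi (2 * k) = - (s powi (2 * k')) \<or> s powi (2 * k + 2 * k') = - (s powi 0)"
    by (auto simp: power_int_add s_nonzero minus_equation_iff)
  then show False using s_powi_neq_uminus by blast
qed

end

section \<open>Tableaux\<close>

text \<open>The value 1/2 stands in for a missing right neighbour. Applied to row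
  \<open>k + 1\<close> this is the lower end of the interval for entry \<open>i\<close> of row
  \<open>k\<close>; applied to row \<open>k\<close> itself it expresses that the row decreases and
  stays at or above 1/2.\<close>

definition lower_bound :: "arr \<Rightarrow> nat \<Rightarrow> nat \<Rightarrow> rat"
  where "lower_bound \<xi> k i = (if Suc i \<le> k div 2 then \<xi> (Suc i, k) else 1 / 2)"

text \<open>A parity-free form of the interlacing conditions: below a fixed row, every entry ranges
  independently over its own interval.\<close>

lemma nonclassical_tableaux_iff:
  "\<xi> \<in> nonclassical_tableaux n m \<longleftrightarrow> \<xi> \<in> positions n \<rightarrow>\<^sub>E half_integers \<and>
    (\<forall>j\<in>{1..n div 2}. \<xi> (j, n) = m j) \<and>
    (\<forall>k\<in>{2..<n}. \<forall>i\<in>{1..k div 2}. lower_bound \<xi> (Suc k) i \<le> \<xi> (i, k) \<and> \<xi> (i, k) \<le> \<xi> (i, Suc k))"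
  (is "?L \<longleftrightarrow> ?A \<and> ?B \<and> ?R")
proof -
  let ?odd = "\<forall>p. 2 \<le> 2*p \<and> 2*p+1 \<le> n \<longrightarrow>
       (\<forall>i\<in>{1..p}. \<xi> (i, 2*p+1) \<ge> \<xi> (i, 2*p)) \<and>
       (\<forall>i\<in>{1..<p}. \<xi> (i, 2*p) \<ge> \<xi> (i+1, 2*p+1)) \<and> \<xi> (p, 2*p) \<ge> 1/2"
  let ?even = "\<forall>p. 2 \<le> 2*p-1 \<and> 2*p \<le> n \<longrightarrow>
       (\<forall>i\<in>{1..<p}. \<xi> (i, 2*p) \<ge> \<xi> (i, 2*p-1) \<and> \<xi> (i, 2*p-1) \<ge> \<xi> (i+1, 2*p))"
  let ?row = "\<lambda>k. \<forall>i\<in>{1..k div 2}. lower_bound \<xi> (Suc k) i \<le> \<xi> (i, k) \<and> \<xi> (i, k) \<le> \<xi> (i, Suc k)"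
  have o: "(\<forall>i\<in>{1..p}. \<xi> (i, 2*p+1) \<ge> \<xi> (i, 2*p)) \<and>
       (\<forall>i\<in>{1..<p}. \<xi> (i, 2*p) \<ge> \<xi> (i+1, 2*p+1)) \<and> \<xi> (p, 2*p) \<ge> 1/2 \<longleftrightarrow> ?row (2*p)" (is "?l \<longleftrightarrow> ?r")
    if "p \<ge> 1" for p
  proof
    assume ?l then show ?r by (auto simp: lower_bound_def) (metis Suc_leI le_neq_implies_less)
  next
    assume r: ?r
    have "lower_bound \<xi> (Suc (2*p)) i \<le> \<xi> (i, 2*p) \<and> \<xi> (i, 2*p) \<le> \<xi> (i, Suc (2*p))" if "1 \<le> i" "i \<le> p" for i
      using r that by simp
    from this this[of p] \<open>p \<ge> 1\<close> show ?l by (fastforce simp: lower_bound_def)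
  qed
  have e: "(\<forall>i\<in>{1..<p}. \<xi> (i, 2*p) \<ge> \<xi> (i, 2*p-1) \<and> \<xi> (i, 2*p-1) \<ge> \<xi> (i+1, 2*p)) \<longleftrightarrow> ?row (2*p-1)"
    if "p \<ge> 2" for p
  proof -
    have "(2*p - 1) div 2 = p - 1" "Suc (2*p - 1) = 2*p" using that by auto
    then show ?thesis using that by (auto simp: lower_bound_def)
  qed
  have "?odd \<and> ?even \<longleftrightarrow> (\<forall>k\<in>{2..<n}. ?row k)" (is "?l \<longleftrightarrow> ?r")
  proof
    assume l: ?l
    show ?r
    proof
      fix k assume k: "k \<in> {2..<n}"
      show "?row k"
      proof (cases "even k")
        case True
        then obtain p where "k = 2 * p" by blast
        with k l o[of p] show ?thesis by simp
      next
        case False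
        then obtain p where "k = 2 * p - 1" "p \<ge> 2" using k by (auto elim!: oddE intro: that[of "Suc _"])
        moreover have "2 \<le> 2*p-1 \<and> 2*p \<le> n" using calculation k by auto
        ultimately show ?thesis using l e[of p] by blast
      qed
    qed
  next
    assume r: ?r
    have ?odd
    proof (intro allI impI)
      fix p assume "2 \<le> 2*p \<and> 2*p+1 \<le> n"
      with r o[of p] show "(\<forall>i\<in>{1..p}. \<xi> (i, 2*p+1) \<ge> \<xi> (i, 2*p)) \<and>
       (\<forall>i\<in>{1..<p}. \<xi> (i, 2*p) \<ge> \<xi> (i+1, 2*p+1)) \<and> \<xi> (p, 2*p) \<ge> 1/2" by fastforce
    qed
    moreover have ?even
    proof (intro allI impI)
      fix p assume "2 \<le> 2*p-1 \<and> 2*p \<le> n"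
      then have "p \<ge> 2" "2*p - 1 \<in> {2..<n}" by auto
      with r e[of p] show "\<forall>i\<in>{1..<p}. \<xi> (i, 2*p) \<ge> \<xi> (i, 2*p-1) \<and> \<xi> (i, 2*p-1) \<ge> \<xi> (i+1, 2*p)" by blast
    qed
    ultimately show ?l by blast
  qed
  then show ?thesis unfolding nonclassical_tableaux_def by blast
qed

section \<open>Order within rows, bounds and finiteness\<close>

lemma nonclassically_admissible_lower_bound:
  assumes "nonclassically_admissible n \<epsilon> m" "i \<in> {1..n div 2}"
  shows "(if Suc i \<le> n div 2 then m (Suc i) else 1 / 2) \<le> m i"
  using assms by (auto simp: nonclassically_admissible_def not_less_eq_eq)

lemma finite_half_integers_interval: "finite {x \<in> half_integers. a \<le> x \<and> x \<le> b}"
proof (rule finite_subset)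
  show "{x \<in> half_integers. a \<le> x \<and> x \<le> b} \<subseteq> (\<lambda>z. of_int z + 1/2) ` {\<lfloor>a\<rfloor> - 1..\<lceil>b\<rceil>}"
  proof safe
    fix x assume "x \<in> half_integers" "a \<le> x" "x \<le> b"
    then obtain z where z: "x = of_int z + 1/2" by (elim half_integers_E)
    with \<open>a \<le> x\<close> \<open>x \<le> b\<close> have "\<lfloor>a\<rfloor> - 1 \<le> z" "z \<le> \<lceil>b\<rceil>" by linarith+
    with z show "x \<in> (\<lambda>z. of_int z + 1/2) ` {\<lfloor>a\<rfloor> - 1..\<lceil>b\<rceil>}" by auto
  qed
qed simp

context
  fixes n :: nat and \<epsilon> :: "nat \<Rightarrow> int" and m :: "nat \<Rightarrow> rat"
  assumes adm: "nonclassically_admissible n \<epsilon> m"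
begin

text \<open>Decrease within a row is not part of the definition below the top row. It descends by
  downward induction, because neighbouring entries of row \<open>k\<close> are separated by an entry
  of row \<open>k + 1\<close>.\<close>

lemma tableau_row:
  assumes "\<xi> \<in> nonclassical_tableaux n m" "k \<le> n" "2 \<le> k" "i \<in> {1..k div 2}"
  shows "lower_bound \<xi> k i \<le> \<xi> (i, k)"
  using assms(2,3,4)
proof (induction arbitrary: i rule: inc_induct)
  case base
  with assms(1) nonclassically_admissible_lower_bound[OF adm base(2)] show ?case
    by (auto simp: nonclassical_tableaux_iff lower_bound_def split: if_splits)
next
  case (step k)
  have k: "k \<in> {2..<n}" using step by simp
  have b: "lower_bound \<xi> (Suc k) i \<le> \<xi> (i, k)" "\<xi> (i, k) \<le> \<xi> (i, Suc k)" if "i \<in> {1..k div 2}" for i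
    using assms(1) k that by (auto simp: nonclassical_tableaux_iff)
  show ?case
  proof (cases "Suc i \<le> k div 2")
    case True
    then have "Suc i \<le> Suc k div 2" by linarith
    then show ?thesis using b[OF step.prems(2)] b(2)[of "Suc i"] True by (simp add: lower_bound_def)
  next
    case False
    \<comment> \<open>For odd \<open>k\<close> the last entry is bounded below by the last entry of
      row \<open>k + 1\<close>, which the induction hypothesis covers; for even \<open>k\<close> the
      bound is 1/2 itself.\<close>
    have "1/2 \<le> lower_bound \<xi> (Suc k) i"
    proof (cases "Suc i \<le> Suc k div 2")
      case True
      with False have "\<not> Suc (Suc i) \<le> Suc k div 2" by linarith
      with step.IH[of "Suc i"] True step.prems show ?thesis by (simp add: lower_bound_def)
    qed (simp add: lower_bound_def)
    then show ?thesis using b(1)[OF step.prems(2)] False by (simp add: lower_bound_def)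
  qed
qed

lemma tableau_row_antimono:
  assumes "\<xi> \<in> nonclassical_tableaux n m" "k \<le> n" "2 \<le> k" "1 \<le> i" "i \<le> j" "j \<le> k div 2"
  shows "\<xi> (j, k) \<le> \<xi> (i, k)"
  using assms(5,6)
proof (induction rule: dec_induct)
  case (step j)
  then show ?case
    using tableau_row[OF assms(1-3), of j] assms(4) by (simp add: lower_bound_def)
qed simp

lemma tableau_ge_half:
  assumes "\<xi> \<in> nonclassical_tableaux n m" "k \<le> n" "2 \<le> k" "1 \<le> i" "i \<le> k div 2"
  shows "1/2 \<le> \<xi> (i, k)"
  using tableau_row[OF assms(1-3), of "k div 2"] tableau_row_antimono[OF assms(1-4), of "k div 2"] assms(4,5)
  by (auto simp: lower_bound_def)

text \<open>Transitivity along a row upgrades interlacing of neighbours to all pairs of indices.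
  This decides the sign of the differences between adjacent rows in A and B.\<close>

lemma tableau_interlacing:
  assumes "\<xi> \<in> nonclassical_tableaux n m" "2 \<le> k" "Suc k \<le> n" "1 \<le> j" "j \<le> k div 2" "1 \<le> i" "i \<le> Suc k div 2"
  shows "i \<le> j \<Longrightarrow> \<xi> (j, k) \<le> \<xi> (i, Suc k)" "j < i \<Longrightarrow> \<xi> (i, Suc k) \<le> \<xi> (j, k)"
proof -
  have b: "lower_bound \<xi> (Suc k) j \<le> \<xi> (j, k)" "\<xi> (j, k) \<le> \<xi> (j, Suc k)"
    using assms by (auto simp: nonclassical_tableaux_iff)
  show "\<xi> (j, k) \<le> \<xi> (i, Suc k)" if "i \<le> j"
    using b(2) tableau_row_antimono[OF assms(1,3) _ assms(6) that] assms by linarith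
  show "\<xi> (i, Suc k) \<le> \<xi> (j, k)" if "j < i"
    using b(1) tableau_row_antimono[OF assms(1,3) _ _ , of "Suc j" i] assms that by (simp add: lower_bound_def)
qed

lemma tableau_half_integer:
  assumes "\<xi> \<in> nonclassical_tableaux n m" "k \<le> n" "2 \<le> k" "1 \<le> i" "i \<le> k div 2"
  shows "\<xi> (i, k) \<in> half_integers"
  using assms by (auto simp: nonclassical_tableaux_iff positions_def)

lemma tableau_le_top:
  assumes "\<xi> \<in> nonclassical_tableaux n m" "k \<le> n" "2 \<le> k" "i \<in> {1..k div 2}"
  shows "\<xi> (i, k) \<le> m i"
  using assms(2,3,4)
proof (induction rule: inc_induct)
  case base
  with assms(1) show ?case by (auto simp: nonclassical_tableaux_iff)
next
  case (step k)
  have "i \<in> {1..Suc k div 2}" using step.prems by (auto intro: order_trans div_le_mono)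
  with step have "\<xi> (i, Suc k) \<le> m i" by simp
  moreover have "\<xi> (i, k) \<le> \<xi> (i, Suc k)" using assms(1) step by (simp add: nonclassical_tableaux_iff)
  ultimately show ?case by simp
qed

lemma finite_nonclassical_tableaux: "finite (nonclassical_tableaux n m)"
proof (rule finite_subset)
  have "positions n \<subseteq> {..n} \<times> {..n}" by (auto simp: positions_def)
  then have "finite (positions n)" by (rule finite_subset) simp
  then show "finite (Pi\<^sub>E (positions n) (\<lambda>(i, k). {x \<in> half_integers. 1/2 \<le> x \<and> x \<le> m i}))"
    by (rule finite_PiE) (simp only: split_beta finite_half_integers_interval)
  show "nonclassical_tableaux n m \<subseteq> Pi\<^sub>E (positions n) (\<lambda>(i, k). {x \<in> half_integers. 1/2 \<le> x \<and> x \<le> m i})"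
  proof
    fix \<xi> assume x: "\<xi> \<in> nonclassical_tableaux n m"
    then have e: "\<xi> \<in> extensional (positions n)" by (auto simp: nonclassical_tableaux_iff PiE_def)
    show "\<xi> \<in> Pi\<^sub>E (positions n) (\<lambda>(i, k). {x \<in> half_integers. 1/2 \<le> x \<and> x \<le> m i})"
      using e tableau_half_integer[OF x] tableau_ge_half[OF x] tableau_le_top[OF x]
      by (auto simp: PiE_def positions_def)
  qed
qed

text \<open>Repeating the top row downwards, truncated to the length of each row, meets every upper
  interlacing bound with equality. It shows that the space is nonzero.\<close>

lemma constant_tableau:
  "(\<lambda>(j, k). if (j, k) \<in> positions n then m j else undefined) \<in> nonclassical_tableaux n m"
  unfolding nonclassical_tableaux_iff
proof (intro conjI ballI)
  show "(\<lambda>(j, k). if (j, k) \<in> positions n then m j else undefined) \<in> positions n \<rightarrow>\<^sub>E half_integers"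
  proof
    fix x assume "x \<in> positions n"
    moreover from this have "fst x \<in> {1..n div 2}"
      by (auto simp: positions_def intro: order_trans div_le_mono)
    ultimately show "(case x of (j, k) \<Rightarrow> if (j, k) \<in> positions n then m j else undefined) \<in> half_integers"
      using adm by (auto simp: nonclassically_admissible_def split_beta)
  qed auto
next
  fix j assume j: "j \<in> {1..n div 2}"
  then show "(\<lambda>(j, k). if (j, k) \<in> positions n then m j else undefined) (j, n) = m j"
    by (auto simp: positions_def)
next
  fix k i assume k: "k \<in> {2..<n}" and i: "i \<in> {1..k div 2}"
  have le: "k div 2 \<le> Suc k div 2" "Suc k div 2 \<le> n div 2" using k by (auto intro: div_le_mono)
  have adm': "i \<in> {1..n div 2} \<Longrightarrow> (if Suc i \<le> n div 2 then m (Suc i) else 1 / 2) \<le> m i" for i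
    by (rule nonclassically_admissible_lower_bound[OF adm])
  have half: "1/2 \<le> m j" if "j \<in> {1..n div 2}" for j
  proof -
    from that have "j \<le> n div 2" by simp
    then show ?thesis using that
    proof (induction rule: inc_induct)
      case base
      with adm'[of "n div 2"] show ?case by simp
    next
      case (step j)
      with adm'[of j] show ?case by auto
    qed
  qed
  show "lower_bound (\<lambda>(j, k). if (j, k) \<in> positions n then m j else undefined) (Suc k) i
      \<le> (\<lambda>(j, k). if (j, k) \<in> positions n then m j else undefined) (i, k)"
    using k i le adm'[of i] half[of i] by (auto simp: lower_bound_def positions_def split: if_splits)
  show "(\<lambda>(j, k). if (j, k) \<in> positions n then m j else undefined) (i, k)
      \<le> (\<lambda>(j, k). if (j, k) \<in> positions n then m j else undefined) (i, Suc k)"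
    using k i le by (auto simp: positions_def)
qed

end

section \<open>Replacing the lower rows of a tableau\<close>

definition fill :: "nat \<Rightarrow> (nat \<Rightarrow> rat) \<Rightarrow> arr \<Rightarrow> arr"
  where "fill k \<mu> \<xi> = (\<lambda>(j, k'). if (j, k') \<in> positions k then \<mu> j else \<xi> (j, k'))"

lemma fill_apply: "fill k \<mu> \<xi> (j, k') = (if (j, k') \<in> positions k then \<mu> j else \<xi> (j, k'))"
  by (simp add: fill_def)

text \<open>Overwriting row \<open>k\<close> alone could break interlacing with the rows below, so
  \<open>fill\<close> repeats truncations of one sequence in all of them. Only the comparison with
  row \<open>k + 1\<close> then has to be checked.\<close>

lemma fill_tableau:
  assumes adm: "nonclassically_admissible n \<epsilon> m" and \<xi>: "\<xi> \<in> nonclassical_tableaux n m" and k: "Suc k \<le> n" "1 \<le> k"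
    and \<mu>: "\<And>j. 1 \<le> j \<Longrightarrow> j \<le> k div 2 \<Longrightarrow>
      \<mu> j \<in> half_integers \<and> lower_bound \<xi> (Suc k) j \<le> \<mu> j \<and> \<mu> j \<le> \<xi> (j, Suc k)"
  shows "fill k \<mu> \<xi> \<in> nonclassical_tableaux n m"
proof -
  have half: "1/2 \<le> lower_bound \<xi> (Suc k) j" if "1 \<le> j" for j
    using tableau_ge_half[OF adm \<xi> k(1), of "Suc j"] k that by (auto simp: lower_bound_def)
  show ?thesis
    unfolding nonclassical_tableaux_iff
  proof (intro conjI ballI)
    have "\<xi> \<in> positions n \<rightarrow>\<^sub>E half_integers" using \<xi> by (simp add: nonclassical_tableaux_iff)
    then show "fill k \<mu> \<xi> \<in> positions n \<rightarrow>\<^sub>E half_integers"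
    proof (intro PiE_I, goal_cases)
      case (1 x)
      then show ?case using \<mu>[of "fst x"]
        by (cases x) (auto simp: fill_apply positions_def PiE_iff intro: order_trans div_le_mono)
    next
      case (2 x)
      moreover have "x \<notin> positions k" using 2 k by (auto simp: positions_def)
      ultimately show ?case by (cases x) (auto simp: fill_apply)
    qed
  next
    fix j assume "j \<in> {1..n div 2}"
    then show "fill k \<mu> \<xi> (j, n) = m j"
      using \<xi> k by (auto simp: nonclassical_tableaux_iff fill_apply positions_def)
  next
    fix k' i assume k': "k' \<in> {2..<n}" and i: "i \<in> {1..k' div 2}"
    have b: "lower_bound \<xi> (Suc k') i \<le> \<xi> (i, k')" "\<xi> (i, k') \<le> \<xi> (i, Suc k')"
      using \<xi> k' i by (auto simp: nonclassical_tableaux_iff)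
    have le: "k' div 2 \<le> Suc k' div 2" by (intro div_le_mono) simp
    have "lower_bound (fill k \<mu> \<xi>) (Suc k') i \<le> fill k \<mu> \<xi> (i, k') \<and> fill k \<mu> \<xi> (i, k') \<le> fill k \<mu> \<xi> (i, Suc k')"
    proof (cases "k' \<le> k")
      case False
      then have "fill k \<mu> \<xi> (j, k'') = \<xi> (j, k'')" if "k'' \<ge> k'" for j k''
        using that by (simp add: fill_apply positions_def)
      moreover from this have "lower_bound (fill k \<mu> \<xi>) (Suc k') i = lower_bound \<xi> (Suc k') i"
        by (simp add: lower_bound_def)
      ultimately show ?thesis using b by simp
    next
      case True
      then have "i \<le> k div 2" using i by (auto intro: order_trans div_le_mono)
      note m = \<mu>[OF _ this] half[of i]
      show ?thesis
      proof (cases "k' = k")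
        case True
        then show ?thesis using m k' i by (auto simp: fill_apply positions_def lower_bound_def split: if_splits)
      next
        case False
        with True have kk: "Suc k' \<le> k" by simp
        then have ll: "Suc k' div 2 \<le> k div 2" by (rule div_le_mono)
        \<comment> \<open>Adjacent intervals of the box share the endpoint
          \<open>\<xi> (Suc i, Suc k)\<close>, so \<open>\<mu>\<close> is automatically
          decreasing.\<close>
        have "\<mu> (Suc i) \<le> \<mu> i" if "Suc i \<le> Suc k' div 2"
        proof -
          have "Suc i \<le> k div 2" using that ll by simp
          moreover from this have "Suc i \<le> Suc k div 2" by linarith
          ultimately show ?thesis using \<mu>[of "Suc i"] m(1) i by (auto simp: lower_bound_def)
        qed
        then show ?thesis using m k' i kk le by (auto simp: fill_apply positions_def lower_bound_def)
      qed
    qed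
    then show "lower_bound (fill k \<mu> \<xi>) (Suc k') i \<le> fill k \<mu> \<xi> (i, k')"
      "fill k \<mu> \<xi> (i, k') \<le> fill k \<mu> \<xi> (i, Suc k')" by auto
  qed
qed

definition graft :: "nat \<Rightarrow> arr \<Rightarrow> arr \<Rightarrow> arr"
  where "graft k \<zeta> \<xi> = (\<lambda>(j, k'). if k' \<le> k then \<zeta> (j, k') else \<xi> (j, k'))"

lemma graft_apply: "graft k \<zeta> \<xi> (j, k') = (if k' \<le> k then \<zeta> (j, k') else \<xi> (j, k'))"
  by (simp add: graft_def)

lemma graft_eq_iff: "graft k \<zeta> \<xi> = graft k \<zeta>' \<xi>' \<longleftrightarrow>
    (\<forall>j k'. k' \<le> k \<longrightarrow> \<zeta> (j, k') = \<zeta>' (j, k')) \<and> (\<forall>j k'. k' > k \<longrightarrow> \<xi> (j, k') = \<xi>' (j, k'))"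
  by (auto simp: fun_eq_iff graft_def)

lemma eq_graft_iff: "\<eta> = graft k \<zeta> \<xi> \<longleftrightarrow>
    (\<forall>j k'. k' \<le> k \<longrightarrow> \<eta> (j, k') = \<zeta> (j, k')) \<and> (\<forall>j k'. k' > k \<longrightarrow> \<eta> (j, k') = \<xi> (j, k'))"
  by (auto simp: fun_eq_iff graft_def)

text \<open>Interlacing relates consecutive rows only, so agreement in row \<open>k\<close> is
  enough at the seam. The donor \<open>\<zeta>\<close> may have another top row, as it may belong to
  the other representation.\<close>

lemma graft_tableau:
  assumes "\<xi> \<in> nonclassical_tableaux n m" "\<zeta> \<in> nonclassical_tableaux n m'"
    and "k \<le> n" and row: "\<And>j. \<zeta> (j, k) = \<xi> (j, k)"
  shows "graft k \<zeta> \<xi> \<in> nonclassical_tableaux n m"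
  unfolding nonclassical_tableaux_iff
proof (intro conjI ballI)
  show "graft k \<zeta> \<xi> \<in> positions n \<rightarrow>\<^sub>E half_integers"
    using assms(1,2) by (auto simp: nonclassical_tableaux_iff graft_def PiE_iff extensional_def)
next
  fix j assume "j \<in> {1..n div 2}"
  moreover from this have "\<xi> (j, n) = m j" using assms(1) by (simp add: nonclassical_tableaux_iff)
  ultimately show "graft k \<zeta> \<xi> (j, n) = m j"
    using assms(3) row[of j] by (cases "n = k") (auto simp: graft_apply)
next
  fix k' i assume k': "k' \<in> {2..<n}" and i: "i \<in> {1..k' div 2}"
  have "lower_bound \<xi> (Suc k') i \<le> \<xi> (i, k') \<and> \<xi> (i, k') \<le> \<xi> (i, Suc k')"
    "lower_bound \<zeta> (Suc k') i \<le> \<zeta> (i, k') \<and> \<zeta> (i, k') \<le> \<zeta> (i, Suc k')"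
    using assms(1,2) k' i by (auto simp: nonclassical_tableaux_iff)
  then have "lower_bound (graft k \<zeta> \<xi>) (Suc k') i \<le> graft k \<zeta> \<xi> (i, k') \<and>
      graft k \<zeta> \<xi> (i, k') \<le> graft k \<zeta> \<xi> (i, Suc k')"
    using row by (cases "k' = k"; cases "k' < k") (auto simp: graft_apply lower_bound_def)
  then show "lower_bound (graft k \<zeta> \<xi>) (Suc k') i \<le> graft k \<zeta> \<xi> (i, k')"
    "graft k \<zeta> \<xi> (i, k') \<le> graft k \<zeta> \<xi> (i, Suc k')" by auto
qed

section \<open>Matrix coefficients of the generators\<close>

lemma shift_up_apply: "shift_up \<xi> j k (j', k') = (if (j', k') = (j, k) then \<xi> (j, k) + 1 else \<xi> (j', k'))"
  by (auto simp: shift_up_def)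

lemma shift_down_apply: "shift_down \<xi> j k (j', k') = (if (j', k') = (j, k) then \<xi> (j, k) - 1 else \<xi> (j', k'))"
  by (auto simp: shift_down_def)

lemma shift_down_shift_up: "shift_down (shift_up \<xi> j k) j k = \<xi>"
  by (simp add: shift_up_def shift_down_def)

lemma of_nat_le_rat:
  "i \<le> j \<Longrightarrow> (of_nat i :: rat) \<le> of_nat j" "i < j \<Longrightarrow> (of_nat i :: rat) + 1 \<le> of_nat j"
  using of_nat_mono[of "Suc i" j, where 'a = rat] by simp_all

lemma l_even: "l \<xi> i (2 * p) = \<xi> (i, 2 * p) + of_nat p - of_nat i"
  by (simp add: l_def)

lemma l_odd: "l \<xi> i (Suc (2 * p)) = \<xi> (i, Suc (2 * p)) + of_nat p - of_nat i + 1"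
  by (simp add: l_def)

text \<open>By the first bound, l = 1/2 can occur only at the last entry of an even row. Everywhere
  else l is at least 3/2, which keeps factors such as [l - 1/2] and [2l - 1] away from zero.\<close>

lemma l_ge:
  assumes "nonclassically_admissible n \<epsilon> m" "\<xi> \<in> nonclassical_tableaux n m"
    and "k \<le> n" "2 \<le> k" "1 \<le> i" "i \<le> k div 2"
  shows "1/2 + of_nat (k div 2) - of_nat i + (if odd k then 1 else 0) \<le> l \<xi> i k" "1/2 \<le> l \<xi> i k"
proof -
  have "1/2 \<le> \<xi> (i, k)" using tableau_ge_half[OF assms(1,2)] assms by blast
  moreover have "(of_nat i :: rat) \<le> of_nat (k div 2)" using assms(6) by (simp only: of_nat_le_iff)
  ultimately show "1/2 + of_nat (k div 2) - of_nat i + (if odd k then 1 else 0) \<le> l \<xi> i k" "1/2 \<le> l \<xi> i k"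
    by (auto simp: l_def)
qed

section \<open>Nonvanishing of the coefficients on tableaux\<close>

context non_root
begin

lemma rt_half_integers:
  assumes "a \<in> half_integers" "b \<in> half_integers"
  shows "a + b \<noteq> 0 \<Longrightarrow> rt r (a + b) \<noteq> 0" "a - b \<noteq> 0 \<Longrightarrow> rt r (a - b) \<noteq> 0"
    "a + b + 1 \<noteq> 0 \<Longrightarrow> rt r (a + b + 1) \<noteq> 0" "a + b - 1 \<noteq> 0 \<Longrightarrow> rt r (a + b - 1) \<noteq> 0"
    "a - b - 1 \<noteq> 0 \<Longrightarrow> rt r (a - b - 1) \<noteq> 0"
  by (intro rt_nonzero Ints_add Ints_diff Ints_1 half_integers_add half_integers_diff assms; assumption)+

context
  fixes n \<epsilon> m
  assumes adm: "nonclassically_admissible n \<epsilon> m"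
begin

lemma tableau_l_half_integer:
  "\<xi> \<in> nonclassical_tableaux n m \<Longrightarrow> k \<le> n \<Longrightarrow> 2 \<le> k \<Longrightarrow> 1 \<le> i \<Longrightarrow> i \<le> k div 2 \<Longrightarrow> l \<xi> i k \<in> half_integers"
  by (intro half_integers_l tableau_half_integer[OF adm])

text \<open>Sums of l's are positive. Where a weak interlacing inequality would still allow a
  difference to vanish, the shifted array, being a tableau as well, leaves room for one more
  unit.\<close>

lemma coeff_A_nonzero:
  assumes \<xi>: "\<xi> \<in> nonclassical_tableaux n m" and up: "shift_up \<xi> j (2 * p) \<in> nonclassical_tableaux n m"
    and j: "1 \<le> j" "j \<le> p" and n: "Suc (2 * p) \<le> n"
  shows "coeff_A r p j \<xi> \<noteq> 0"
proof -
  obtain t where p: "p = Suc t" using j by (cases p) auto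
  note H = tableau_l_half_integer[OF \<xi>] and L = l_ge(2)[OF adm \<xi>]
  note I = tableau_interlacing[OF adm \<xi>] and I' = tableau_interlacing[OF adm up]
  note M = tableau_row_antimono[OF adm \<xi>] and M' = tableau_row_antimono[OF adm up]
  have J: "l \<xi> j (2 * p) \<in> half_integers" "1/2 \<le> l \<xi> j (2 * p)" using H[of "2*p"] L[of "2*p"] j n by auto
  note rat = of_nat_le_rat
  have 1: "rt r (l \<xi> i (2*p+1) + l \<xi> j (2*p)) \<noteq> 0" "rt r (l \<xi> i (2*p+1) - l \<xi> j (2*p) - 1) \<noteq> 0"
    if i: "i \<in> {1..p}" for i
  proof -
    have h: "l \<xi> i (Suc (2*p)) \<in> half_integers" "1/2 \<le> l \<xi> i (Suc (2*p))"
      using H[of "Suc (2*p)"] L[of "Suc (2*p)"] i n j by auto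
    have "l \<xi> i (Suc (2*p)) - l \<xi> j (2*p) - 1 \<noteq> 0"
    \<comment> \<open>With the index offsets in l the argument is at least 1 for
      \<open>i \<le> j\<close>, by the shifted tableau, and at most -1 for \<open>j < i\<close>, by
      the original one.\<close>
    proof (cases "i \<le> j")
      case True
      with I'(1)[of "2*p" j i] i j n have "\<xi> (j, 2*p) + 1 \<le> \<xi> (i, Suc (2*p))" by (simp add: shift_up_apply)
      with rat(1)[OF True] show ?thesis by (simp add: l_even l_odd)
    next
      case False
      with I(2)[of "2*p" j i] i j n have "\<xi> (i, Suc (2*p)) \<le> \<xi> (j, 2*p)" by simp
      with rat(2)[of j i] False show ?thesis by (simp add: l_even l_odd)
    qed
    then show "rt r (l \<xi> i (2*p+1) + l \<xi> j (2*p)) \<noteq> 0" "rt r (l \<xi> i (2*p+1) - l \<xi> j (2*p) - 1) \<noteq> 0"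
      using rt_half_integers[OF h(1) J(1)] h(2) J(2) by simp_all
  qed
  have 2: "rt r (l \<xi> i (2*p-1) + l \<xi> j (2*p)) \<noteq> 0" "rt r (l \<xi> i (2*p-1) - l \<xi> j (2*p) - 1) \<noteq> 0"
    if i: "i \<in> {1..p-1}" for i
  proof -
    have pp: "2 * p - 1 = Suc (2 * t)" "Suc (Suc (2 * t)) = 2 * p" and t: "1 \<le> i" "i \<le> t" using p i by auto
    have h: "l \<xi> i (Suc (2*t)) \<in> half_integers" "1/2 \<le> l \<xi> i (Suc (2*t))"
      using H[of "Suc (2*t)"] L[of "Suc (2*t)"] t n p by auto
    have "l \<xi> i (Suc (2*t)) - l \<xi> j (2*p) - 1 \<noteq> 0"
    proof (cases "i < j")
      case True
      with I'(2)[of "Suc (2*t)" i j] t j n have "\<xi> (j, 2*p) + 1 \<le> \<xi> (i, Suc (2*t))"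
        by (simp add: shift_up_apply p)
      with rat(2)[OF True] show ?thesis unfolding l_even l_odd by (simp add: p)
    next
      case False
      with I(1)[of "Suc (2*t)" i j] t j n have "\<xi> (i, Suc (2*t)) \<le> \<xi> (j, 2*p)" by (simp add: p)
      with rat(1)[of j i] False show ?thesis unfolding l_even l_odd by (simp add: p)
    qed
    then show "rt r (l \<xi> i (2*p-1) + l \<xi> j (2*p)) \<noteq> 0" "rt r (l \<xi> i (2*p-1) - l \<xi> j (2*p) - 1) \<noteq> 0"
      unfolding pp using rt_half_integers[OF h(1) J(1)] h(2) J(2) by simp_all
  qed
  have 3: "rt r (l \<xi> i (2*p) + l \<xi> j (2*p)) \<noteq> 0" "rt r (l \<xi> i (2*p) - l \<xi> j (2*p)) \<noteq> 0"
    "rt r (l \<xi> i (2*p) + l \<xi> j (2*p) + 1) \<noteq> 0" "rt r (l \<xi> i (2*p) - l \<xi> j (2*p) - 1) \<noteq> 0"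
    if i: "i \<in> {1..p} - {j}" for i
  proof -
    have h: "l \<xi> i (2*p) \<in> half_integers" "1/2 \<le> l \<xi> i (2*p)" using H[of "2*p"] L[of "2*p"] i n j by auto
    have "l \<xi> i (2*p) - l \<xi> j (2*p) \<noteq> 0 \<and> l \<xi> i (2*p) - l \<xi> j (2*p) - 1 \<noteq> 0"
    proof (cases "i < j")
      case True
      with M'[of "2*p" i j] i j n have "\<xi> (j, 2*p) + 1 \<le> \<xi> (i, 2*p)" by (simp add: shift_up_apply)
      with rat(2)[OF True] show ?thesis by (simp add: l_even)
    next
      case False
      with M[of "2*p" j i] i j n have "\<xi> (i, 2*p) \<le> \<xi> (j, 2*p)" by simp
      with rat(2)[of j i] False i show ?thesis by (simp add: l_even)
    qed
    then show "rt r (l \<xi> i (2*p) + l \<xi> j (2*p)) \<noteq> 0" "rt r (l \<xi> i (2*p) - l \<xi> j (2*p)) \<noteq> 0"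
    "rt r (l \<xi> i (2*p) + l \<xi> j (2*p) + 1) \<noteq> 0" "rt r (l \<xi> i (2*p) - l \<xi> j (2*p) - 1) \<noteq> 0"
      using rt_half_integers[OF h(1) J(1)] h(2) J(2) by simp_all
  qed
  show ?thesis
    unfolding coeff_A_def by (simp only: divide_eq_0_iff mult_eq_0_iff prod_zero_iff finite_atLeastAtMost
        finite_Diff de_Morgan_disj bex_simps) (use 1 2 3 in blast)
qed

text \<open>Row 2p-1 is written as \<open>Suc (2 * t)\<close> to avoid truncated subtraction. There
  l is at least 3/2; a bound of 1/2 would not keep the argument l_i + l_j - 1 in the denominator
  away from zero.\<close>

lemma coeff_B_nonzero:
  assumes \<xi>: "\<xi> \<in> nonclassical_tableaux n m" and up: "shift_up \<xi> j (Suc (2 * t)) \<in> nonclassical_tableaux n m"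
    and j: "1 \<le> j" "j \<le> t" and n: "Suc (Suc (2 * t)) \<le> n"
  shows "coeff_B r (Suc t) j \<xi> \<noteq> 0"
proof -
  let ?p = "Suc t"
  have row: "2 * ?p - 1 = Suc (2 * t)" "2 * ?p - 2 = 2 * t" "?p - 1 = t" by simp_all
  note H = tableau_l_half_integer[OF \<xi>] and L = l_ge(2)[OF adm \<xi>]
  note I = tableau_interlacing[OF adm \<xi>] and I' = tableau_interlacing[OF adm up]
  note M = tableau_row_antimono[OF adm \<xi>] and M' = tableau_row_antimono[OF adm up]
  note rat = of_nat_le_rat
  have L': "l \<xi> i (Suc (2*t)) \<in> half_integers" "3/2 \<le> l \<xi> i (Suc (2*t))" if "1 \<le> i" "i \<le> t" for i
    using H[of "Suc (2*t)" i] l_ge(1)[OF adm \<xi>, of "Suc (2*t)" i] that n rat(1)[of i t] by auto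
  note J = L'[OF j]
  have 1: "rt r (l \<xi> i (2*?p) + l \<xi> j (Suc (2*t))) \<noteq> 0" "rt r (l \<xi> i (2*?p) - l \<xi> j (Suc (2*t))) \<noteq> 0"
    if i: "i \<in> {1..?p}" for i
  proof -
    have h: "l \<xi> i (2*?p) \<in> half_integers" "1/2 \<le> l \<xi> i (2*?p)" using H[of "2*?p"] L[of "2*?p"] i n j by auto
    have "l \<xi> i (2*?p) - l \<xi> j (Suc (2*t)) \<noteq> 0"
    proof (cases "i \<le> j")
      case True
      with I'(1)[of "Suc (2*t)" j i] i j n have "\<xi> (j, Suc (2*t)) + 1 \<le> \<xi> (i, 2*?p)"
        by (simp add: shift_up_apply)
      with rat(1)[OF True] show ?thesis unfolding l_even l_odd by simp
    next
      case False
      with I(2)[of "Suc (2*t)" j i] i j n have "\<xi> (i, 2*?p) \<le> \<xi> (j, Suc (2*t))" by simp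
      with rat(2)[of j i] False show ?thesis unfolding l_even l_odd by simp
    qed
    then show "rt r (l \<xi> i (2*?p) + l \<xi> j (Suc (2*t))) \<noteq> 0" "rt r (l \<xi> i (2*?p) - l \<xi> j (Suc (2*t))) \<noteq> 0"
      using rt_half_integers[OF h(1) J(1)] h(2) J(2) by simp_all
  qed
  have 2: "rt r (l \<xi> i (2*t) + l \<xi> j (Suc (2*t))) \<noteq> 0" "rt r (l \<xi> i (2*t) - l \<xi> j (Suc (2*t))) \<noteq> 0"
    if i: "i \<in> {1..t}" for i
  proof -
    have h: "l \<xi> i (2*t) \<in> half_integers" "1/2 \<le> l \<xi> i (2*t)" using H[of "2*t"] L[of "2*t"] i n j by auto
    have "l \<xi> i (2*t) - l \<xi> j (Suc (2*t)) \<noteq> 0"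
    proof (cases "i < j")
      case True
      with I'(2)[of "2*t" i j] i j n have "\<xi> (j, Suc (2*t)) + 1 \<le> \<xi> (i, 2*t)"
        by (simp add: shift_up_apply)
      with rat(2)[OF True] show ?thesis unfolding l_even l_odd by simp
    next
      case False
      with I(1)[of "2*t" i j] i j n have "\<xi> (i, 2*t) \<le> \<xi> (j, Suc (2*t))" by simp
      with rat(1)[of j i] False show ?thesis unfolding l_even l_odd by simp
    qed
    then show "rt r (l \<xi> i (2*t) + l \<xi> j (Suc (2*t))) \<noteq> 0" "rt r (l \<xi> i (2*t) - l \<xi> j (Suc (2*t))) \<noteq> 0"
      using rt_half_integers[OF h(1) J(1)] h(2) J(2) by simp_all
  qed
  have 3: "rt r (l \<xi> i (Suc (2*t)) + l \<xi> j (Suc (2*t))) \<noteq> 0" "rt r (l \<xi> i (Suc (2*t)) - l \<xi> j (Suc (2*t))) \<noteq> 0"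
    "rt r (l \<xi> i (Suc (2*t)) + l \<xi> j (Suc (2*t)) - 1) \<noteq> 0" "rt r (l \<xi> i (Suc (2*t)) - l \<xi> j (Suc (2*t)) - 1) \<noteq> 0"
    if i: "i \<in> {1..t} - {j}" for i
  proof -
    have h: "l \<xi> i (Suc (2*t)) \<in> half_integers" "3/2 \<le> l \<xi> i (Suc (2*t))" using L'[of i] i by auto
    have "l \<xi> i (Suc (2*t)) - l \<xi> j (Suc (2*t)) \<noteq> 0 \<and> l \<xi> i (Suc (2*t)) - l \<xi> j (Suc (2*t)) - 1 \<noteq> 0"
    proof (cases "i < j")
      case True
      with M'[of "Suc (2*t)" i j] i j n have "\<xi> (j, Suc (2*t)) + 1 \<le> \<xi> (i, Suc (2*t))" by (simp add: shift_up_apply)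
      with rat(2)[OF True] show ?thesis by (simp add: l_odd)
    next
      case False
      with M[of "Suc (2*t)" j i] i j n have "\<xi> (i, Suc (2*t)) \<le> \<xi> (j, Suc (2*t))" by simp
      with rat(2)[of j i] False i show ?thesis by (simp add: l_odd)
    qed
    then show "rt r (l \<xi> i (Suc (2*t)) + l \<xi> j (Suc (2*t))) \<noteq> 0" "rt r (l \<xi> i (Suc (2*t)) - l \<xi> j (Suc (2*t))) \<noteq> 0"
    "rt r (l \<xi> i (Suc (2*t)) + l \<xi> j (Suc (2*t)) - 1) \<noteq> 0" "rt r (l \<xi> i (Suc (2*t)) - l \<xi> j (Suc (2*t)) - 1) \<noteq> 0"
      using rt_half_integers[OF h(1) J(1)] h(2) J(2) by simp_all
  qed
  show ?thesis
    unfolding coeff_B_def row by (simp only: divide_eq_0_iff mult_eq_0_iff prod_zero_iff finite_atLeastAtMost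
        finite_Diff de_Morgan_disj bex_simps) (use 1 2 3 in blast)
qed

text \<open>The values [a]_+ never vanish at half-integral a, so the sign at an even level is
  visible on every tableau.\<close>

lemma coeff_C_hat_nonzero:
  assumes \<xi>: "\<xi> \<in> nonclassical_tableaux n m" and n: "2 * p \<le> n"
  shows "coeff_C_hat s p \<xi> \<noteq> 0"
proof -
  have H: "2 * l \<xi> i k \<in> \<int>" if "k \<le> n" "2 \<le> k" "1 \<le> i" "i \<le> k div 2" for i k
    by (rule half_integers_double[OF tableau_l_half_integer[OF \<xi> that]])
  have H': "2 * (l \<xi> i k - 1) \<in> \<int>" if "k \<le> n" "2 \<le> k" "1 \<le> i" "i \<le> k div 2" for i k
    using Ints_diff[OF H[OF that], of 2] by (simp add: right_diff_distrib)
  have 1: "qbr_plus s (l \<xi> i (2*p)) \<noteq> 0" if "i \<in> {1..p}" for i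
    using that n by (intro qbr_plus_nonzero H) auto
  have 2: "qbr_plus s (l \<xi> i (2*p-2)) \<noteq> 0" if "i \<in> {1..p-1}" for i
    using that n by (intro qbr_plus_nonzero H) auto
  have 3: "qbr_plus s (l \<xi> i (2*p-1)) \<noteq> 0" "qbr_plus s (l \<xi> i (2*p-1) - 1) \<noteq> 0" if "i \<in> {1..p-1}" for i
    using that n by (auto intro!: qbr_plus_nonzero H H')
  show ?thesis
    unfolding coeff_C_hat_def by (simp only: divide_eq_0_iff mult_eq_0_iff prod_zero_iff finite_atLeastAtMost
        de_Morgan_disj bex_simps) (use 1 2 3 in blast)
qed

text \<open>Only l = 1/2 would be harmful. In the rows involved it can occur only at the last entry
  of row 2p, and the denominator omits exactly that entry.\<close>

lemma coeff_D_nonzero: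
  assumes \<xi>: "\<xi> \<in> nonclassical_tableaux n m" and n: "Suc (2 * p) \<le> n"
  shows "coeff_D s p \<xi> \<noteq> 0"
proof -
  have H: "2 * (l \<xi> i k - 1/2) \<in> \<int>" "2 * (l \<xi> i k + 1/2) \<in> \<int>" if "k \<le> n" "2 \<le> k" "1 \<le> i" "i \<le> k div 2" for i k
    using half_integers_double[OF tableau_l_half_integer[OF \<xi> that]]
    by (simp_all add: distrib_left right_diff_distrib)
  have L: "3/2 \<le> l \<xi> i k" if "k \<le> n" "2 \<le> k" "1 \<le> i" "i \<le> k div 2" "odd k \<or> i < k div 2" for i k
  proof -
    have "(of_nat i :: rat) \<le> of_nat (k div 2)" "i < k div 2 \<longrightarrow> (of_nat i :: rat) + 1 \<le> of_nat (k div 2)"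
      using that(4) of_nat_le_rat by blast+
    with l_ge(1)[OF adm \<xi> that(1-4)] that(5) show ?thesis by (auto split: if_splits)
  qed
  have 1: "qbr s (l \<xi> i (2*p+1) - 1/2) \<noteq> 0" if "i \<in> {1..p}" for i
    using that n L[of "2*p+1" i] by (intro qbr_nonzero H) auto
  have 2: "qbr s (l \<xi> i (2*p-1) - 1/2) \<noteq> 0" if "i \<in> {1..p-1}" for i
  proof -
    have "2 * p - 1 \<le> n" "2 \<le> 2 * p - 1" "1 \<le> i" "i \<le> (2 * p - 1) div 2" "odd (2 * p - 1)"
      using that n by auto
    then show ?thesis using L[of "2*p-1" i] by (intro qbr_nonzero H) auto
  qed
  have 3: "qbr s (l \<xi> i (2*p) + 1/2) \<noteq> 0" "qbr s (l \<xi> i (2*p) - 1/2) \<noteq> 0" if "i \<in> {1..p-1}" for i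
    using that n L[of "2*p" i] by (intro qbr_nonzero H; force)+
  show ?thesis
    unfolding coeff_D_def by (simp only: divide_eq_0_iff mult_eq_0_iff prod_zero_iff finite_atLeastAtMost
        de_Morgan_disj bex_simps) (use 1 2 3 in blast)
qed

end

lemma s_diff_half_nonzero: "qpow s (1/2) - qpow s (- 1/2) \<noteq> 0"
  using qpow_diff_nonzero[of "1/2"] by simp

end

section \<open>Matrix entries of one generator, uniform in the parity of its index\<close>

definition up_coeff :: "complex \<Rightarrow> (nat \<Rightarrow> complex) \<Rightarrow> nat \<Rightarrow> nat \<Rightarrow> arr \<Rightarrow> complex"
  where "up_coeff s r k j \<xi> = (let y = l \<xi> j (k - 1) in
    if even k then coeff_B r (k div 2) j \<xi> / (qbr s (2 * y - 1) * qbr_plus s y)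
    else coeff_A r (k div 2) j \<xi> / (qpow s y - qpow s (- y)))"

definition down_coeff :: "complex \<Rightarrow> (nat \<Rightarrow> complex) \<Rightarrow> nat \<Rightarrow> nat \<Rightarrow> arr \<Rightarrow> complex"
  where "down_coeff s r k j \<xi> = (let y = l \<xi> j (k - 1); \<zeta> = shift_down \<xi> j (k - 1) in
    if even k then coeff_B r (k div 2) j \<zeta> / (qbr s (2 * y - 1) * qbr_plus s (y - 1))
    else coeff_A r (k div 2) j \<zeta> / (qpow s y - qpow s (- y)))"

definition diag_coeff :: "complex \<Rightarrow> nat \<Rightarrow> arr \<Rightarrow> complex"
  where "diag_coeff s k \<xi> =
    (if even k then coeff_C_hat s (k div 2) \<xi>
     else if \<xi> (k div 2, k - 1) = 1/2 then coeff_D s (k div 2) \<xi> / (qpow s (1/2) - qpow s (- 1/2)) else 0)"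

text \<open>The coefficient of \<open>\<eta>\<close> in the image of \<open>\<xi>\<close> under
  I_{k,k-1}, extended to arbitrary arrays. Omitted terms are accounted for by evaluating it at
  tableaux only.\<close>

definition gen_entry :: "complex \<Rightarrow> (nat \<Rightarrow> complex) \<Rightarrow> nat \<Rightarrow> int \<Rightarrow> arr \<Rightarrow> arr \<Rightarrow> complex"
  where "gen_entry s r k e \<eta> \<xi> =
    (if \<eta> = \<xi> then of_int e * diag_coeff s k \<xi> else 0)
    + (\<Sum>j=1..(k - 1) div 2. if \<eta> = shift_up \<xi> j (k - 1) then up_coeff s r k j \<xi> else 0)
    - (\<Sum>j=1..(k - 1) div 2. if \<eta> = shift_down \<xi> j (k - 1) then down_coeff s r k j \<xi> else 0)"

lemma lookup_tableau_term:
  "\<eta> \<in> S \<Longrightarrow> Poly_Mapping.lookup (tableau_term S c \<xi>) \<eta> = (if \<eta> = \<xi> then c else 0)"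
  by (auto simp: tableau_term_def lookup_cscale lookup_single when_def)

lemma lookup_sum_tableau_term:
  "\<eta> \<in> S \<Longrightarrow> Poly_Mapping.lookup (\<Sum>j\<in>J. tableau_term S (c j) (f j)) \<eta> = (\<Sum>j\<in>J. if \<eta> = f j then c j else 0)"
  by (simp add: lookup_sum lookup_tableau_term)

lemma lookup_cscale_ket: "Poly_Mapping.lookup (cscale c (ket \<xi>)) \<eta> = (if \<eta> = \<xi> then c else 0)"
  by (auto simp: lookup_cscale lookup_single when_def)

lemma lookup_gen_action:
  assumes rep: "nonclassical_rep s r n q \<epsilon> m \<rho>" and k: "2 \<le> k" "k \<le> n"
    and "\<xi> \<in> nonclassical_tableaux n m" "\<eta> \<in> nonclassical_tableaux n m"
  shows "Poly_Mapping.lookup (\<rho> (Uq_class n q (gen k)) (ket \<xi>)) \<eta> = gen_entry s r k (\<epsilon> k) \<eta> \<xi>"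
proof (cases "even k")
  case True
  then obtain p where p: "k = 2 * p" by blast
  then have "1 \<le> p" using k by simp
  then have d: "(2 * p - Suc 0) div 2 = p - 1" by simp
  have "\<rho> (Uq_class n q (gen k)) (ket \<xi>) = nonclassical_even s r n \<epsilon> m p \<xi>"
    using assms p by (auto simp: nonclassical_rep_def)
  then show ?thesis using assms(4,5)
    by (simp add: nonclassical_even_def gen_entry_def Let_def lookup_add lookup_minus lookup_sum_tableau_term
      lookup_cscale_ket p up_coeff_def down_coeff_def diag_coeff_def d cong: if_cong)
next
  case False
  then obtain p where p: "k = Suc (2 * p)" by (auto elim: oddE)
  have "2 \<le> 2 * p \<and> 2 * p \<le> n - 1" using k p by auto
  then have "\<rho> (Uq_class n q (gen k)) (ket \<xi>) = nonclassical_odd s r n \<epsilon> m p \<xi>"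
    using assms(1,4) p by (auto simp: nonclassical_rep_def)
  then show ?thesis using assms(4,5)
    by (simp add: nonclassical_odd_def gen_entry_def Let_def lookup_add lookup_minus lookup_sum_tableau_term
      lookup_cscale_ket p up_coeff_def down_coeff_def diag_coeff_def cong: if_cong)
qed

text \<open>The coefficients of I_{k,k-1} are built from rows k-2, k-1 and k. Rows above
  \<open>k\<close> never enter, which allows an induction over the chain of subalgebras.\<close>

lemma coeffs_local:
  assumes "\<And>j k'. k' \<le> k \<Longrightarrow> \<xi> (j, k') = \<xi>' (j, k')"
  shows "up_coeff s r k j \<xi> = up_coeff s r k j \<xi>'" "down_coeff s r k j \<xi> = down_coeff s r k j \<xi>'"
    "diag_coeff s k \<xi> = diag_coeff s k \<xi>'"
proof -
  \<comment> \<open>For even \<open>k\<close> the row index \<open>2 * (k div 2) + 1\<close> would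
    exceed \<open>k\<close>, so A and D are compared for odd \<open>k\<close> only.\<close>
  have A: "odd k \<Longrightarrow> coeff_A r (k div 2) j \<xi> = coeff_A r (k div 2) j \<xi>'"
    and B: "coeff_B r (k div 2) j \<xi> = coeff_B r (k div 2) j \<xi>'"
    and C: "coeff_C_hat s (k div 2) \<xi> = coeff_C_hat s (k div 2) \<xi>'"
    and D: "odd k \<Longrightarrow> coeff_D s (k div 2) \<xi> = coeff_D s (k div 2) \<xi>'"
    if "\<And>j k'. k' \<le> k \<Longrightarrow> \<xi> (j, k') = \<xi>' (j, k')" for \<xi> \<xi>'
  proof -
    have l: "l \<xi> i k' = l \<xi>' i k'" if "k' \<le> k" for i k'
      using that \<open>\<And>j k'. k' \<le> k \<Longrightarrow> \<xi> (j, k') = \<xi>' (j, k')\<close> by (simp add: l_def)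
    have le: "2 * (k div 2) \<le> k" "2 * (k div 2) - 1 \<le> k" "2 * (k div 2) - 2 \<le> k" by auto
    show "coeff_B r (k div 2) j \<xi> = coeff_B r (k div 2) j \<xi>'" "coeff_C_hat s (k div 2) \<xi> = coeff_C_hat s (k div 2) \<xi>'"
      unfolding coeff_B_def coeff_C_hat_def by (simp_all only: l le)
    show "coeff_A r (k div 2) j \<xi> = coeff_A r (k div 2) j \<xi>'" "coeff_D s (k div 2) \<xi> = coeff_D s (k div 2) \<xi>'" if "odd k"
    proof -
      have "2 * (k div 2) + 1 \<le> k" using that by simp
      then show "coeff_A r (k div 2) j \<xi> = coeff_A r (k div 2) j \<xi>'" "coeff_D s (k div 2) \<xi> = coeff_D s (k div 2) \<xi>'"
        unfolding coeff_A_def coeff_D_def by (simp_all only: l le)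
    qed
  qed
  have l: "l \<xi> j (k - 1) = l \<xi>' j (k - 1)" using assms by (simp add: l_def)
  have d: "\<And>i k'. k' \<le> k \<Longrightarrow> shift_down \<xi> j (k - 1) (i, k') = shift_down \<xi>' j (k - 1) (i, k')"
    using assms by (simp add: shift_down_apply)
  show "up_coeff s r k j \<xi> = up_coeff s r k j \<xi>'"
    unfolding up_coeff_def Let_def l using A[of \<xi> \<xi>', OF assms] B[of \<xi> \<xi>', OF assms] by simp
  show "down_coeff s r k j \<xi> = down_coeff s r k j \<xi>'"
    unfolding down_coeff_def Let_def l using A[of "shift_down \<xi> j (k - 1)" "shift_down \<xi>' j (k - 1)", OF d] B[of "shift_down \<xi> j (k - 1)" "shift_down \<xi>' j (k - 1)", OF d] by simp
  show "diag_coeff s k \<xi> = diag_coeff s k \<xi>'"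
    using C[of \<xi> \<xi>', OF assms] D[of \<xi> \<xi>', OF assms] assms by (simp add: diag_coeff_def)
qed

lemma gen_entry_local:
  assumes low: "\<And>j k'. k' \<le> k \<Longrightarrow> \<xi> (j, k') = \<xi>' (j, k')" "\<And>j k'. k' \<le> k \<Longrightarrow> \<eta> (j, k') = \<eta>' (j, k')"
    and high: "\<And>j k'. k < k' \<Longrightarrow> \<eta> (j, k') = \<xi> (j, k')" "\<And>j k'. k < k' \<Longrightarrow> \<eta>' (j, k') = \<xi>' (j, k')"
    and "1 \<le> k"
  shows "gen_entry s r k e \<eta> \<xi> = gen_entry s r k e \<eta>' \<xi>'"
proof -
  have eq: "\<eta> = f \<xi> \<longleftrightarrow> \<eta>' = f \<xi>'"
    if "\<And>\<zeta> i k'. k < k' \<Longrightarrow> f \<zeta> (i, k') = \<zeta> (i, k')" "\<And>i k'. k' \<le> k \<Longrightarrow> f \<xi> (i, k') = f \<xi>' (i, k')" for f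
  proof -
    have "\<eta> x = f \<xi> x \<longleftrightarrow> \<eta>' x = f \<xi>' x" for x
      using that low high by (cases x; cases "snd x \<le> k") auto
    then show ?thesis by (simp add: fun_eq_iff)
  qed
  have "\<eta> = \<xi> \<longleftrightarrow> \<eta>' = \<xi>'" using eq[of "\<lambda>\<zeta>. \<zeta>"] low by simp
  moreover have "\<eta> = shift_up \<xi> j (k - 1) \<longleftrightarrow> \<eta>' = shift_up \<xi>' j (k - 1)" for j
    by (rule eq) (use low assms(5) in \<open>auto simp: shift_up_apply\<close>)
  moreover have "\<eta> = shift_down \<xi> j (k - 1) \<longleftrightarrow> \<eta>' = shift_down \<xi>' j (k - 1)" for j
    by (rule eq) (use low assms(5) in \<open>auto simp: shift_down_apply\<close>)
  ultimately show ?thesis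
    unfolding gen_entry_def using coeffs_local[of k \<xi> \<xi>', OF low(1)] by (simp cong: if_cong)
qed

lemma gen_entry_preserves_high:
  assumes "gen_entry s r k e \<eta> \<xi> \<noteq> 0" "k - 1 < k'"
  shows "\<eta> (j, k') = \<xi> (j, k')"
proof (rule ccontr)
  assume ne: "\<eta> (j, k') \<noteq> \<xi> (j, k')"
  then have "\<eta> \<noteq> \<xi>" "\<eta> \<noteq> shift_up \<xi> i (k - 1)" "\<eta> \<noteq> shift_down \<xi> i (k - 1)" for i
    using assms(2) by (auto simp: shift_up_apply shift_down_apply)
  with assms(1) show False by (simp add: gen_entry_def)
qed

lemma shift_up_eq_iff: "shift_up \<xi> i k = shift_up \<xi> j k \<longleftrightarrow> i = j"
  by (metis add_cancel_right_right prod.inject shift_up_apply zero_neq_one)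

lemma shift_down_eq_iff: "shift_down \<xi> i k = shift_down \<xi> j k \<longleftrightarrow> i = j"
  by (metis diff_zero diff_left_imp_eq diff_0_right prod.inject shift_down_apply zero_neq_one)

lemma shift_up_neq: "shift_up \<xi> i k \<noteq> \<xi>" "shift_up \<xi> i k \<noteq> shift_down \<xi> j k" "shift_down \<xi> i k \<noteq> \<xi>"
proof -
  have "shift_up \<xi> i k (i, k) > \<xi> (i, k)" "shift_down \<xi> j k (i, k) \<le> \<xi> (i, k)"
    "shift_down \<xi> i k (i, k) < \<xi> (i, k)"
    by (simp_all add: shift_up_apply shift_down_apply)
  then show "shift_up \<xi> i k \<noteq> \<xi>" "shift_up \<xi> i k \<noteq> shift_down \<xi> j k" "shift_down \<xi> i k \<noteq> \<xi>"
    by (metis less_irrefl not_less)+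
qed

lemma gen_entry_diag: "gen_entry s r k e \<xi> \<xi> = of_int e * diag_coeff s k \<xi>"
  using shift_up_neq[of \<xi> _ "k - 1"] by (simp add: gen_entry_def eq_commute[of \<xi>])

lemma gen_entry_up:
  assumes "1 \<le> j" "j \<le> (k - 1) div 2"
  shows "gen_entry s r k e (shift_up \<xi> j (k - 1)) \<xi> = up_coeff s r k j \<xi>"
  using shift_up_neq[of \<xi> _ "k - 1"] assms
  by (simp add: gen_entry_def shift_up_eq_iff sum.delta)

lemma gen_entry_down:
  assumes "1 \<le> j" "j \<le> (k - 1) div 2"
  shows "gen_entry s r k e (shift_down \<xi> j (k - 1)) \<xi> = - down_coeff s r k j \<xi>"
  using shift_up_neq[of \<xi> _ "k - 1"] assms
  by (simp add: gen_entry_def shift_down_eq_iff sum.delta not_sym)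

context non_root
begin

text \<open>The downward move from the raised tableau uses the same A or B as the upward move from
  \<open>\<xi>\<close>; only the denominators differ. Both directions are needed to return along a
  path.\<close>

lemma gen_entry_nonzero:
  assumes adm: "nonclassically_admissible n \<epsilon> m"
    and \<xi>: "\<xi> \<in> nonclassical_tableaux n m" and up: "shift_up \<xi> j (k - 1) \<in> nonclassical_tableaux n m"
    and j: "1 \<le> j" "j \<le> (k - 1) div 2" and k: "k \<le> n"
  shows "gen_entry s r k e (shift_up \<xi> j (k - 1)) \<xi> \<noteq> 0" "gen_entry s r k e \<xi> (shift_up \<xi> j (k - 1)) \<noteq> 0"
proof -
  let ?\<eta> = "shift_up \<xi> j (k - 1)"
  have k': "k - 1 \<le> n" "2 \<le> k - 1" using j k by auto
  note H = half_integers_double[OF tableau_l_half_integer[OF adm _ k' j]]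
  have y: "l \<zeta> j (k - 1) \<ge> 1/2" "l \<zeta> j (k - 1) \<in> half_integers" if "\<zeta> \<in> nonclassical_tableaux n m" for \<zeta>
    using l_ge(2)[OF adm that k' j] tableau_l_half_integer[OF adm that k' j] by auto
  \<comment> \<open>Denominators are evaluated at either end of the move, hence treated for an
    arbitrary tableau \<open>\<zeta>\<close>.\<close>
  have even: "coeff_B r (k div 2) j \<xi> \<noteq> 0" "qbr s (2 * l \<zeta> j (k - 1) - 1) \<noteq> 0"
      "qbr_plus s (l \<zeta> j (k - 1)) \<noteq> 0" "qbr_plus s (l \<zeta> j (k - 1) - 1) \<noteq> 0"
    if "even k" "\<zeta> \<in> nonclassical_tableaux n m" for \<zeta>
  proof -
    from that(1) k' obtain u where "k = 2 * u" by blast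
    with k' obtain t where t: "k = Suc (Suc (2 * t))" by (intro that[of "u - 1"]) simp
    have "odd (k - 1)" using t by simp
    show "coeff_B r (k div 2) j \<xi> \<noteq> 0"
      using coeff_B_nonzero[OF adm \<xi>, of j t] up j k t by simp
    have "l \<zeta> j (k - 1) \<ge> 3/2"
      using l_ge(1)[OF adm that(2) k' j] of_nat_le_rat(1)[OF j(2)] \<open>odd (k - 1)\<close> by simp
    moreover have "2 * (2 * l \<zeta> j (k - 1) - 1) \<in> \<int>"
      using Ints_diff[OF Ints_mult[OF _ H[OF that(2)], of 2] Ints_of_nat[of 2]] by simp
    ultimately show "qbr s (2 * l \<zeta> j (k - 1) - 1) \<noteq> 0" by (intro qbr_nonzero) auto
    show "qbr_plus s (l \<zeta> j (k - 1)) \<noteq> 0" by (rule qbr_plus_nonzero[OF H[OF that(2)]])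
    have "2 * (l \<zeta> j (k - 1) - 1) \<in> \<int>" using Ints_diff[OF H[OF that(2)], of 2] by (simp add: right_diff_distrib)
    then show "qbr_plus s (l \<zeta> j (k - 1) - 1) \<noteq> 0" by (rule qbr_plus_nonzero)
  qed
  have odd: "coeff_A r (k div 2) j \<xi> \<noteq> 0" "qpow s (l \<zeta> j (k - 1)) - qpow s (- l \<zeta> j (k - 1)) \<noteq> 0"
    if "odd k" "\<zeta> \<in> nonclassical_tableaux n m" for \<zeta>
  proof -
    from that(1) obtain p where p: "k = Suc (2 * p)" by (auto elim: oddE)
    show "coeff_A r (k div 2) j \<xi> \<noteq> 0" using coeff_A_nonzero[OF adm \<xi>, of j p] up j k p by simp
    show "qpow s (l \<zeta> j (k - 1)) - qpow s (- l \<zeta> j (k - 1)) \<noteq> 0"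
      using y(1)[OF that(2)] by (intro qpow_diff_nonzero H that(2)) auto
  qed
  show "gen_entry s r k e ?\<eta> \<xi> \<noteq> 0"
    unfolding gen_entry_up[OF j] up_coeff_def Let_def using even[OF _ \<xi>] odd[OF _ \<xi>] by simp
  have "gen_entry s r k e \<xi> ?\<eta> = - down_coeff s r k j ?\<eta>"
    using gen_entry_down[OF j, of s r e ?\<eta>] by (simp only: shift_down_shift_up)
  then show "gen_entry s r k e \<xi> ?\<eta> \<noteq> 0"
    unfolding down_coeff_def Let_def shift_down_shift_up using even[OF _ up] odd[OF _ up] by simp
qed

lemma diag_coeff_nonzero:
  assumes adm: "nonclassically_admissible n \<epsilon> m" and \<xi>: "\<xi> \<in> nonclassical_tableaux n m" and k: "k \<le> n"
    and "odd k \<Longrightarrow> \<xi> (k div 2, k - 1) = 1/2"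
  shows "diag_coeff s k \<xi> \<noteq> 0"
proof (cases "even k")
  case True
  with k coeff_C_hat_nonzero[OF adm \<xi>, of "k div 2"] show ?thesis by (simp add: diag_coeff_def)
next
  case False
  moreover from this have "Suc (2 * (k div 2)) \<le> n" using k by simp
  ultimately show ?thesis
    using assms(4) coeff_D_nonzero[OF adm \<xi>, of "k div 2"] s_diff_half_nonzero by (simp add: diag_coeff_def)
qed

end

section \<open>Linear maps on finitely supported functions\<close>

lemma space_on_iff: "x \<in> space_on S \<longleftrightarrow> (\<forall>b. b \<notin> S \<longrightarrow> Poly_Mapping.lookup x b = 0)"
  by (auto simp: space_on_def in_keys_iff)

lemma cscale_ket_in_space_on: "b \<in> S \<Longrightarrow> cscale c (ket b) \<in> space_on S"
  by (auto simp: space_on_iff lookup_cscale lookup_single when_def)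

lemma ket_in_space_on: "b \<in> S \<Longrightarrow> ket b \<in> space_on S"
  by (auto simp: space_on_iff lookup_single when_def)

lemma cscale_0: "cscale 0 x = 0" "cscale c 0 = 0"
  by (simp_all add: poly_mapping_eq_iff fun_eq_iff lookup_cscale)

lemma ket_nonzero: "ket b \<noteq> 0"
  by (metis lookup_single_eq lookup_zero zero_neq_one)

lemma linear_between_expand:
  assumes "finite S" and f: "linear_between (space_on S) W f" and "x \<in> space_on S"
  shows "f x = (\<Sum>b\<in>S. cscale (Poly_Mapping.lookup x b) (f (ket b)))"
proof -
  \<comment> \<open>Linearity of \<open>f\<close> is available on \<open>space_on S\<close> only, so
    the induction runs over subsets of \<open>S\<close> and every partial vector stays in that
    space.\<close>
  have "\<forall>x\<in>space_on A. f x = (\<Sum>b\<in>A. cscale (Poly_Mapping.lookup x b) (f (ket b)))" if "A \<subseteq> S" for A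
    using finite_subset[OF that assms(1)] that
  proof (induction A rule: finite_induct)
    case empty
    have "f (cscale 0 0) = cscale 0 (f 0)" using f by (simp add: linear_between_def space_on_def)
    then have "f 0 = 0" by (simp add: cscale_0)
    moreover have "x = 0" if "x \<in> space_on {}" for x :: "'a \<Rightarrow>\<^sub>0 complex"
      using that by (simp add: space_on_iff poly_mapping_eq_iff fun_eq_iff)
    ultimately show ?case by auto
  next
    case (insert a A)
    show ?case
    proof
      fix x assume x: "x \<in> space_on (insert a A)"
      define y where "y = x - cscale (Poly_Mapping.lookup x a) (ket a)"
      have y: "Poly_Mapping.lookup y b = (if b = a then 0 else Poly_Mapping.lookup x b)" for b
        by (simp add: y_def lookup_minus lookup_cscale lookup_single when_def)
      have yA: "y \<in> space_on A" using x by (auto simp: space_on_iff y)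
      have "x = cscale (Poly_Mapping.lookup x a) (ket a) + y" by (simp add: y_def)
      moreover have "cscale (Poly_Mapping.lookup x a) (ket a) \<in> space_on S" "ket a \<in> space_on S"
        using insert.prems by (auto intro: cscale_ket_in_space_on ket_in_space_on)
      moreover have "y \<in> space_on S" using insert.prems yA by (auto simp: space_on_iff)
      ultimately have "f x = cscale (Poly_Mapping.lookup x a) (f (ket a)) + f y"
        using f unfolding linear_between_def by metis
      also have "f y = (\<Sum>b\<in>A. cscale (Poly_Mapping.lookup y b) (f (ket b)))"
        using insert yA by blast
      also have "\<dots> = (\<Sum>b\<in>A. cscale (Poly_Mapping.lookup x b) (f (ket b)))"
        using insert.hyps by (intro sum.cong) (auto simp: y)
      finally show "f x = (\<Sum>b\<in>insert a A. cscale (Poly_Mapping.lookup x b) (f (ket b)))"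
        using insert.hyps by simp
    qed
  qed
  with assms(3) show ?thesis by blast
qed

lemma linear_between_lookup:
  assumes "finite S" "linear_between (space_on S) W f" "x \<in> space_on S"
  shows "Poly_Mapping.lookup (f x) c =
    (\<Sum>b\<in>S. Poly_Mapping.lookup x b * Poly_Mapping.lookup (f (ket b)) c)"
  unfolding linear_between_expand[OF assms] by (simp add: lookup_sum lookup_cscale)

lemma gen_carrier: "2 \<le> i \<Longrightarrow> i \<le> n \<Longrightarrow> gen i \<in> carrier (free_algebra n)"
  by (simp add: gen_def free_algebra_def)

lemma scalar_carrier: "scalar c \<in> carrier (free_algebra n)"
  by (simp add: scalar_def free_algebra_def zero_word_def)

lemma Uq_class_carrier: "a \<in> carrier (free_algebra n) \<Longrightarrow> Uq_class n q a \<in> carrier (Uq n q)"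
  by (auto simp: Uq_def Uq_class_def FactRing_def A_RCOSETS_def')

lemma Uq_ring: "ring (Uq n q)"
  unfolding Uq_def by (rule ideal.quotient_is_ring[OF ideal_rel_ideal])

section \<open>Matrices realized by the algebra in two representations at once\<close>

text \<open>The two representations are indexed by \<open>bool\<close> and may be equal: the
  constant family yields irreducibility, two different ones yield inequivalence.\<close>

locale rep_pair = non_root q s r for q s r +
  fixes n :: nat and eps :: "bool \<Rightarrow> nat \<Rightarrow> int" and m :: "bool \<Rightarrow> nat \<Rightarrow> rat"
    and rho :: "bool \<Rightarrow> ncpoly set \<Rightarrow> (arr \<Rightarrow>\<^sub>0 complex) \<Rightarrow> (arr \<Rightarrow>\<^sub>0 complex)"
  assumes adm: "nonclassically_admissible n (eps i) (m i)"
    and rep: "nonclassical_rep s r n q (eps i) (m i) (rho i)"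
begin

abbreviation tableaux :: "bool \<Rightarrow> arr set"
  where "tableaux i \<equiv> nonclassical_tableaux n (m i)"

text \<open>One and the same element must produce the prescribed matrices in both representations;
  the closure properties below preserve this.\<close>

definition realized :: "(bool \<Rightarrow> arr \<Rightarrow> arr \<Rightarrow> complex) \<Rightarrow> bool"
  where "realized M \<longleftrightarrow> (\<exists>u\<in>carrier (Uq n q). \<forall>i. \<forall>\<xi>\<in>tableaux i. \<forall>\<eta>\<in>tableaux i.
    Poly_Mapping.lookup (rho i u (ket \<xi>)) \<eta> = M i \<eta> \<xi>)"

definition mat_mult ::
    "(bool \<Rightarrow> arr \<Rightarrow> arr \<Rightarrow> complex) \<Rightarrow> (bool \<Rightarrow> arr \<Rightarrow> arr \<Rightarrow> complex) \<Rightarrow> bool \<Rightarrow> arr \<Rightarrow> arr \<Rightarrow> complex"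
  where "mat_mult M N i \<eta> \<xi> = (\<Sum>\<zeta>\<in>tableaux i. M i \<eta> \<zeta> * N i \<zeta> \<xi>)"

definition diag :: "(bool \<Rightarrow> arr \<Rightarrow> complex) \<Rightarrow> bool \<Rightarrow> arr \<Rightarrow> arr \<Rightarrow> complex"
  where "diag f i \<eta> \<xi> = (if \<eta> = \<xi> then f i \<xi> else 0)"

lemma finite_tableaux: "finite (tableaux i)"
  by (rule finite_nonclassical_tableaux[OF adm])

lemma representation: "is_representation n q (space_on (tableaux i)) (rho i)"
  using rep by (simp add: nonclassical_rep_def)

lemma linear: "u \<in> carrier (Uq n q) \<Longrightarrow> linear_between (space_on (tableaux i)) (space_on (tableaux i)) (rho i u)"
  using representation[of i] by (simp add: is_representation_def)

lemma realized_cong: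
  assumes "realized M" "\<And>i \<xi> \<eta>. \<xi> \<in> tableaux i \<Longrightarrow> \<eta> \<in> tableaux i \<Longrightarrow> M i \<eta> \<xi> = N i \<eta> \<xi>"
  shows "realized N"
  using assms unfolding realized_def by fastforce

lemma realized_add:
  assumes "realized M" "realized N"
  shows "realized (\<lambda>i \<eta> \<xi>. M i \<eta> \<xi> + N i \<eta> \<xi>)"
proof -
  from assms obtain u v where u: "u \<in> carrier (Uq n q)" "v \<in> carrier (Uq n q)"
    "\<And>i \<xi> \<eta>. \<xi> \<in> tableaux i \<Longrightarrow> \<eta> \<in> tableaux i \<Longrightarrow> Poly_Mapping.lookup (rho i u (ket \<xi>)) \<eta> = M i \<eta> \<xi>"
    "\<And>i \<xi> \<eta>. \<xi> \<in> tableaux i \<Longrightarrow> \<eta> \<in> tableaux i \<Longrightarrow> Poly_Mapping.lookup (rho i v (ket \<xi>)) \<eta> = N i \<eta> \<xi>"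
    unfolding realized_def by metis
  have "rho i (u \<oplus>\<^bsub>Uq n q\<^esub> v) (ket \<xi>) = rho i u (ket \<xi>) + rho i v (ket \<xi>)" if "\<xi> \<in> tableaux i" for i \<xi>
    using representation[of i] u(1,2) ket_in_space_on[OF that] unfolding is_representation_def by blast
  then show ?thesis
    unfolding realized_def
    by (intro bexI[of _ "u \<oplus>\<^bsub>Uq n q\<^esub> v"]) (simp_all add: u lookup_add ring.ring_simprules(1)[OF Uq_ring])
qed

lemma realized_mult:
  assumes "realized M" "realized N"
  shows "realized (mat_mult M N)"
proof -
  from assms obtain u v where u: "u \<in> carrier (Uq n q)" "v \<in> carrier (Uq n q)"
    "\<And>i \<xi> \<eta>. \<xi> \<in> tableaux i \<Longrightarrow> \<eta> \<in> tableaux i \<Longrightarrow> Poly_Mapping.lookup (rho i u (ket \<xi>)) \<eta> = M i \<eta> \<xi>"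
    "\<And>i \<xi> \<eta>. \<xi> \<in> tableaux i \<Longrightarrow> \<eta> \<in> tableaux i \<Longrightarrow> Poly_Mapping.lookup (rho i v (ket \<xi>)) \<eta> = N i \<eta> \<xi>"
    unfolding realized_def by metis
  have "Poly_Mapping.lookup (rho i (u \<otimes>\<^bsub>Uq n q\<^esub> v) (ket \<xi>)) \<eta> = mat_mult M N i \<eta> \<xi>"
    if "\<xi> \<in> tableaux i" "\<eta> \<in> tableaux i" for i \<xi> \<eta>
  proof -
    have "rho i (u \<otimes>\<^bsub>Uq n q\<^esub> v) (ket \<xi>) = rho i u (rho i v (ket \<xi>))"
      using representation[of i] u(1,2) ket_in_space_on[OF that(1)] unfolding is_representation_def by blast
    moreover have "rho i v (ket \<xi>) \<in> space_on (tableaux i)"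
      using linear[OF u(2), of i] ket_in_space_on[OF that(1)] by (simp add: linear_between_def)
    ultimately show ?thesis
      using linear_between_lookup[OF finite_tableaux linear[OF u(1)]] that
      by (simp add: mat_mult_def u(3,4) mult.commute)
  qed
  then show ?thesis
    unfolding realized_def using u(1,2) by (intro bexI[of _ "u \<otimes>\<^bsub>Uq n q\<^esub> v"]) (simp_all add: ring.ring_simprules(5)[OF Uq_ring])
qed

lemma realized_const: "realized (diag (\<lambda>_ _. c))"
  unfolding realized_def
proof (intro bexI[of _ "Uq_class n q (scalar c)"] allI ballI)
  fix i \<xi> \<eta> assume "\<xi> \<in> tableaux i"
  then have "rho i (Uq_class n q (scalar c)) (ket \<xi>) = cscale c (ket \<xi>)"
    using representation[of i] ket_in_space_on[of \<xi> "tableaux i"] by (simp add: is_representation_def)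
  then show "Poly_Mapping.lookup (rho i (Uq_class n q (scalar c)) (ket \<xi>)) \<eta> = diag (\<lambda>_ _. c) i \<eta> \<xi>"
    by (simp add: lookup_cscale_ket diag_def)
qed (rule Uq_class_carrier[OF scalar_carrier])

lemma realized_gen: "2 \<le> k \<Longrightarrow> k \<le> n \<Longrightarrow> realized (\<lambda>i. gen_entry s r k (eps i k))"
  unfolding realized_def
  by (intro bexI[of _ "Uq_class n q (gen k)"] Uq_class_carrier gen_carrier) (simp_all add: lookup_gen_action[OF rep])

lemma mat_mult_diag_left: "\<eta> \<in> tableaux i \<Longrightarrow> mat_mult (diag f) M i \<eta> \<xi> = f i \<eta> * M i \<eta> \<xi>"
  using finite_tableaux[of i] by (simp add: mat_mult_def diag_def if_distrib[of "\<lambda>x. x * _"] sum.delta' cong: if_cong)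

lemma mat_mult_diag_right: "\<xi> \<in> tableaux i \<Longrightarrow> mat_mult M (diag f) i \<eta> \<xi> = M i \<eta> \<xi> * f i \<xi>"
  using finite_tableaux[of i] by (simp add: mat_mult_def diag_def if_distrib[of "\<lambda>x. _ * x"] sum.delta cong: if_cong)

lemma realized_scale: "realized M \<Longrightarrow> realized (\<lambda>i \<eta> \<xi>. c * M i \<eta> \<xi>)"
  using realized_cong[OF realized_mult[OF realized_const[of c], of M], of "\<lambda>i \<eta> \<xi>. c * M i \<eta> \<xi>"]
  by (simp add: mat_mult_diag_left)

lemma realized_diag_mult: "realized (diag f) \<Longrightarrow> realized (diag g) \<Longrightarrow> realized (diag (\<lambda>i \<xi>. f i \<xi> * g i \<xi>))"
  by (rule realized_cong[OF realized_mult[of "diag f" "diag g"]]) (auto simp: mat_mult_diag_left diag_def)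

lemma realized_diag_affine: "realized (diag f) \<Longrightarrow> realized (diag (\<lambda>i \<xi>. c * (f i \<xi> - d)))"
  by (rule realized_cong[OF realized_scale[OF realized_add[OF _ realized_const[of "- d"]]]]) (auto simp: diag_def)

text \<open>The key of level \<open>k\<close> records the part of a tableau and of its signs that belongs to the
  subalgebra generated by the first \<open>k - 1\<close> generators.\<close>

definition key :: "nat \<Rightarrow> bool \<Rightarrow> arr \<Rightarrow> (nat \<Rightarrow> int) \<times> arr"
  where "key k i \<xi> = ((\<lambda>k'. if k' \<le> k then eps i k' else 0), graft k \<xi> (\<lambda>_. 0))"

lemma key_eq_iff: "key k i \<xi> = key k i' \<xi>' \<longleftrightarrow>
    (\<forall>k'\<le>k. eps i k' = eps i' k') \<and> (\<forall>j k'. k' \<le> k \<longrightarrow> \<xi> (j, k') = \<xi>' (j, k'))"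
proof -
  have "(\<lambda>k'. if k' \<le> k then f k' else 0) = (\<lambda>k'. if k' \<le> k then g k' else 0) \<longleftrightarrow> (\<forall>k'\<le>k. f k' = g k')"
    for f g :: "nat \<Rightarrow> int" by (auto simp: fun_eq_iff)
  then show ?thesis unfolding key_def prod.inject graft_eq_iff by simp
qed

lemma key_mono: "key k i \<xi> = key k i' \<xi>' \<Longrightarrow> h \<le> k \<Longrightarrow> key h i \<xi> = key h i' \<xi>'"
  by (simp add: key_eq_iff)

lemma graft_key: "key k i \<xi> = key k i' \<zeta> \<Longrightarrow> graft k \<zeta> \<xi> = \<xi>"
  by (auto simp: key_eq_iff graft_def fun_eq_iff)

text \<open>Comparison across the two representations is included: coefficients of generators up to
  \<open>k\<close> cannot tell which representation a part comes from.\<close>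

definition local_fun :: "nat \<Rightarrow> (bool \<Rightarrow> arr \<Rightarrow> complex) \<Rightarrow> bool"
  where "local_fun k c \<longleftrightarrow> (\<forall>i i'. \<forall>\<xi>\<in>tableaux i. \<forall>\<xi>'\<in>tableaux i'. key k i \<xi> = key k i' \<xi>' \<longrightarrow> c i \<xi> = c i' \<xi>')"

lemma local_funD:
  "local_fun k c \<Longrightarrow> \<xi> \<in> tableaux i \<Longrightarrow> \<xi>' \<in> tableaux i' \<Longrightarrow> key k i \<xi> = key k i' \<xi>' \<Longrightarrow> c i \<xi> = c i' \<xi>'"
  unfolding local_fun_def by blast

lemma local_fun_const: "local_fun k (\<lambda>_ _. c)"
  by (simp add: local_fun_def)

lemma local_fun_mult:
  assumes "local_fun k c" "local_fun k d"
  shows "local_fun k (\<lambda>i \<xi>. c i \<xi> * d i \<xi>)"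
  unfolding local_fun_def
proof (intro allI ballI impI)
  fix i i' \<xi> \<xi>' assume "\<xi> \<in> tableaux i" "\<xi>' \<in> tableaux i'" "key k i \<xi> = key k i' \<xi>'"
  from local_funD[OF assms(1) this] local_funD[OF assms(2) this] show "c i \<xi> * d i \<xi> = c i' \<xi>' * d i' \<xi>'"
    by simp
qed

text \<open>Whether lower rows fit depends on row \<open>h + 1\<close> only, and this row belongs to
  the key since \<open>h < k\<close>. Admissibility of a graft thus transfers even to the other
  representation.\<close>

lemma graft_tableaux_cong:
  assumes "h < k" "k \<le> n" "\<xi> \<in> tableaux i" "\<xi>' \<in> tableaux i'" "key k i \<xi> = key k i' \<xi>'" "graft h \<beta> \<xi> \<in> tableaux i"
  shows "graft h \<beta> \<xi>' \<in> tableaux i'"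
proof -
  have "graft h \<beta> \<xi>' = graft k (graft h \<beta> \<xi>) \<xi>'"
    using assms(1,5) by (auto simp: eq_graft_iff graft_apply key_eq_iff)
  then show ?thesis
    using graft_tableau[OF assms(4,6,2)] assms(1,5) by (simp add: graft_apply key_eq_iff)
qed

lemma key_graft: "h \<le> k \<Longrightarrow> key k i \<xi> = key k i' \<xi>' \<Longrightarrow> key k i (graft h \<beta> \<xi>) = key k i' (graft h \<beta> \<xi>')"
  by (auto simp: key_eq_iff graft_apply)

lemma local_fun_graft:
  assumes "local_fun k c" "h < k" "k \<le> n"
  shows "local_fun k (\<lambda>i \<xi>. if graft h \<beta> \<xi> \<in> tableaux i then c i (graft h \<beta> \<xi>) else 0)"
  unfolding local_fun_def
proof (intro allI ballI impI)
  fix i i' \<xi> \<xi>' assume x: "\<xi> \<in> tableaux i" "\<xi>' \<in> tableaux i'" and k: "key k i \<xi> = key k i' \<xi>'"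
  have "graft h \<beta> \<xi> \<in> tableaux i \<longleftrightarrow> graft h \<beta> \<xi>' \<in> tableaux i'"
    using graft_tableaux_cong[OF assms(2,3) x k] graft_tableaux_cong[OF assms(2,3) x(2,1) k[symmetric]] by blast
  then show "(if graft h \<beta> \<xi> \<in> tableaux i then c i (graft h \<beta> \<xi>) else 0) =
      (if graft h \<beta> \<xi>' \<in> tableaux i' then c i' (graft h \<beta> \<xi>') else 0)"
    using local_funD[OF assms(1) _ _ key_graft[OF less_imp_le[OF assms(2)] k]] by simp
qed

text \<open>A matrix unit on the rows up to \<open>k\<close>, combined with a diagonal weight that
  may depend on the rows above. Tableaux onto which \<open>\<beta>\<close> does not fit are sent to
  zero, as only tableaux index the matrices.\<close>

definition transition ::
    "nat \<Rightarrow> (nat \<Rightarrow> int) \<times> arr \<Rightarrow> arr \<Rightarrow> (bool \<Rightarrow> arr \<Rightarrow> complex) \<Rightarrow> bool \<Rightarrow> arr \<Rightarrow> arr \<Rightarrow> complex"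
  where "transition k a \<beta> c i \<eta> \<xi> = (if key k i \<xi> = a \<and> \<eta> = graft k \<beta> \<xi> then c i \<xi> else 0)"

lemma mat_mult_transition:
  "mat_mult M (transition h a \<beta> c) i \<eta> \<xi> =
    (if key h i \<xi> = a \<and> graft h \<beta> \<xi> \<in> tableaux i then M i \<eta> (graft h \<beta> \<xi>) * c i \<xi> else 0)"
  using finite_tableaux[of i]
  by (cases "key h i \<xi> = a") (simp_all add: mat_mult_def transition_def if_distrib[of "\<lambda>x. _ * x"] sum.delta cong: if_cong)

text \<open>The weight is zero where \<open>graft h \<eta>0 \<xi>\<close> is not a tableau because
  the matrix product sums over tableaux only, so that path is missing. This effect later detects the
  box below row k.\<close>

lemma realized_transition_comp:
  assumes "realized (transition h (key h i0 \<xi>0) \<eta>0 c)" "realized (transition h (key h i0 \<eta>0) \<zeta>0 d)"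
  shows "realized (transition h (key h i0 \<xi>0) \<zeta>0
    (\<lambda>i \<xi>. (if graft h \<eta>0 \<xi> \<in> tableaux i then d i (graft h \<eta>0 \<xi>) else 0) * c i \<xi>))"
proof (rule realized_cong[OF realized_mult[OF assms(2,1)]], goal_cases)
  case (1 i \<xi> \<eta>)
  have "key h i (graft h \<eta>0 \<xi>) = key h i0 \<eta>0" if "key h i \<xi> = key h i0 \<xi>0"
    using that by (simp add: key_eq_iff graft_apply)
  moreover have "graft h \<zeta>0 (graft h \<eta>0 \<xi>) = graft h \<zeta>0 \<xi>"
    by (auto simp: graft_def fun_eq_iff)
  ultimately show ?case by (simp add: mat_mult_transition transition_def)
qed

definition matrix_units :: "nat \<Rightarrow> bool"
  where "matrix_units k \<longleftrightarrow> (\<forall>i i'. \<forall>\<xi>\<in>tableaux i. \<forall>\<xi>'\<in>tableaux i'.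
    (\<forall>k'\<le>k. eps i k' = eps i' k') \<longrightarrow> (\<forall>j. \<xi> (j, k) = \<xi>' (j, k)) \<longrightarrow>
    realized (transition k (key k i \<xi>) \<xi>' (\<lambda>_ _. 1)))"

lemma tableau_undefined: "\<xi> \<in> tableaux i \<Longrightarrow> (j, k) \<notin> positions n \<Longrightarrow> \<xi> (j, k) = undefined"
  by (auto simp: nonclassical_tableaux_iff PiE_def extensional_def)

text \<open>No position has a row index below 2, so tableaux and signs take the value
  \<open>undefined\<close> there and all keys of level 1 coincide. The claim reduces to the identity
  matrix.\<close>

lemma matrix_units_1: "matrix_units 1"
  unfolding matrix_units_def
proof (intro allI ballI impI)
  fix i0 i0' \<xi>0 \<xi>0' assume t0: "\<xi>0 \<in> tableaux i0" "\<xi>0' \<in> tableaux i0'"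
  have low: "(j, k) \<notin> positions n" if "k \<le> 1" for j k using that by (auto simp: positions_def)
  have e: "eps i k = undefined" if "k \<le> 1" for i k
    using adm[of i] that by (auto simp: nonclassically_admissible_def PiE_def extensional_def)
  show "realized (transition 1 (key 1 i0 \<xi>0) \<xi>0' (\<lambda>_ _. 1))"
  proof (rule realized_cong[OF realized_const[of 1]], goal_cases)
    case (1 i \<xi> \<eta>)
    have "key 1 i \<xi> = key 1 i0 \<xi>0" "graft 1 \<xi>0' \<xi> = \<xi>"
      using tableau_undefined[OF 1(1) low] tableau_undefined[OF t0(1) low] tableau_undefined[OF t0(2) low] e
      by (auto simp: key_eq_iff graft_def fun_eq_iff)
    then show ?case by (simp add: transition_def diag_def)
  qed
qed

lemma gen_entry_local_fun:
  assumes "h < k" "1 \<le> k" "k \<le> n"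
  shows "local_fun k (\<lambda>i \<xi>. if graft h \<beta> \<xi> \<in> tableaux i then gen_entry s r k (eps i k) (graft h \<beta> \<xi>) \<xi> else 0)"
  unfolding local_fun_def
proof (intro allI ballI impI)
  fix i i' \<xi> \<xi>' assume x: "\<xi> \<in> tableaux i" "\<xi>' \<in> tableaux i'" and k: "key k i \<xi> = key k i' \<xi>'"
  have "graft h \<beta> \<xi> \<in> tableaux i \<longleftrightarrow> graft h \<beta> \<xi>' \<in> tableaux i'"
    using graft_tableaux_cong[OF assms(1,3) x k] graft_tableaux_cong[OF assms(1,3) x(2,1) k[symmetric]] by blast
  moreover have "eps i k = eps i' k" using k by (simp add: key_eq_iff)
  moreover have "gen_entry s r k e (graft h \<beta> \<xi>) \<xi> = gen_entry s r k e (graft h \<beta> \<xi>') \<xi>'" for e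
    using k assms(1,2) by (intro gen_entry_local) (auto simp: key_eq_iff graft_apply)
  ultimately show "(if graft h \<beta> \<xi> \<in> tableaux i then gen_entry s r k (eps i k) (graft h \<beta> \<xi>) \<xi> else 0) =
      (if graft h \<beta> \<xi>' \<in> tableaux i' then gen_entry s r k (eps i' k) (graft h \<beta> \<xi>') \<xi>' else 0)"
    by simp
qed

end

section \<open>The induction step\<close>

context rep_pair
begin

context
  fixes h k :: nat
  assumes k: "k = Suc h" "2 \<le> k" "k \<le> n" and units: "matrix_units h"
begin

section \<open>Transitions produced by one more generator\<close>

lemma h_less: "h < k" and h_eq: "k - 1 = h"
  using k by simp_all

text \<open>The generator is compressed between the projections onto the keys of
  \<open>\<eta>0\<close> and \<open>\<xi>0\<close>, which are the matrix units from a part to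
  itself.\<close>

lemma realized_gen_transition:
  assumes "\<xi>0 \<in> tableaux i0" "\<eta>0 \<in> tableaux i0" "\<And>j. \<xi>0 (j, k) = \<eta>0 (j, k)"
  shows "realized (transition h (key h i0 \<xi>0) \<eta>0
    (\<lambda>i \<xi>. if graft h \<eta>0 \<xi> \<in> tableaux i then gen_entry s r k (eps i k) (graft h \<eta>0 \<xi>) \<xi> else 0))"
proof -
  have P: "realized (transition h (key h i0 \<zeta>0) \<zeta>0 (\<lambda>_ _. 1))" if "\<zeta>0 \<in> tableaux i0" for \<zeta>0
    using units that unfolding matrix_units_def by blast
  let ?X = "\<lambda>i. gen_entry s r k (eps i k)"
  let ?M = "mat_mult (transition h (key h i0 \<eta>0) \<eta>0 (\<lambda>_ _. 1)) ?X"
  have "realized (mat_mult ?M (transition h (key h i0 \<xi>0) \<xi>0 (\<lambda>_ _. 1)))"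
    by (intro realized_mult P assms realized_gen k)
  then show ?thesis
  proof (rule realized_cong)
    fix i \<xi> \<eta> assume t: "\<xi> \<in> tableaux i" "\<eta> \<in> tableaux i"
    have "transition h (key h i0 \<eta>0) \<eta>0 (\<lambda>_ _. 1) i \<eta> \<zeta> = (if \<zeta> = \<eta> then of_bool (key h i \<eta> = key h i0 \<eta>0) else 0)" for \<zeta>
    proof -
      have "graft h \<eta>0 \<zeta> = \<zeta>" if "key h i \<zeta> = key h i0 \<eta>0" by (rule graft_key[OF that])
      then show ?thesis by (auto simp: transition_def)
    qed
    then have M: "?M i \<eta> \<xi> = (if key h i \<eta> = key h i0 \<eta>0 then ?X i \<eta> \<xi> else 0)"
      using finite_tableaux[of i] t
      by (simp add: mat_mult_def if_distrib[of "\<lambda>x. x * _"] sum.delta cong: if_cong)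
    show "mat_mult ?M (transition h (key h i0 \<xi>0) \<xi>0 (\<lambda>_ _. 1)) i \<eta> \<xi> =
      transition h (key h i0 \<xi>0) \<eta>0
      (\<lambda>i \<xi>. if graft h \<eta>0 \<xi> \<in> tableaux i then gen_entry s r k (eps i k) (graft h \<eta>0 \<xi>) \<xi> else 0) i \<eta> \<xi>"
    proof (cases "key h i \<xi> = key h i0 \<xi>0")
      case True
      then have g: "graft h \<xi>0 \<xi> = \<xi>" by (rule graft_key)
      have e: "\<forall>k'\<le>h. eps i k' = eps i0 k'" using True by (simp add: key_eq_iff)
      \<comment> \<open>The key fixes the rows up to \<open>h\<close> and the generator cannot move
        the rows above \<open>h\<close>, so a nonzero entry leaves one candidate for
        \<open>\<eta>\<close>.\<close>
      have "?X i \<eta> \<xi> = 0" if "key h i \<eta> = key h i0 \<eta>0" "\<eta> \<noteq> graft h \<eta>0 \<xi>"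
      proof (rule ccontr)
        assume nz: "?X i \<eta> \<xi> \<noteq> 0"
        have "\<eta> (j, k') = \<xi> (j, k')" if "h < k'" for j k'
          using gen_entry_preserves_high[OF nz] that k(1) by simp
        moreover have "\<eta> (j, k') = \<eta>0 (j, k')" if "k' \<le> h" for j k'
          using \<open>key h i \<eta> = key h i0 \<eta>0\<close> that by (simp add: key_eq_iff)
        ultimately show False using \<open>\<eta> \<noteq> graft h \<eta>0 \<xi>\<close> by (simp add: eq_graft_iff)
      qed
      moreover have "key h i (graft h \<eta>0 \<xi>) = key h i0 \<eta>0"
        using e by (simp add: key_eq_iff graft_apply)
      ultimately show ?thesis
        using True t g by (auto simp: mat_mult_transition M transition_def)
    next
      case False
      then show ?thesis by (simp add: mat_mult_transition transition_def)
    qed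
  qed
qed

text \<open>Weaker than a matrix unit: the weight may vary with row \<open>k\<close> and may vanish
  at other tableaux. Locality at level \<open>k\<close> is recorded so that restriction to one key
  of level \<open>k\<close> makes the weight constant.\<close>

definition linked :: "bool \<Rightarrow> arr \<Rightarrow> arr \<Rightarrow> bool"
  where "linked i \<xi> \<eta> \<longleftrightarrow> \<xi> \<in> tableaux i \<and> \<eta> \<in> tableaux i \<and> \<eta> = graft h \<eta> \<xi> \<and>
    (\<exists>c. local_fun k c \<and> c i \<xi> \<noteq> 0 \<and> realized (transition h (key h i \<xi>) \<eta> c))"

lemma linked_trans:
  assumes "linked i \<xi> \<eta>" "linked i \<eta> \<zeta>"
  shows "linked i \<xi> \<zeta>"
proof -
  obtain c where c: "local_fun k c" "c i \<xi> \<noteq> 0" "realized (transition h (key h i \<xi>) \<eta> c)"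
    using assms(1) by (auto simp: linked_def)
  obtain d where d: "local_fun k d" "d i \<eta> \<noteq> 0" "realized (transition h (key h i \<eta>) \<zeta> d)"
    using assms(2) by (auto simp: linked_def)
  let ?e = "\<lambda>i \<xi>. (if graft h \<eta> \<xi> \<in> tableaux i then d i (graft h \<eta> \<xi>) else 0) * c i \<xi>"
  have t: "\<xi> \<in> tableaux i" "\<eta> \<in> tableaux i" "\<zeta> \<in> tableaux i" "graft h \<eta> \<xi> = \<eta>"
    using assms by (auto simp: linked_def)
  have "local_fun k ?e" by (intro local_fun_mult local_fun_graft c d) (use k in auto)
  moreover have "?e i \<xi> \<noteq> 0" using c d t by simp
  moreover have "realized (transition h (key h i \<xi>) \<zeta> ?e)" by (rule realized_transition_comp[OF c(3) d(3)])
  moreover have "\<zeta> = graft h \<zeta> \<xi>"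
    using assms by (auto simp: linked_def eq_graft_iff)
  ultimately show ?thesis using t unfolding linked_def by blast
qed

lemma linked_same_row:
  assumes "\<xi> \<in> tableaux i" "\<eta> \<in> tableaux i" "\<And>j k'. h \<le> k' \<Longrightarrow> \<xi> (j, k') = \<eta> (j, k')"
  shows "linked i \<xi> \<eta>"
proof -
  have "realized (transition h (key h i \<xi>) \<eta> (\<lambda>_ _. 1))"
    using units assms(1,2) assms(3)[OF order_refl] unfolding matrix_units_def by blast
  then show ?thesis
    using assms unfolding linked_def
    by (intro conjI exI[of _ "\<lambda>_ _. 1"]) (auto simp: local_fun_const eq_graft_iff)
qed

lemma linked_gen:
  assumes "\<xi> \<in> tableaux i" "\<eta> \<in> tableaux i" "\<And>j k'. h < k' \<Longrightarrow> \<xi> (j, k') = \<eta> (j, k')"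
    and "gen_entry s r k (eps i k) \<eta> \<xi> \<noteq> 0"
  shows "linked i \<xi> \<eta>"
proof -
  have g: "graft h \<eta> \<xi> = \<eta>" using assms(3) by (auto simp: graft_def fun_eq_iff)
  show ?thesis
    unfolding linked_def
    using realized_gen_transition[OF assms(1,2) assms(3)] gen_entry_local_fun[of h k \<eta>] assms g k
    by (intro conjI exI[of _ "\<lambda>i \<xi>. if graft h \<eta> \<xi> \<in> tableaux i then gen_entry s r k (eps i k) (graft h \<eta> \<xi>) \<xi> else 0"]) auto
qed

section \<open>Connecting a box of rows through its upper corner\<close>

definition top_tableau :: "arr \<Rightarrow> arr"
  where "top_tableau \<xi> = fill h (\<lambda>j. \<xi> (j, k)) \<xi>"

definition bottom_tableau :: "arr \<Rightarrow> arr"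
  where "bottom_tableau \<xi> = fill h (lower_bound \<xi> k) \<xi>"

lemma tableau_bounds:
  assumes "\<xi> \<in> tableaux i" "1 \<le> j" "j \<le> h div 2"
  shows "lower_bound \<xi> k j \<le> \<xi> (j, h)" "\<xi> (j, h) \<le> \<xi> (j, k)" "\<xi> (j, h) \<in> half_integers" "\<xi> (j, k) \<in> half_integers"
    "lower_bound \<xi> k j \<in> half_integers" "lower_bound \<xi> k j \<le> \<xi> (j, k)"
proof -
  have h: "h \<in> {2..<n}" "j \<in> {1..h div 2}" "h div 2 \<le> k div 2" using assms k by (auto intro: div_le_mono)
  with assms show b: "lower_bound \<xi> k j \<le> \<xi> (j, h)" "\<xi> (j, h) \<le> \<xi> (j, k)"
    by (auto simp: nonclassical_tableaux_iff k(1))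
  show "\<xi> (j, h) \<in> half_integers" "\<xi> (j, k) \<in> half_integers"
    using tableau_half_integer[OF adm assms(1)] h k by auto
  show "lower_bound \<xi> k j \<in> half_integers"
    using tableau_half_integer[OF adm assms(1), of k "Suc j"] half_integers_half k by (auto simp: lower_bound_def)
  show "lower_bound \<xi> k j \<le> \<xi> (j, k)" using b by simp
qed

lemma top_tableau:
  assumes "\<xi> \<in> tableaux i"
  shows "top_tableau \<xi> \<in> tableaux i"
  unfolding top_tableau_def
  by (rule fill_tableau[OF adm assms]) (use k tableau_bounds[OF assms] in auto)

lemma bottom_tableau:
  assumes "\<xi> \<in> tableaux i"
  shows "bottom_tableau \<xi> \<in> tableaux i"
  unfolding bottom_tableau_def
  by (rule fill_tableau[OF adm assms]) (use k tableau_bounds[OF assms] in auto)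

text \<open>The upper corner depends on the rows above \<open>h\<close> only, so it is a common
  meeting point of all tableaux that agree there.\<close>

lemma top_tableau_cong:
  assumes "\<xi> \<in> tableaux i" "\<eta> \<in> tableaux i" "\<And>j k'. h < k' \<Longrightarrow> \<xi> (j, k') = \<eta> (j, k')"
  shows "top_tableau \<xi> = top_tableau \<eta>"
proof -
  have "\<xi> (j, k') = \<eta> (j, k')" if "(j, k') \<notin> positions h" for j k'
  proof (cases "h < k'")
    case False
    then have "(j, k') \<notin> positions n" using that k by (auto simp: positions_def)
    then show ?thesis using tableau_undefined assms(1,2) by metis
  qed (rule assms(3))
  then show ?thesis using assms(3)[OF h_less] by (auto simp: top_tableau_def fill_def fun_eq_iff)
qed

text \<open>Induction on the total distance of row \<open>h\<close> from the upper corner of its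
  box: as long as it is positive, some entry can be raised by one, with links in both
  directions.\<close>

lemma linked_top:
  assumes "\<xi> \<in> tableaux i"
  shows "linked i \<xi> (top_tableau \<xi>) \<and> linked i (top_tableau \<xi>) \<xi>"
  using assms
proof (induction "\<Sum>j\<in>{1..h div 2}. nat \<lfloor>\<xi> (j, k) - \<xi> (j, h)\<rfloor>" arbitrary: \<xi> rule: less_induct)
  case (less \<xi>)
  note \<xi> = \<open>\<xi> \<in> tableaux i\<close>
  note B = tableau_bounds[OF \<xi>]
  show ?case
  proof (cases "\<forall>j\<in>{1..h div 2}. \<xi> (j, h) = \<xi> (j, k)")
    case True
    have "\<xi> (j, k') = top_tableau \<xi> (j, k')" if "h \<le> k'" for j k'
      using True that by (auto simp: top_tableau_def fill_apply positions_def)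
    then show ?thesis using linked_same_row[OF \<xi> top_tableau[OF \<xi>]] linked_same_row[OF top_tableau[OF \<xi>] \<xi>] by simp
  next
    case False
    then obtain j where j: "1 \<le> j" "j \<le> h div 2" "\<xi> (j, h) \<noteq> \<xi> (j, k)" by auto
    have h: "2 \<le> h" "h \<le> n" using j k by auto
    have less_row: "\<xi> (j, h) + 1 \<le> \<xi> (j, k)"
      using B[OF j(1,2)] j(3) by (intro Ints_less_imp_le half_integers_diff) auto
    define \<mu> where "\<mu> = (\<lambda>j'. \<xi> (j', h))"
    define \<mu>' where "\<mu>' = \<mu>(j := \<mu> j + 1)"
    have \<mu>': "\<mu>' j' \<in> half_integers \<and> lower_bound \<xi> k j' \<le> \<mu>' j' \<and> \<mu>' j' \<le> \<xi> (j', k) \<and> \<mu> j' \<le> \<mu>' j'"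
      if "1 \<le> j'" "j' \<le> h div 2" for j'
      using B[OF that] less_row half_integers_add_int[of "\<xi> (j, h)" 1] by (auto simp: \<mu>'_def \<mu>_def)
    \<comment> \<open>With the given lower rows, raising entry \<open>j\<close> might violate
      interlacing with row \<open>h - 1\<close>. The lower rows are therefore first reset to
      truncations of row \<open>h\<close>, which takes only matrix units of level
      \<open>h\<close>.\<close>
    define \<xi>1 where "\<xi>1 = fill h \<mu> \<xi>"
    define \<zeta> where "\<zeta> = fill h \<mu>' \<xi>"
    define \<xi>2 where "\<xi>2 = shift_up \<xi>1 j h"
    have t1: "\<xi>1 \<in> tableaux i"
      unfolding \<xi>1_def by (rule fill_tableau[OF adm \<xi>]) (use k B in \<open>auto simp: \<mu>_def\<close>)
    have \<zeta>: "\<zeta> \<in> tableaux i"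
      unfolding \<zeta>_def by (rule fill_tableau[OF adm \<xi>]) (use k \<mu>' in auto)
    have \<zeta>_row: "\<zeta> (j', h) = \<mu>' j'" if "1 \<le> j'" "j' \<le> h div 2" for j'
      using that h by (simp add: \<zeta>_def fill_apply positions_def)
    \<comment> \<open>Filling with \<open>\<mu>'\<close> raises entry \<open>j\<close> in lower rows
      too. Refilling the rows below \<open>h\<close> with \<open>\<mu>\<close> undoes this and shows
      that the plain shift of \<open>\<xi>1\<close> is a tableau.\<close>
    have "fill (h - 1) \<mu> \<zeta> \<in> tableaux i"
    proof (rule fill_tableau[OF adm \<zeta>])
      fix j' assume j': "1 \<le> j'" "j' \<le> (h - 1) div 2"
      then have j'h: "j' \<le> h div 2" by linarith
      have "lower_bound \<zeta> h j' \<le> \<mu> j'"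
      proof (cases "Suc j' \<le> h div 2")
        case True
        moreover have "h div 2 \<le> k div 2" using k by (simp add: div_le_mono)
        ultimately have "\<mu>' (Suc j') \<le> lower_bound \<xi> k j'" using \<mu>'[of "Suc j'"] by (simp add: lower_bound_def)
        then show ?thesis using True B[OF j'(1) j'h] \<zeta>_row[of "Suc j'"] by (simp add: lower_bound_def \<mu>_def)
      next
        case False
        then show ?thesis
          using tableau_ge_half[OF adm \<xi>, of h j'] h j' j'h by (simp add: lower_bound_def \<mu>_def)
      qed
      then show "\<mu> j' \<in> half_integers \<and> lower_bound \<zeta> (Suc (h - 1)) j' \<le> \<mu> j' \<and> \<mu> j' \<le> \<zeta> (j', Suc (h - 1))"
        using h B[OF j'(1) j'h] \<mu>'[OF j'(1) j'h] \<zeta>_row[OF j'(1) j'h] by (simp add: \<mu>_def)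
    qed (use h in auto)
    also have "fill (h - 1) \<mu> \<zeta> = \<xi>2"
      using h j by (auto simp: fun_eq_iff \<xi>2_def \<xi>1_def \<zeta>_def shift_up_apply fill_apply positions_def \<mu>'_def)
    finally have t2: "\<xi>2 \<in> tableaux i" .
    have r1: "\<xi> (j', k') = \<xi>1 (j', k')" if "h \<le> k'" for j' k'
      using that by (auto simp: \<xi>1_def fill_apply positions_def \<mu>_def)
    have r2: "\<xi>1 (j', k') = \<xi>2 (j', k')" if "h < k'" for j' k'
      using that by (auto simp: \<xi>2_def shift_up_apply)
    have l1: "linked i \<xi> \<xi>1" "linked i \<xi>1 \<xi>" using linked_same_row[OF \<xi> t1] linked_same_row[OF t1 \<xi>] r1 by auto
    have "linked i \<xi>1 \<xi>2" "linked i \<xi>2 \<xi>1"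
      using gen_entry_nonzero[OF adm t1, of j k "eps i k"] t2 j k(3) r2
      by (auto intro!: linked_gen t1 t2 simp: h_eq[simplified] \<xi>2_def[symmetric])
    with l1 have l2: "linked i \<xi> \<xi>2" "linked i \<xi>2 \<xi>" by (blast intro: linked_trans)+
    have "(\<Sum>j\<in>{1..h div 2}. nat \<lfloor>\<xi>2 (j, k) - \<xi>2 (j, h)\<rfloor>) < (\<Sum>j\<in>{1..h div 2}. nat \<lfloor>\<xi> (j, k) - \<xi> (j, h)\<rfloor>)"
    proof (rule sum_strict_mono_ex1)
      have e: "\<xi>2 (j', k) = \<xi> (j', k)" "\<xi>2 (j', h) = \<xi> (j', h) + (if j' = j then 1 else 0)" for j'
        using r1[of h] r1[of k] r2[of k] k(1) by (auto simp: \<xi>2_def shift_up_apply)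
      show "\<forall>j\<in>{1..h div 2}. nat \<lfloor>\<xi>2 (j, k) - \<xi>2 (j, h)\<rfloor> \<le> nat \<lfloor>\<xi> (j, k) - \<xi> (j, h)\<rfloor>"
        by (intro ballI nat_mono floor_mono) (simp add: e)
      have "nat \<lfloor>\<xi>2 (j, k) - \<xi>2 (j, h)\<rfloor> < nat \<lfloor>\<xi> (j, k) - \<xi> (j, h)\<rfloor>"
      proof -
        have "\<xi>2 (j, k) - \<xi>2 (j, h) = \<xi> (j, k) - \<xi> (j, h) - 1" by (simp add: e)
        moreover have "\<lfloor>\<xi> (j, k) - \<xi> (j, h)\<rfloor> \<ge> 1" using less_row by linarith
        ultimately show ?thesis by (simp only: floor_diff_one)
      qed
      then show "\<exists>j\<in>{1..h div 2}. nat \<lfloor>\<xi>2 (j, k) - \<xi>2 (j, h)\<rfloor> < nat \<lfloor>\<xi> (j, k) - \<xi> (j, h)\<rfloor>" using j by auto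
    qed simp
    from less.hyps[OF this t2] have "linked i \<xi>2 (top_tableau \<xi>2)" "linked i (top_tableau \<xi>2) \<xi>2" by auto
    moreover have "top_tableau \<xi>2 = top_tableau \<xi>"
      using r1 r2 by (intro top_tableau_cong[OF t2 \<xi>]) auto
    ultimately show ?thesis using l2 by (metis linked_trans)
  qed
qed

lemma linked_all:
  assumes "\<xi> \<in> tableaux i" "\<eta> \<in> tableaux i" "\<And>j k'. h < k' \<Longrightarrow> \<xi> (j, k') = \<eta> (j, k')"
  shows "linked i \<xi> \<eta>"
  using linked_top[OF assms(1)] linked_top[OF assms(2)] top_tableau_cong[OF assms] by (metis linked_trans)

section \<open>Separating keys by diagonal matrices\<close>

definition inseparable :: "bool \<Rightarrow> arr \<Rightarrow> bool \<Rightarrow> arr \<Rightarrow> bool"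
  where "inseparable i \<xi> i' \<xi>' \<longleftrightarrow> (\<forall>f. realized (diag f) \<longrightarrow> local_fun k f \<longrightarrow> f i \<xi> = f i' \<xi>')"

lemma inseparable_sym: "inseparable i \<xi> i' \<xi>' \<Longrightarrow> inseparable i' \<xi>' i \<xi>"
  unfolding inseparable_def by metis

text \<open>A transition followed by its reverse is diagonal, so inseparable tableaux must allow the same
  transitions.\<close>

lemma inseparable_transport:
  assumes t: "\<xi> \<in> tableaux i" "\<eta> \<in> tableaux i" "\<xi>' \<in> tableaux i'"
    and row: "\<And>j k'. h < k' \<Longrightarrow> \<xi> (j, k') = \<eta> (j, k')" and ins: "inseparable i \<xi> i' \<xi>'"
  shows "key h i \<xi> = key h i' \<xi>'" "graft h \<eta> \<xi>' \<in> tableaux i'" "inseparable i \<eta> i' (graft h \<eta> \<xi>')"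
proof -
  obtain c where c: "local_fun k c" "c i \<xi> \<noteq> 0" "realized (transition h (key h i \<xi>) \<eta> c)"
    using linked_all[OF t(1,2) row] by (auto simp: linked_def)
  obtain d where d: "local_fun k d" "d i \<eta> \<noteq> 0" "realized (transition h (key h i \<eta>) \<xi> d)"
    using linked_all[OF t(2,1)] row by (auto simp: linked_def)
  have \<eta>: "graft h \<eta> \<xi> = \<eta>" using row by (auto simp: graft_def fun_eq_iff)
  \<comment> \<open>\<open>H f\<close> is the weight of the round trip to the tableau with lower
    rows \<open>\<eta>\<close> and back, with \<open>f\<close> inserted at the far end;
    \<open>G f\<close> restricts it to the key where the trip starts.\<close>
  define H :: "(bool \<Rightarrow> arr \<Rightarrow> complex) \<Rightarrow> bool \<Rightarrow> arr \<Rightarrow> complex" where "H = (\<lambda>f i0 \<xi>0. (if graft h \<eta> \<xi>0 \<in> tableaux i0 then d i0 (graft h \<eta> \<xi>0) * f i0 (graft h \<eta> \<xi>0) else 0) * c i0 \<xi>0)"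
  define G where "G f i0 \<xi>0 = (if key h i0 \<xi>0 = key h i \<xi> then 1 else 0) * H f i0 \<xi>0" for f i0 \<xi>0
  have G: "G f i \<xi> = G f i' \<xi>'" if f: "realized (diag f)" "local_fun k f" for f
  proof -
    have "realized (transition h (key h i \<eta>) \<xi> (\<lambda>i \<xi>. d i \<xi> * f i \<xi>))"
      by (rule realized_cong[OF realized_mult[OF d(3) f(1)]]) (simp add: mat_mult_diag_right transition_def)
    from realized_transition_comp[OF c(3) this] have "realized (transition h (key h i \<xi>) \<xi> (H f))"
      by (simp only: H_def)
    then have "realized (diag (G f))"
    proof (rule realized_cong)
      fix i0 \<xi>0 \<eta>0
      have "graft h \<xi> \<xi>0 = \<xi>0" if "key h i0 \<xi>0 = key h i \<xi>" by (rule graft_key[OF that])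
      then show "transition h (key h i \<xi>) \<xi> (H f) i0 \<eta>0 \<xi>0 = diag (G f) i0 \<eta>0 \<xi>0"
        by (auto simp: transition_def diag_def G_def)
    qed
    moreover have "local_fun k (\<lambda>i0 \<xi>0. if key h i0 \<xi>0 = key h i \<xi> then 1 else 0)"
      unfolding local_fun_def using k(1) by (metis key_mono le_SucI order_refl)
    then have "local_fun k (G f)"
      unfolding G_def H_def by (intro local_fun_mult local_fun_graft c d f) (use k in auto)
    ultimately show ?thesis using ins by (simp add: inseparable_def)
  qed
  \<comment> \<open>The case f = 1 tests whether the trip is possible at all: its weight is nonzero
    at \<open>\<xi>\<close>, hence at \<open>\<xi>'\<close>.\<close>
  have one: "G (\<lambda>_ _. 1) i \<xi> = G (\<lambda>_ _. 1) i' \<xi>'" by (intro G realized_const local_fun_const)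
  have "G (\<lambda>_ _. 1) i \<xi> = d i \<eta> * c i \<xi>" using t by (simp add: G_def H_def \<eta>)
  with c(2) d(2) one have nz: "G (\<lambda>_ _. 1) i' \<xi>' \<noteq> 0" by (metis mult_eq_0_iff)
  then have "key h i' \<xi>' = key h i \<xi>" and mem: "graft h \<eta> \<xi>' \<in> tableaux i'"
    by (auto simp: G_def H_def split: if_splits)
  then show "key h i \<xi> = key h i' \<xi>'" "graft h \<eta> \<xi>' \<in> tableaux i'" by auto
  \<comment> \<open>Cancelling the weight of the trip with f = 1 recovers the value of
    \<open>f\<close> at the far end.\<close>
  have "f i \<eta> = f i' (graft h \<eta> \<xi>')" if f: "realized (diag f)" "local_fun k f" for f
  proof -
    have "G f i \<xi> = G (\<lambda>_ _. 1) i \<xi> * f i \<eta>" using t by (simp add: G_def H_def \<eta>)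
    moreover have "G f i' \<xi>' = G (\<lambda>_ _. 1) i' \<xi>' * f i' (graft h \<eta> \<xi>')"
      using mem by (simp add: G_def H_def)
    ultimately show ?thesis using G[OF f] nz one by simp
  qed
  then show "inseparable i \<eta> i' (graft h \<eta> \<xi>')" by (auto simp: inseparable_def)
qed

lemma top_bottom_tableau_high: "h < k' \<Longrightarrow> top_tableau \<xi> (j, k') = \<xi> (j, k')" "h < k' \<Longrightarrow> bottom_tableau \<xi> (j, k') = \<xi> (j, k')"
  by (auto simp: top_tableau_def bottom_tableau_def fill_apply positions_def)

text \<open>Both corners of the box below row \<open>k\<close> of \<open>\<xi>\<close> must also fit
  below row \<open>k\<close> of \<open>\<xi>'\<close>, so the first box lies in the second. The ends
  of the intervals are entries of row \<open>k\<close>, and symmetry will give equality.\<close>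

lemma inseparable_row_le:
  assumes t: "\<xi> \<in> tableaux i" "\<xi>' \<in> tableaux i'" and ins: "inseparable i \<xi> i' \<xi>'" and j: "1 \<le> j" "j \<le> h div 2"
  shows "\<xi> (j, k) \<le> \<xi>' (j, k)" "Suc j \<le> k div 2 \<Longrightarrow> \<xi>' (Suc j, k) \<le> \<xi> (Suc j, k)"
proof -
  have pos: "(j, h) \<in> positions h" using j by (simp add: positions_def)
  have "graft h (top_tableau \<xi>) \<xi>' \<in> tableaux i'"
    using inseparable_transport(2)[OF t(1) top_tableau[OF t(1)] t(2) _ ins] top_bottom_tableau_high by simp
  from tableau_bounds(2)[OF this j] show "\<xi> (j, k) \<le> \<xi>' (j, k)"
    using pos h_less by (simp add: graft_apply top_tableau_def fill_apply)
  have "graft h (bottom_tableau \<xi>) \<xi>' \<in> tableaux i'"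
    using inseparable_transport(2)[OF t(1) bottom_tableau[OF t(1)] t(2) _ ins] top_bottom_tableau_high by simp
  from tableau_bounds(1)[OF this j] show "\<xi>' (Suc j, k) \<le> \<xi> (Suc j, k)" if "Suc j \<le> k div 2"
    using pos h_less that by (simp add: graft_apply bottom_tableau_def fill_apply lower_bound_def)
qed

lemma inseparable_key:
  assumes t: "\<xi> \<in> tableaux i" "\<xi>' \<in> tableaux i'" and ins: "inseparable i \<xi> i' \<xi>'"
  shows "key k i \<xi> = key k i' \<xi>'"
proof -
  have kh: "key h i \<xi> = key h i' \<xi>'" by (rule inseparable_transport(1)[OF t(1,1,2) refl ins])
  have eps_pm: "eps i k \<in> {1, -1}" for i
    using adm[of i] k by (auto simp: nonclassically_admissible_def)
  have out: "\<xi> (j, k) = \<xi>' (j, k)" if "\<not> (1 \<le> j \<and> j \<le> k div 2)" for j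
    using tableau_undefined[OF t(1)] tableau_undefined[OF t(2)] that by (simp add: positions_def)
  have "(\<forall>j. \<xi> (j, k) = \<xi>' (j, k)) \<and> eps i k = eps i' k"
  \<comment> \<open>Row 1 is empty, so at level 2 no box is available; I_{2,1} is diagonal and its
    eigenvalue settles both the row and the sign.\<close>
  proof (cases "k = 2")
    case True
    have "realized (diag (\<lambda>i \<xi>. gen_entry s r k (eps i k) \<xi> \<xi>))"
      by (rule realized_cong[OF realized_gen[OF k(2,3)]]) (auto simp: diag_def gen_entry_def True)
    moreover have "local_fun k (\<lambda>i \<xi>. gen_entry s r k (eps i k) \<xi> \<xi>)"
      unfolding local_fun_def gen_entry_diag
      by (intro allI ballI impI arg_cong2[where f = "(*)"] coeffs_local(3)) (auto simp: key_eq_iff)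
    ultimately have "gen_entry s r k (eps i k) \<xi> \<xi> = gen_entry s r k (eps i' k) \<xi>' \<xi>'"
      using ins unfolding inseparable_def by blast
    then have eq: "of_int (eps i k) * qbr_plus s (l \<xi> 1 2) = of_int (eps i' k) * qbr_plus s (l \<xi>' 1 2)"
      by (simp add: gen_entry_diag diag_coeff_def coeff_C_hat_def True)
    have l: "l \<zeta> 1 2 > 0" "2 * l \<zeta> 1 2 \<in> \<int>" if "\<zeta> \<in> tableaux i" for \<zeta> i
      using l_ge(2)[OF adm that, of 2 1] half_integers_double[OF tableau_l_half_integer[OF adm that, of 2 1]] k
      by auto
    have "eps i k = eps i' k" "l \<xi> 1 2 = l \<xi>' 1 2"
      using qbr_plus_inj[OF l(2)[OF t(1)] l(2)[OF t(2)] l(1)[OF t(1)] l(1)[OF t(2)] eps_pm eps_pm eq] by auto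
    moreover from this have "\<xi> (j, k) = \<xi>' (j, k)" for j
      using out[of j] True by (cases "j = 1") (auto simp: l_def)
    ultimately show ?thesis by blast
  next
    case False
    then have "h \<ge> 2" using k by simp
    then have "1 \<le> h div 2" by linarith
    have row: "\<xi> (j, k) = \<xi>' (j, k)" for j
    proof (cases "1 \<le> j \<and> j \<le> k div 2")
      case j: True
      note le = inseparable_row_le[OF t ins] inseparable_row_le[OF t(2,1) inseparable_sym[OF ins]]
      show ?thesis
      \<comment> \<open>The first entry is the upper end of the first interval; every later entry is
        the lower end of the interval before it. For even \<open>k\<close> the last entry of row
        \<open>k\<close> is reached only in this way.\<close>
      proof (cases "j = 1")
        case True
        with le(1)[of 1] le(3)[of 1] \<open>1 \<le> h div 2\<close> show ?thesis by auto
      next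
        case False
        then obtain j' where "j = Suc j'" "1 \<le> j'" using j by (cases j) auto
        moreover from this have "j' \<le> h div 2" using j k(1) by simp
        ultimately show ?thesis using le(2)[of j'] le(4)[of j'] j by auto
      qed
    qed (rule out)
    \<comment> \<open>The lower corner matters for odd \<open>k\<close>: its last entry in row
      \<open>k - 1\<close> is 1/2, so the diagonal term carrying the sign is present.\<close>
    define \<eta> where "\<eta> = bottom_tableau \<xi>"
    define \<eta>' where "\<eta>' = graft h \<eta> \<xi>'"
    have \<eta>: "\<eta> \<in> tableaux i" unfolding \<eta>_def by (rule bottom_tableau[OF t(1)])
    have \<eta>_high: "\<xi> (j, k') = \<eta> (j, k')" if "h < k'" for j k'
      using that by (simp add: \<eta>_def top_bottom_tableau_high)
    have \<eta>': "\<eta>' \<in> tableaux i'" "inseparable i \<eta> i' \<eta>'"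
      unfolding \<eta>'_def using inseparable_transport[OF t(1) \<eta> t(2) \<eta>_high ins] by auto
    \<comment> \<open>The part of the generator's diagonal that lies on one key of level
      \<open>h\<close>; compression by the projection onto this key removes all off-diagonal
      entries.\<close>
    define f :: "bool \<Rightarrow> arr \<Rightarrow> complex" where
      "f = (\<lambda>i0 \<xi>0. (if key h i0 \<xi>0 = key h i \<eta> then 1 else 0) * gen_entry s r k (eps i0 k) \<xi>0 \<xi>0)"
    have "realized (diag f)"
    proof (rule realized_cong[OF realized_gen_transition[OF \<eta> \<eta> refl]])
      fix i0 \<xi>0 \<eta>0 assume "\<xi>0 \<in> tableaux i0"
      moreover have "graft h \<eta> \<xi>0 = \<xi>0" if "key h i0 \<xi>0 = key h i \<eta>" by (rule graft_key[OF that])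
      ultimately show "transition h (key h i \<eta>) \<eta> (\<lambda>i \<xi>. if graft h \<eta> \<xi> \<in> tableaux i
          then gen_entry s r k (eps i k) (graft h \<eta> \<xi>) \<xi> else 0) i0 \<eta>0 \<xi>0 = diag f i0 \<eta>0 \<xi>0"
        by (auto simp: transition_def diag_def f_def)
    qed
    moreover have "local_fun k f"
      unfolding f_def gen_entry_diag
    proof (intro local_fun_mult)
      show "local_fun k (\<lambda>i0 \<xi>0. if key h i0 \<xi>0 = key h i \<eta> then 1 else 0)"
        unfolding local_fun_def using k(1) by (metis key_mono le_SucI order_refl)
      show "local_fun k (\<lambda>i \<xi>. of_int (eps i k))" by (auto simp: local_fun_def key_eq_iff)
      show "local_fun k (\<lambda>i. diag_coeff s k)"
        unfolding local_fun_def by (intro allI ballI impI coeffs_local(3)) (auto simp: key_eq_iff)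
    qed
    ultimately have "f i \<eta> = f i' \<eta>'" using \<eta>'(2) unfolding inseparable_def by blast
    moreover have "key h i' \<eta>' = key h i \<eta>"
      using kh by (simp add: key_eq_iff \<eta>'_def graft_apply)
    ultimately have "of_int (eps i k) * diag_coeff s k \<eta> = of_int (eps i' k) * diag_coeff s k \<eta>'"
      by (simp add: f_def gen_entry_diag)
    \<comment> \<open>All rows up to \<open>k\<close> agree, so the coefficients do, and the common
      nonzero factor cancels from the signs.\<close>
    moreover have "diag_coeff s k \<eta> = diag_coeff s k \<eta>'"
    proof (rule coeffs_local(3))
      fix j k' assume "k' \<le> k"
      then show "\<eta> (j, k') = \<eta>' (j, k')"
        using row[of j] \<eta>_high[of k j] k(1) by (cases "k' = k") (auto simp: \<eta>'_def graft_apply)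
    qed
    moreover have "diag_coeff s k \<eta> \<noteq> 0"
    proof (rule diag_coeff_nonzero[OF adm \<eta> k(3)])
      assume "odd k"
      then have "(k div 2, h) \<in> positions h" using \<open>h \<ge> 2\<close> k(1) by (auto simp: positions_def)
      then show "\<eta> (k div 2, k - 1) = 1/2"
        using h_less by (simp add: h_eq[simplified] \<eta>_def bottom_tableau_def fill_apply lower_bound_def)
    qed
    ultimately have "(of_int (eps i k) :: complex) = of_int (eps i' k)" by simp
    then show ?thesis using row by simp
  qed
  then show ?thesis using kh k(1) by (auto simp: key_eq_iff le_Suc_eq)
qed

text \<open>Lagrange interpolation: for each tableau with a different key, one factor vanishes there
  and equals 1 at \<open>\<xi>0\<close>. Finitely many factors suffice, and locality spreads the
  value 1 over the whole key.\<close>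

lemma realized_key_projection:
  assumes "\<xi>0 \<in> tableaux i0"
  shows "realized (diag (\<lambda>i \<xi>. if key k i \<xi> = key k i0 \<xi>0 then 1 else 0))"
proof -
  define T where "T = (SIGMA i:UNIV. tableaux i)"
  have "\<exists>f. realized (diag f) \<and> local_fun k f \<and> f i0 \<xi>0 = 1 \<and>
      (\<forall>(i, \<xi>)\<in>B. key k i \<xi> \<noteq> key k i0 \<xi>0 \<longrightarrow> f i \<xi> = 0)" if "B \<subseteq> T" for B
  proof -
    have "finite T" unfolding T_def by (intro finite_SigmaI finite_tableaux) simp
    from finite_subset[OF that this] that show ?thesis
    proof (induction B rule: finite_induct)
      case empty
      show ?case by (intro exI[of _ "\<lambda>_ _. 1"]) (simp add: realized_const local_fun_const)
    next
      case (insert x B)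
      then obtain f where f: "realized (diag f)" "local_fun k f" "f i0 \<xi>0 = 1"
        "\<forall>(i, \<xi>)\<in>B. key k i \<xi> \<noteq> key k i0 \<xi>0 \<longrightarrow> f i \<xi> = 0" by auto
      obtain i1 \<xi>1 where x: "x = (i1, \<xi>1)" by fastforce
      then have t1: "\<xi>1 \<in> tableaux i1" using insert.prems by (simp add: T_def)
      show ?case
      proof (cases "key k i1 \<xi>1 = key k i0 \<xi>0")
        case True
        with f x show ?thesis by (intro exI[of _ f]) auto
      next
        case False
        then have "\<not> inseparable i0 \<xi>0 i1 \<xi>1" using inseparable_key[OF assms t1] by metis
        then obtain g where g: "realized (diag g)" "local_fun k g" "g i0 \<xi>0 \<noteq> g i1 \<xi>1"
          by (auto simp: inseparable_def)
        define c where "c = inverse (g i0 \<xi>0 - g i1 \<xi>1)"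
        have "local_fun k (\<lambda>i \<xi>. c * (g i \<xi> - g i1 \<xi>1))"
          unfolding local_fun_def using local_funD[OF g(2)] by metis
        then show ?thesis
          using f g x realized_diag_mult[OF f(1) realized_diag_affine[OF g(1), of c "g i1 \<xi>1"]]
          by (intro exI[of _ "\<lambda>i \<xi>. f i \<xi> * (c * (g i \<xi> - g i1 \<xi>1))"]) (auto simp: local_fun_mult c_def)
      qed
    qed
  qed
  from this[of T] obtain f where f: "realized (diag f)" "local_fun k f" "f i0 \<xi>0 = 1"
    "\<forall>(i, \<xi>)\<in>T. key k i \<xi> \<noteq> key k i0 \<xi>0 \<longrightarrow> f i \<xi> = 0" by auto
  have "f i \<xi> = (if key k i \<xi> = key k i0 \<xi>0 then 1 else 0)" if "\<xi> \<in> tableaux i" for i \<xi>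
    using f(3,4) local_funD[OF f(2) that assms] that by (auto simp: T_def)
  then show ?thesis by (intro realized_cong[OF f(1)]) (simp add: diag_def)
qed

text \<open>On a single key of level \<open>k\<close> the weight of a linking transition is constant
  and nonzero. Projecting onto that key first and dividing by the constant gives the matrix
  unit.\<close>

lemma matrix_units_step: "matrix_units k"
  unfolding matrix_units_def
proof (intro allI ballI impI)
  fix i i' \<xi> \<xi>' assume t: "\<xi> \<in> tableaux i" "\<xi>' \<in> tableaux i'"
    and row: "\<forall>j. \<xi> (j, k) = \<xi>' (j, k)"
  \<comment> \<open>Links connect tableaux of one representation, so the lower rows of
    \<open>\<xi>'\<close> are put on \<open>\<xi>\<close> to obtain a target there.\<close>
  define \<eta> where "\<eta> = graft k \<xi>' \<xi>"
  have \<eta>: "\<eta> \<in> tableaux i" unfolding \<eta>_def by (rule graft_tableau[OF t k(3)]) (simp add: row)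
  have "\<xi> (j, k') = \<eta> (j, k')" if "h < k'" for j k'
    using that row k(1) by (cases "k' = k") (auto simp: \<eta>_def graft_apply)
  from linked_all[OF t(1) \<eta> this] obtain c
    where c: "local_fun k c" "c i \<xi> \<noteq> 0" "realized (transition h (key h i \<xi>) \<eta> c)"
    by (auto simp: linked_def)
  have "realized (mat_mult (transition h (key h i \<xi>) \<eta> c) (diag (\<lambda>i0 \<xi>0. if key k i0 \<xi>0 = key k i \<xi> then 1 else 0)))"
    by (rule realized_mult[OF c(3) realized_key_projection[OF t(1)]])
  then have "realized (\<lambda>i0 \<eta>0 \<xi>0. inverse (c i \<xi>) * mat_mult (transition h (key h i \<xi>) \<eta> c)
      (diag (\<lambda>i0 \<xi>0. if key k i0 \<xi>0 = key k i \<xi> then 1 else 0)) i0 \<eta>0 \<xi>0)"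
    by (rule realized_scale)
  then show "realized (transition k (key k i \<xi>) \<xi>' (\<lambda>_ _. 1))"
  proof (rule realized_cong)
    fix i0 \<xi>0 \<eta>0 assume t0: "\<xi>0 \<in> tableaux i0"
    show "inverse (c i \<xi>) * mat_mult (transition h (key h i \<xi>) \<eta> c)
      (diag (\<lambda>i0 \<xi>0. if key k i0 \<xi>0 = key k i \<xi> then 1 else 0)) i0 \<eta>0 \<xi>0 =
      transition k (key k i \<xi>) \<xi>' (\<lambda>_ _. 1) i0 \<eta>0 \<xi>0"
    proof (cases "key k i0 \<xi>0 = key k i \<xi>")
      case True
      moreover have "key h i0 \<xi>0 = key h i \<xi>" by (rule key_mono[OF True]) (use k in simp)
      moreover have "c i0 \<xi>0 = c i \<xi>" by (rule local_funD[OF c(1) t0 t(1) True])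
      moreover have "graft h \<eta> \<xi>0 = graft k \<xi>' \<xi>0"
        using True row k(1) by (auto simp: eq_graft_iff graft_apply \<eta>_def key_eq_iff le_Suc_eq)
      ultimately show ?thesis using c(2) t0 by (simp add: mat_mult_diag_right transition_def)
    next
      case False
      then show ?thesis using t0 by (simp add: mat_mult_diag_right transition_def)
    qed
  qed
qed

end

lemma matrix_units:
  assumes "1 \<le> k" "k \<le> n"
  shows "matrix_units k"
  using assms
proof (induction rule: dec_induct)
  case base
  show ?case by (rule matrix_units_1)
next
  case (step k)
  then show ?case by (intro matrix_units_step[of "Suc k" k]) auto
qed

end

section \<open>Irreducibility and inequivalence\<close>

lemma linear_between_0: "linear_between V W f \<Longrightarrow> 0 \<in> V \<Longrightarrow> f 0 = 0"
  unfolding linear_between_def by (metis cscale_0(1))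

lemma zero_in_space_on: "0 \<in> space_on S"
  by (simp add: space_on_def)

lemma intertwiner_nonzero:
  assumes "linear_between (space_on S) W \<phi>" "inj_on \<phi> (space_on S)" "b \<in> S"
  shows "\<phi> (ket b) \<noteq> 0"
proof
  assume "\<phi> (ket b) = 0"
  then have "\<phi> (ket b) = \<phi> 0" using linear_between_0[OF assms(1) zero_in_space_on] by simp
  then have "ket b = 0" using assms(2,3) ket_in_space_on zero_in_space_on by (metis inj_onD)
  then show False by (simp add: ket_nonzero)
qed

context rep_pair
begin

lemma tableaux_eq_iff:
  assumes "\<xi> \<in> tableaux i" "\<xi> \<in> tableaux i'"
  shows "m i = m i'"
proof
  fix j
  show "m i j = m i' j"
  proof (cases "j \<in> {1..n div 2}")
    case True
    with assms show ?thesis by (metis nonclassical_tableaux_iff)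
  next
    case False
    with adm[of i] adm[of i'] show ?thesis
      by (auto simp: nonclassically_admissible_def PiE_def extensional_def)
  qed
qed

lemma key_n_iff:
  assumes "\<xi> \<in> tableaux i" "\<xi>' \<in> tableaux i'"
  shows "key n i \<xi> = key n i' \<xi>' \<longleftrightarrow> eps i = eps i' \<and> \<xi> = \<xi>'"
proof -
  have "eps i k = eps i' k" if "n < k" for k
    using adm[of i] adm[of i'] that by (auto simp: nonclassically_admissible_def PiE_def extensional_def)
  moreover have "\<xi> (j, k) = \<xi>' (j, k)" if "n < k" for j k
    using tableau_undefined[OF assms(1)] tableau_undefined[OF assms(2)] that by (simp add: positions_def)
  ultimately have "eps i = eps i' \<longleftrightarrow> (\<forall>k\<le>n. eps i k = eps i' k)"
    "\<xi> = \<xi>' \<longleftrightarrow> (\<forall>j k. k \<le> n \<longrightarrow> \<xi> (j, k) = \<xi>' (j, k))"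
    by (auto simp: fun_eq_iff) (meson not_le)+
  then show ?thesis by (simp add: key_eq_iff)
qed

text \<open>Level \<open>n\<close> leaves no rows above, so the transition is a genuine matrix unit.
  It survives in the other representation only if that one has the same signs and contains
  \<open>\<xi>\<close>, hence has the same top row.\<close>

lemma matrix_unit:
  assumes "1 \<le> n" "\<xi> \<in> tableaux i" "\<eta> \<in> tableaux i"
  obtains u where "u \<in> carrier (Uq n q)"
    "\<And>i' \<zeta>. \<zeta> \<in> tableaux i' \<Longrightarrow> rho i' u (ket \<zeta>) = (if eps i' = eps i \<and> \<zeta> = \<xi> then ket \<eta> else 0)"
proof -
  have "\<xi> (j, n) = \<eta> (j, n)" for j
  proof (cases "j \<in> {1..n div 2}")
    case True
    with assms show ?thesis by (simp add: nonclassical_tableaux_iff)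
  next
    case False
    then have "(j, n) \<notin> positions n" by (auto simp: positions_def)
    then show ?thesis using tableau_undefined assms(2,3) by metis
  qed
  then have "realized (transition n (key n i \<xi>) \<eta> (\<lambda>_ _. 1))"
    using matrix_units[OF assms(1) order_refl] assms(2,3) unfolding matrix_units_def by blast
  then obtain u where u: "u \<in> carrier (Uq n q)" and lookup: "\<And>i' \<zeta> \<zeta>'. \<zeta> \<in> tableaux i' \<Longrightarrow> \<zeta>' \<in> tableaux i' \<Longrightarrow>
      Poly_Mapping.lookup (rho i' u (ket \<zeta>)) \<zeta>' = transition n (key n i \<xi>) \<eta> (\<lambda>_ _. 1) i' \<zeta>' \<zeta>"
    unfolding realized_def by blast
  have "rho i' u (ket \<zeta>) = (if eps i' = eps i \<and> \<zeta> = \<xi> then ket \<eta> else 0)" if \<zeta>: "\<zeta> \<in> tableaux i'" for i' \<zeta>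
  proof (rule poly_mapping_eqI)
    fix \<zeta>'
    have sp: "rho i' u (ket \<zeta>) \<in> space_on (tableaux i')"
      using linear[OF u, of i'] ket_in_space_on[OF \<zeta>] by (simp add: linear_between_def)
    have "graft n \<eta> \<xi> = \<eta>"
      using tableau_undefined[OF assms(2)] tableau_undefined[OF assms(3)]
      by (auto simp: graft_def fun_eq_iff positions_def)
    then have tr: "transition n (key n i \<xi>) \<eta> (\<lambda>_ _. 1) i' \<zeta>' \<zeta> = (if eps i' = eps i \<and> \<zeta> = \<xi> \<and> \<zeta>' = \<eta> then 1 else 0)"
      using key_n_iff[OF \<zeta> assms(2)] by (auto simp: transition_def)
    show "Poly_Mapping.lookup (rho i' u (ket \<zeta>)) \<zeta>' =
      Poly_Mapping.lookup (if eps i' = eps i \<and> \<zeta> = \<xi> then ket \<eta> else 0) \<zeta>'"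
    proof (cases "\<zeta>' \<in> tableaux i'")
      case True
      then show ?thesis using lookup[OF \<zeta> True] tr by (auto simp: lookup_single when_def)
    next
      case False
      then have "\<zeta>' \<noteq> \<eta>" if "\<zeta> = \<xi>" using tableaux_eq_iff[of \<xi> i i'] assms \<zeta> that by auto
      then show ?thesis using sp False by (auto simp: space_on_iff lookup_single when_def)
    qed
  qed
  with u show thesis by (rule that)
qed

text \<open>A nonzero vector of an invariant subspace has a nonzero coordinate, and matrix units
  carry this coordinate to every basis vector.\<close>

lemma irreducible:
  assumes "1 \<le> n"
  shows "irreducible_representation n q (space_on (tableaux i)) (rho i)"
  unfolding irreducible_representation_def
proof (intro conjI allI impI)
  show "is_representation n q (space_on (tableaux i)) (rho i)" by (rule representation)
next
  have "ket (\<lambda>(j, k). if (j, k) \<in> positions n then m i j else undefined) \<in> space_on (tableaux i)" (is "ket ?\<xi> \<in> _")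
    by (rule ket_in_space_on[OF constant_tableau[OF adm]])
  moreover have "ket ?\<xi> \<noteq> 0" by (rule ket_nonzero)
  ultimately show "space_on (tableaux i) \<noteq> {0}" by blast
next
  interpret cs: vector_space cscale by (rule vector_space_cscale)
  fix W assume W: "module.subspace cscale W \<and> W \<subseteq> space_on (tableaux i) \<and>
    (\<forall>u\<in>carrier (Uq n q). \<forall>x\<in>W. rho i u x \<in> W)"
  show "W = {0} \<or> W = space_on (tableaux i)"
  proof (cases "W = {0}")
    case False
    with W obtain x where x: "x \<in> W" "x \<noteq> 0" using cs.subspace_0 by blast
    then obtain \<xi> where \<xi>: "Poly_Mapping.lookup x \<xi> \<noteq> 0" by (metis poly_mapping_eqI lookup_zero)
    have xV: "x \<in> space_on (tableaux i)" using x W by blast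
    with \<xi> have t: "\<xi> \<in> tableaux i" by (auto simp: space_on_iff)
    have ket: "ket \<eta> \<in> W" if \<eta>: "\<eta> \<in> tableaux i" for \<eta>
    proof -
      obtain u where u: "u \<in> carrier (Uq n q)"
        "\<And>i' \<zeta>. \<zeta> \<in> tableaux i' \<Longrightarrow> rho i' u (ket \<zeta>) = (if eps i' = eps i \<and> \<zeta> = \<xi> then ket \<eta> else 0)"
        using matrix_unit[OF assms t \<eta>] by blast
      have "rho i u x = (\<Sum>\<zeta>\<in>tableaux i. cscale (Poly_Mapping.lookup x \<zeta>) (rho i u (ket \<zeta>)))"
        by (rule linear_between_expand[OF finite_tableaux linear[OF u(1)] xV])
      also have "\<dots> = (\<Sum>\<zeta>\<in>tableaux i. if \<zeta> = \<xi> then cscale (Poly_Mapping.lookup x \<xi>) (ket \<eta>) else 0)"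
        by (intro sum.cong) (auto simp: u(2) cs.scale_zero_right)
      also have "\<dots> = cscale (Poly_Mapping.lookup x \<xi>) (ket \<eta>)"
        using t by (simp add: finite_tableaux)
      finally have "cscale (Poly_Mapping.lookup x \<xi>) (ket \<eta>) \<in> W" using W u(1) x(1) by metis
      then have "cscale (inverse (Poly_Mapping.lookup x \<xi>)) (cscale (Poly_Mapping.lookup x \<xi>) (ket \<eta>)) \<in> W"
        using W cs.subspace_scale by blast
      then show ?thesis using \<xi> by simp
    qed
    have "y \<in> W" if "y \<in> space_on (tableaux i)" for y
    proof -
      have "linear_between (space_on (tableaux i)) (space_on (tableaux i)) (\<lambda>x. x)"
        by (simp add: linear_between_def)
      from linear_between_expand[OF finite_tableaux this that]
      have "y = (\<Sum>\<eta>\<in>tableaux i. cscale (Poly_Mapping.lookup y \<eta>) (ket \<eta>))" .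
      moreover have "(\<Sum>\<eta>\<in>tableaux i. cscale (Poly_Mapping.lookup y \<eta>) (ket \<eta>)) \<in> W"
        using W by (intro cs.subspace_sum cs.subspace_scale ket) auto
      ultimately show ?thesis by simp
    qed
    with W show ?thesis by blast
  qed simp
qed

text \<open>A matrix unit that fixes a basis vector of one representation annihilates the other, so
  an intertwiner would kill that vector.\<close>

lemma inequivalent:
  assumes "1 \<le> n" "(eps i, m i) \<noteq> (eps i', m i')"
  shows "\<not> equivalent_representations n q (space_on (tableaux i)) (rho i) (space_on (tableaux i')) (rho i')"
proof
  assume "equivalent_representations n q (space_on (tableaux i)) (rho i) (space_on (tableaux i')) (rho i')"
  then obtain \<phi> where \<phi>: "linear_between (space_on (tableaux i)) (space_on (tableaux i')) \<phi>"
    "inj_on \<phi> (space_on (tableaux i))"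
    "\<And>u x. u \<in> carrier (Uq n q) \<Longrightarrow> x \<in> space_on (tableaux i) \<Longrightarrow> \<phi> (rho i u x) = rho i' u (\<phi> x)"
    by (auto simp: equivalent_representations_def bij_betw_def)
  obtain \<xi> where \<xi>: "\<xi> \<in> tableaux i" using constant_tableau[OF adm] by blast
  obtain u where u: "u \<in> carrier (Uq n q)"
    "\<And>i' \<zeta>. \<zeta> \<in> tableaux i' \<Longrightarrow> rho i' u (ket \<zeta>) = (if eps i' = eps i \<and> \<zeta> = \<xi> then ket \<xi> else 0)"
    using matrix_unit[OF assms(1) \<xi> \<xi>] by blast
  have "\<phi> (ket \<xi>) = rho i' u (\<phi> (ket \<xi>))"
    using \<phi>(3)[OF u(1) ket_in_space_on[OF \<xi>]] u(2)[OF \<xi>] by simp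
  also have "\<dots> = (\<Sum>\<zeta>\<in>tableaux i'. cscale (Poly_Mapping.lookup (\<phi> (ket \<xi>)) \<zeta>) (rho i' u (ket \<zeta>)))"
    using \<phi>(1) ket_in_space_on[OF \<xi>]
    by (intro linear_between_expand[OF finite_tableaux linear[OF u(1)]]) (simp add: linear_between_def)
  also have "\<dots> = 0"
  proof (rule sum.neutral, rule ballI)
    fix \<zeta> assume \<zeta>: "\<zeta> \<in> tableaux i'"
    then have "\<not> (eps i' = eps i \<and> \<zeta> = \<xi>)" using tableaux_eq_iff[OF \<xi>, of i'] assms(2) by auto
    then show "cscale (Poly_Mapping.lookup (\<phi> (ket \<xi>)) \<zeta>) (rho i' u (ket \<zeta>)) = 0"
      by (simp only: u(2)[OF \<zeta>] if_False cscale_0)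
  qed
  finally show False using intertwiner_nonzero[OF \<phi>(1,2) \<xi>] by simp
qed

end

text \<open>An intertwiner would match an eigenvalue of the first generator on one side with one on the
  other side.\<close>

lemma (in non_root) nonclassical_classical_inequivalent:
  assumes n: "2 \<le> n" and adm: "nonclassically_admissible n \<epsilon> m"
    and rep: "nonclassical_rep s r n q \<epsilon> m \<rho>" and rep': "classical_rep s r n q m' \<rho>'"
  shows "\<not> equivalent_representations n q
    (space_on (nonclassical_tableaux n m)) \<rho> (space_on (classical_tableaux n m')) \<rho>'"
proof
  let ?V = "space_on (nonclassical_tableaux n m)" and ?V' = "space_on (classical_tableaux n m')"
  let ?u = "Uq_class n q (gen 2)"
  assume "equivalent_representations n q ?V \<rho> ?V' \<rho>'"
  then obtain \<phi> where \<phi>: "linear_between ?V ?V' \<phi>" "inj_on \<phi> ?V"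
    "\<And>u x. u \<in> carrier (Uq n q) \<Longrightarrow> x \<in> ?V \<Longrightarrow> \<phi> (\<rho> u x) = \<rho>' u (\<phi> x)"
    by (auto simp: equivalent_representations_def bij_betw_def)
  have u: "?u \<in> carrier (Uq n q)" using n by (intro Uq_class_carrier gen_carrier) auto
  obtain \<xi> where \<xi>: "\<xi> \<in> nonclassical_tableaux n m" using constant_tableau[OF adm] by blast
  define c where "c = of_int (\<epsilon> 2) * qbr_plus s (l \<xi> 1 2)"
  have "\<forall>p. 2 \<le> 2*p \<and> 2*p \<le> n \<longrightarrow> \<rho> (Uq_class n q (gen (2*p))) (ket \<xi>) = nonclassical_even s r n \<epsilon> m p \<xi>"
    using rep \<xi> by (auto simp: nonclassical_rep_def)
  \<comment> \<open>At p = 1 the sums over j are empty, so I_{2,1} is diagonal on the tableau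
    basis.\<close>
  from this[rule_format, of 1] n have eig: "\<rho> ?u (ket \<xi>) = cscale c (ket \<xi>)"
    by (simp add: nonclassical_even_def coeff_C_hat_def c_def)
  define y where "y = \<phi> (ket \<xi>)"
  have y: "y \<in> ?V'" "y \<noteq> 0"
    using \<phi>(1) ket_in_space_on[OF \<xi>] intertwiner_nonzero[OF \<phi>(1,2) \<xi>] by (auto simp: y_def linear_between_def)
  then obtain \<eta> where \<eta>: "Poly_Mapping.lookup y \<eta> \<noteq> 0" by (metis poly_mapping_eqI lookup_zero)
  have mem: "\<zeta> \<in> classical_tableaux n m'" if "\<zeta> \<in> Poly_Mapping.keys y" for \<zeta>
    using y(1) that by (auto simp: space_on_def)
  have "cscale c y = \<phi> (\<rho> ?u (ket \<xi>))"
    using \<phi>(1) ket_in_space_on[OF \<xi>] by (simp add: eig y_def linear_between_def)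
  also have "\<dots> = \<rho>' ?u y" unfolding y_def by (rule \<phi>(3)[OF u ket_in_space_on[OF \<xi>]])
  finally have cy: "\<rho>' ?u y = cscale c y" ..
  have act: "\<rho>' ?u (ket \<zeta>) = cscale (\<i> * qbr s (l \<zeta> 1 2)) (ket \<zeta>)" if "\<zeta> \<in> classical_tableaux n m'" for \<zeta>
  proof -
    have "\<forall>p. 2 \<le> 2*p \<and> 2*p \<le> n \<longrightarrow> \<rho>' (Uq_class n q (gen (2*p))) (ket \<zeta>) = classical_even s r n m' p \<zeta>"
      using rep' that by (auto simp: classical_rep_def)
    \<comment> \<open>In the case l = 0 the coefficient C is set to 0, which agrees with [0] =
      0.\<close>
    from this[rule_format, of 1] n show ?thesis by (simp add: classical_even_def coeff_C_def qbr_def)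
  qed
  have "linear_between ?V' ?V' (\<rho>' ?u)"
    using rep' u by (simp add: classical_rep_def is_representation_def)
  \<comment> \<open>A vector has finite support, so the coordinate expansion is taken over the
    support of \<open>y\<close>.\<close>
  then have lin: "linear_between (space_on (Poly_Mapping.keys y)) ?V' (\<rho>' ?u)"
    using mem unfolding linear_between_def space_on_def by blast
  have "Poly_Mapping.lookup (\<rho>' ?u y) \<eta> =
      (\<Sum>\<zeta>\<in>Poly_Mapping.keys y. Poly_Mapping.lookup y \<zeta> * Poly_Mapping.lookup (\<rho>' ?u (ket \<zeta>)) \<eta>)"
    by (rule linear_between_lookup[OF finite_keys lin]) (simp add: space_on_def)
  also have "\<dots> = (\<Sum>\<zeta>\<in>Poly_Mapping.keys y. if \<zeta> = \<eta> then Poly_Mapping.lookup y \<eta> * (\<i> * qbr s (l \<eta> 1 2)) else 0)"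
    by (intro sum.cong) (auto simp: act mem lookup_cscale_ket)
  also have "\<dots> = Poly_Mapping.lookup y \<eta> * (\<i> * qbr s (l \<eta> 1 2))"
    using \<eta> by (simp add: in_keys_iff)
  finally have "c = \<i> * qbr s (l \<eta> 1 2)"
    using \<eta> by (simp add: cy lookup_cscale)
  moreover have "2 * l \<xi> 1 2 \<in> \<int>"
    using half_integers_double[OF tableau_l_half_integer[OF adm \<xi>, of 2 1]] n by simp
  moreover have "2 * l \<eta> 1 2 \<in> \<int>"
  proof -
    have "(1, 2) \<in> positions n" using n by (simp add: positions_def)
    moreover have "\<eta> \<in> (positions n \<rightarrow>\<^sub>E \<int>) \<union> (positions n \<rightarrow>\<^sub>E half_integers)"
      using mem[of \<eta>] \<eta> by (auto simp: classical_tableaux_def in_keys_iff)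
    ultimately have "\<eta> (1, 2) \<in> \<int> \<or> \<eta> (1, 2) \<in> half_integers" by auto
    then show ?thesis using half_integers_double by (auto simp: l_def)
  qed
  moreover have "\<epsilon> 2 \<in> {1, -1}" using adm n by (auto simp: nonclassically_admissible_def)
  ultimately show False using qbr_plus_neq_imaginary_qbr unfolding c_def by blast
qed

theorem theorem1:
  fixes n :: nat and q s :: complex and r :: "nat \<Rightarrow> complex"
  assumes "n \<ge> 3"
    and "q \<noteq> 0" and "\<forall>k::nat. k \<ge> 1 \<longrightarrow> q ^ k \<noteq> 1"
    and "s\<^sup>2 = q" and "bracket_roots s r"
  shows "(\<forall>\<epsilon> m \<rho>. nonclassically_admissible n \<epsilon> m \<and> nonclassical_rep s r n q \<epsilon> m \<rho> \<longrightarrow>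
            irreducible_representation n q (space_on (nonclassical_tableaux n m)) \<rho>) \<and>
         (\<forall>\<epsilon> m \<rho> \<epsilon>' m' \<rho>'.
            nonclassically_admissible n \<epsilon> m \<and> nonclassical_rep s r n q \<epsilon> m \<rho> \<and>
            nonclassically_admissible n \<epsilon>' m' \<and> nonclassical_rep s r n q \<epsilon>' m' \<rho>' \<and>
            (\<epsilon>, m) \<noteq> (\<epsilon>', m') \<longrightarrow>
            \<not> equivalent_representations n q
                (space_on (nonclassical_tableaux n m)) \<rho> (space_on (nonclassical_tableaux n m')) \<rho>') \<and>
         (\<forall>\<epsilon> m \<rho> m' \<rho>'.
            nonclassically_admissible n \<epsilon> m \<and> nonclassical_rep s r n q \<epsilon> m \<rho> \<and>
            classically_admissible n m' \<and> classical_rep s r n q m' \<rho>' \<longrightarrow>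
            \<not> equivalent_representations n q
                (space_on (nonclassical_tableaux n m)) \<rho> (space_on (classical_tableaux n m')) \<rho>')"
proof (intro conjI allI impI; elim conjE)
  interpret non_root q s r by unfold_locales (use assms in auto)
  fix \<epsilon> m \<rho>
  assume rep: "nonclassically_admissible n \<epsilon> m" "nonclassical_rep s r n q \<epsilon> m \<rho>"
  show "irreducible_representation n q (space_on (nonclassical_tableaux n m)) \<rho>"
  proof -
    interpret rep_pair q s r n "\<lambda>_. \<epsilon>" "\<lambda>_. m" "\<lambda>_. \<rho>"
      by unfold_locales (use rep in auto)
    show ?thesis using irreducible assms(1) by simp
  qed
  show "\<not> equivalent_representations n q
      (space_on (nonclassical_tableaux n m)) \<rho> (space_on (nonclassical_tableaux n m')) \<rho>'"
    if "nonclassically_admissible n \<epsilon>' m'" "nonclassical_rep s r n q \<epsilon>' m' \<rho>'" "(\<epsilon>, m) \<noteq> (\<epsilon>', m')"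
    for \<epsilon>' m' \<rho>'
  proof -
    interpret rep_pair q s r n "\<lambda>i. if i then \<epsilon> else \<epsilon>'" "\<lambda>i. if i then m else m'" "\<lambda>i. if i then \<rho> else \<rho>'"
      by unfold_locales (use rep that in auto)
    show ?thesis using inequivalent[of True False] assms(1) that(3) by simp
  qed
  show "\<not> equivalent_representations n q
      (space_on (nonclassical_tableaux n m)) \<rho> (space_on (classical_tableaux n m')) \<rho>'"
    if "classically_admissible n m'" "classical_rep s r n q m' \<rho>'" for m' \<rho>'
    using nonclassical_classical_inequivalent[OF _ rep that(2)] assms(1) by simp
qed

end
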